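(* Let $n=1$ and $a>1$. For $1\le q\le\infty$ and $s\in\mathbb{R}$, say that $(\ast)_{q,s}$ holds if there is a constant $C$ such that $$\|M^*f\|_{L^q(\mathbb{R})}\le C\,\|f\|_{H_s}\qquad\text{for all } f\in\mathcal{S}(\mathbb{R}).$$ Then: (1) for $1\le q<2$, $(\ast)_{q,s}$ holds for no $s$; (2) for $q=2$, $(\ast)_{q,s}$ holds for $s>a/4$ and does not hold for $s<a/4$; (3) for $2<q<4$, $(\ast)_{q,s}$ holds if and only if $s\ge \frac12-\frac a4+\frac aq-\frac1q$; (4) for $4\le q<\infty$, $(\ast)_{q,s}$ holds if and only if $s\ge\frac12-\frac1q$; (5) for $q=\infty$, $(\ast)_{q,s}$ holds if and only if $s>\frac12$.
   Context: $\mathcal{S}(\mathbb{R})$ is the Schwartz class and $\widehat f(\xi)=\int_{\mathbb{R}}e^{-ix\xi}f(x)\,dx$. For $f\in\mathcal{S}(\mathbb{R})$ and $t\in\mathbb{R}$, $$S_tf(x)=\int_{\mathbb{R}}e^{ix\xi}e^{it|\xi|^a}\widehat f(\xi)\,d\xi,\qquad x\in\mathbb{R},$$ and $M^*f(x)=\sup_{0<t<1}|S_tf(x)|$. The Sobolev norm is $\|f\|_{H_s}=\left(\int_{\mathbb{R}}(1+|\xi|^2)^s|\widehat f(\xi)|^2\,d\xi\right)^{1/2}$. *)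

theory Defs
  imports "HOL-Probability.Essential_Supremum"
begin

definition nth_derivative :: "nat \<Rightarrow> (real \<Rightarrow> complex) \<Rightarrow> real \<Rightarrow> complex" where
  "nth_derivative n f = ((\<lambda>g x. vector_derivative g (at x)) ^^ n) f"

text \<open>Differentiability of every iterated derivative is required explicitly, because
  \<^const>\<open>vector_derivative\<close> is an arbitrary value where the derivative does not exist.\<close>

definition schwartz :: "(real \<Rightarrow> complex) \<Rightarrow> bool" where
  "schwartz f \<longleftrightarrow>
     (\<forall>n. (\<forall>x. nth_derivative n f differentiable (at x)) \<and>
          (\<forall>k::nat. bounded (range (\<lambda>x. x ^ k *\<^sub>R nth_derivative n f x))))"

text \<open>No factor \<open>1 / (2 * pi)\<close> occurs, neither in the transform nor in the propagator.\<close>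

definition fourier :: "(real \<Rightarrow> complex) \<Rightarrow> real \<Rightarrow> complex" where
  "fourier f \<xi> =
     (LINT x|lborel. exp (- \<i> * complex_of_real (x * \<xi>)) * f x)"

definition propagator :: "real \<Rightarrow> real \<Rightarrow> (real \<Rightarrow> complex) \<Rightarrow> real \<Rightarrow> complex" where
  "propagator a t f x =
     (LINT \<xi>|lborel. exp (\<i> * complex_of_real (x * \<xi>))
        * exp (\<i> * complex_of_real (t * (\<bar>\<xi>\<bar> powr a))) * fourier f \<xi>)"

definition maximal_function :: "real \<Rightarrow> (real \<Rightarrow> complex) \<Rightarrow> real \<Rightarrow> ennreal" where
  "maximal_function a f x = (SUP t\<in>{0<..<1}. ennreal (cmod (propagator a t f x)))"

text \<open>Powers of extended nonnegative reals; meant for exponents \<open>p > 0\<close>.\<close>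

definition ennreal_power :: "ennreal \<Rightarrow> real \<Rightarrow> ennreal" where
  "ennreal_power x p = (if x = \<infinity> then \<infinity> else ennreal (enn2real x powr p))"

definition Lq_norm :: "ennreal \<Rightarrow> (real \<Rightarrow> ennreal) \<Rightarrow> ennreal" where
  "Lq_norm q g =
     (if q = \<infinity> then esssup lborel g
      else ennreal_power (\<integral>\<^sup>+x. ennreal_power (g x) (enn2real q) \<partial>lborel) (1 / enn2real q))"

definition sobolev_norm :: "real \<Rightarrow> (real \<Rightarrow> complex) \<Rightarrow> ennreal" where
  "sobolev_norm s f =
     ennreal_power (\<integral>\<^sup>+\<xi>. ennreal ((1 + \<bar>\<xi>\<bar>\<^sup>2) powr s * (cmod (fourier f \<xi>))\<^sup>2) \<partial>lborel) (1 / 2)"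

definition maximal_estimate :: "real \<Rightarrow> ennreal \<Rightarrow> real \<Rightarrow> bool" where
  "maximal_estimate a q s \<longleftrightarrow>
     (\<exists>C::real. \<forall>f. schwartz f \<longrightarrow>
        Lq_norm q (maximal_function a f) \<le> ennreal C * sobolev_norm s f)"

end

theory Submission
  imports Defs "HOL-Probability.Probability"
begin

text \<open>For the estimates that hold with \<open>q < \<infinity>\<close>, the supremum over \<open>t\<close> is replaced by a measurable time
  \<open>\<tau> x\<close>. By \<open>TT\<^sup>*\<close> it then suffices that the operator with kernel
  \<open>K (x - y) (\<tau> x - \<tau> y)\<close>, where
  \<open>K x t = \<integral> exp (\<i> (x \<xi> + t \<bar>\<xi>\<bar>\<^sup>a)) (1 + \<bar>\<xi>\<bar>)\<^bsup>- 2 s\<^esup> d\<xi>\<close>, maps the dual space of \<open>L\<^sup>q\<close> into \<open>L\<^sup>q\<close>.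
  Van der Corput's estimates around the stationary point, which for \<open>\<bar>t\<bar> \<le> 1\<close> lies beyond a multiple of
  \<open>\<bar>x\<bar>\<^bsup>1 / (a - 1)\<^esup>\<close>, give \<open>\<bar>K x t\<bar> \<le> C \<bar>x\<bar>\<^bsup>- 2 / q\<^esup>\<close> at the critical \<open>s\<close> for \<open>2 < q\<close>, and the
  Hardy-Littlewood-Sobolev inequality applies. For \<open>q = 2\<close> and \<open>s > a / 4\<close> the bound on \<open>K\<close> is integrable.
  For \<open>q = \<infinity>\<close> one uses the Cauchy-Schwarz inequality.

  The failures are seen on Gaussian packets: spread out in space (\<open>q < 2\<close>), concentrated at a
  point (\<open>q \<ge> 4\<close>), travelling at frequency \<open>N\<close> with the largest bandwidth that does not disperse before
  time 1 (\<open>2 \<le> q < 4\<close>), and superposed over dyadic scales (\<open>q = \<infinity>\<close>).\<close>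

section \<open>Oscillatory integrals\<close>

text \<open>As the times are arbitrary, every kernel bound must be uniform in t. For 1/4 \<le> s <
  1/2 cutting at frequency 1/|x| gives |x|^(2s-1) for all t; this is |x|^(-2/q) exactly at s = 1/2 -
  1/q, and then s \<ge> 1/4 means q \<ge> 4. For q < 4 this is not enough at large |x|, and |t|
  \<le> 1 must be exploited. A stationary point \<xi>0 contributes \<xi>0^(-2s) (\<xi>0/|x|)^(1/2),
  which decreases in \<xi>0; the smallest possible \<xi>0 gives |x|^(-\<beta>) with \<beta> = 1/2 +
  (2s - 1/2)/(a - 1). Solving \<beta> = 2/q yields the critical s for 2 < q < 4, and \<beta> > 1 is
  the condition s > a/4. The frequency cutoff N is carried through the estimates: the kernel bounds
  are uniform in N up to a term N^(-2s), which vanishes in the limit together with the tail of the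
  integrable transform.\<close>

lemma has_vector_derivative_cis:
  assumes "(f has_real_derivative p) (at x within S)"
  shows "((\<lambda>x. cis (f x)) has_vector_derivative (\<i> * of_real p * cis (f x))) (at x within S)"
proof -
  have "((\<lambda>x. cis (f x)) has_derivative (\<lambda>t. (p * t) *\<^sub>R (\<i> * cis (f x)))) (at x within S)"
    by (rule has_derivative_cis) (use assms in \<open>simp add: has_field_derivative_def\<close>)
  thus ?thesis
    by (simp add: has_vector_derivative_def scaleR_conv_of_real mult_ac)
qed

lemma norm_triangle_ineq3': "norm (x + y + z) \<le> norm x + norm y + norm (z :: 'a :: real_normed_vector)"
  by (meson add_right_mono norm_triangle_ineq order_trans)

text \<open>The product \<open>G x * cis (\<phi> x) / \<i>\<close> serves as an approximate
  antiderivative: for G = \<psi>/p the main part of its derivative is the integrand. The defect is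
  dominated by \<open>k'\<close>, so its integral is at most the increment of \<open>k\<close>, and
  estimates of total variation become differences of end values. Derivatives are asked for only
  inside the interval, since the second derivative of the phases below may be singular at 0.\<close>

lemma oscillatory_by_parts:
  fixes \<phi> p \<psi> k k' :: "real \<Rightarrow> real" and G g :: "real \<Rightarrow> complex"
  assumes AB: "A \<le> B"
    and cont: "continuous_on {A..B} \<phi>" "continuous_on {A..B} \<psi>" "continuous_on {A..B} G"
              "continuous_on {A..B} k"
    and d\<phi>: "\<And>x. A < x \<Longrightarrow> x < B \<Longrightarrow> (\<phi> has_real_derivative p x) (at x)"
    and dG: "\<And>x. A < x \<Longrightarrow> x < B \<Longrightarrow> (G has_vector_derivative g x) (at x)"
    and dk: "\<And>x. A < x \<Longrightarrow> x < B \<Longrightarrow> (k has_real_derivative k' x) (at x)"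
    and le: "\<And>x. A < x \<Longrightarrow> x < B \<Longrightarrow> cmod (g x + \<i> * of_real (p x) * G x - \<i> * of_real (\<psi> x)) \<le> k' x"
  shows "cmod (integral {A..B} (\<lambda>x. of_real (\<psi> x) * cis (\<phi> x))
           - (G B * cis (\<phi> B) - G A * cis (\<phi> A)) / \<i>) \<le> k B - k A"
proof -
  let ?H = "\<lambda>x. G x * cis (\<phi> x) / \<i>"
  let ?h = "\<lambda>x. (g x + \<i> * of_real (p x) * G x) * cis (\<phi> x) / \<i>"
  let ?f = "\<lambda>x. of_real (\<psi> x) * cis (\<phi> x)"
  have cis: "continuous_on {A..B} (\<lambda>x. cis (\<phi> x))"
    using cont(1) by (intro continuous_intros)
  have H: "(?h has_integral (?H B - ?H A)) {A..B}"
  proof (rule fundamental_theorem_of_calculus_interior[OF AB])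
    show "continuous_on {A..B} ?H" by (intro continuous_on_divide continuous_on_mult cont(3) cis continuous_on_const) auto
    fix x assume x: "x \<in> {A<..<B}"
    have "((\<lambda>x. G x * cis (\<phi> x)) has_vector_derivative
        (G x * (\<i> * of_real (p x) * cis (\<phi> x)) + g x * cis (\<phi> x))) (at x)"
      using x by (intro has_vector_derivative_mult has_vector_derivative_cis d\<phi> dG) auto
    hence "((\<lambda>x. G x * cis (\<phi> x) * (1/\<i>)) has_vector_derivative
        (G x * (\<i> * of_real (p x) * cis (\<phi> x)) + g x * cis (\<phi> x)) * (1/\<i>)) (at x)"
      by (rule has_vector_derivative_mult_left)
    thus "(?H has_vector_derivative ?h x) (at x)"
      by (simp add: algebra_simps)
  qed
  have f: "?f integrable_on {A..B}"
    by (intro integrable_continuous_real continuous_intros continuous_on_of_real cont cis)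
  have d: "((\<lambda>x. ?f x - ?h x) has_integral (integral {A..B} ?f - (?H B - ?H A))) {A..B}"
    using f H by (intro has_integral_diff) auto
  have k: "(k' has_integral (k B - k A)) {A..B}"
    using dk cont(4) by (intro fundamental_theorem_of_calculus_interior[OF AB])
      (auto simp: has_real_derivative_iff_has_vector_derivative)
  have "norm (integral {A<..<B} (\<lambda>x. ?f x - ?h x)) \<le> integral {A<..<B} k'"
  proof (rule integral_norm_bound_integral)
    show "(\<lambda>x. ?f x - ?h x) integrable_on {A<..<B}" "k' integrable_on {A<..<B}"
      using d k by (auto simp: integrable_on_Icc_iff_Ioo[symmetric] has_integral_integrable)
    fix x assume x: "x \<in> {A<..<B}"
    have "?f x - ?h x = - ((g x + \<i> * of_real (p x) * G x - \<i> * of_real (\<psi> x)) * cis (\<phi> x) / \<i>)"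
      by (simp add: field_simps)
    thus "norm (?f x - ?h x) \<le> k' x" using le[of x] x by (simp add: norm_mult norm_divide)
  qed
  moreover have "(G B * cis (\<phi> B) - G A * cis (\<phi> A)) / \<i> = ?H B - ?H A"
    by (rule diff_divide_distrib)
  ultimately show ?thesis
    using integral_unique[OF d] integral_unique[OF k] by (simp only: integral_open_interval_real)
qed

text \<open>Take G = \<psi>/p. Since p and p' keep their signs, 1/p moves monotonically within an
  interval of length 1/l, which costs \<psi>(A)/l. The variation of \<psi> costs (\<psi>(A) -
  \<psi>(B))/l and the boundary terms cost (\<psi>(A) + \<psi>(B))/l, in total 3
  \<psi>(A)/l.\<close>

lemma van_der_corput_first:
  fixes \<phi> p p' \<psi> \<psi>' :: "real \<Rightarrow> real"
  assumes AB: "A \<le> B" and l: "0 < l"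
    and d\<phi>: "\<And>x. A \<le> x \<Longrightarrow> x \<le> B \<Longrightarrow> (\<phi> has_real_derivative p x) (at x)"
    and dp: "\<And>x. A \<le> x \<Longrightarrow> x \<le> B \<Longrightarrow> (p has_real_derivative p' x) (at x)"
    and d\<psi>: "\<And>x. A \<le> x \<Longrightarrow> x \<le> B \<Longrightarrow> (\<psi> has_real_derivative \<psi>' x) (at x)"
    and \<psi>: "\<And>x. A \<le> x \<Longrightarrow> x \<le> B \<Longrightarrow> 0 \<le> \<psi> x" "\<And>x. A \<le> x \<Longrightarrow> x \<le> B \<Longrightarrow> \<psi>' x \<le> 0"
    and p: "(\<forall>x\<in>{A..B}. l \<le> p x) \<or> (\<forall>x\<in>{A..B}. p x \<le> - l)"
    and p': "(\<forall>x\<in>{A..B}. 0 \<le> p' x) \<or> (\<forall>x\<in>{A..B}. p' x \<le> 0)"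
  shows "cmod (integral {A..B} (\<lambda>x. of_real (\<psi> x) * cis (\<phi> x))) \<le> 3 * \<psi> A / l"
proof -
  \<comment> \<open>The sign r of p', and below the sign s of p, let all four sign patterns be
    treated at once.\<close>
  obtain r :: real where r: "r = 1 \<or> r = -1" "\<And>x. A \<le> x \<Longrightarrow> x \<le> B \<Longrightarrow> 0 \<le> r * p' x"
  proof (cases "\<forall>x\<in>{A..B}. 0 \<le> p' x")
    case True
    thus ?thesis by (intro that[of 1]) auto
  next
    case False
    hence "\<forall>x\<in>{A..B}. p' x \<le> 0" using p' by blast
    thus ?thesis by (intro that[of "-1"]) auto
  qed
  obtain s :: real where s: "s = 1 \<or> s = -1" "\<And>x. A \<le> x \<Longrightarrow> x \<le> B \<Longrightarrow> l \<le> s * p x"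
  proof (cases "\<forall>x\<in>{A..B}. l \<le> p x")
    case True
    thus ?thesis by (intro that[of 1]) auto
  next
    case False
    hence "\<forall>x\<in>{A..B}. p x \<le> - l" using p by blast
    hence "l \<le> - p x" if "A \<le> x" "x \<le> B" for x using that by force
    thus ?thesis by (intro that[of "-1"]) auto
  qed
  have pl: "l \<le> \<bar>p x\<bar>" if "A \<le> x" "x \<le> B" for x using s(1) s(2)[OF that] by auto
  hence p0: "p x \<noteq> 0" if "A \<le> x" "x \<le> B" for x using l that by force
  have \<psi>A: "\<psi> x \<le> \<psi> A" if "A \<le> x" "x \<le> B" for x
    using that d\<psi> \<psi>(2)
    by (intro DERIV_nonpos_imp_nonincreasing[of A x \<psi>]) (auto intro: order_trans)
  define G where "G = (\<lambda>x. complex_of_real (\<psi> x / p x))"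
  define g where "g = (\<lambda>x. complex_of_real (\<psi>' x / p x - \<psi> x * p' x / (p x)\<^sup>2))"
  \<comment> \<open>An antiderivative of -\<psi>'/l + \<psi>(A) |p'|/p^2, which dominates the
    derivative of \<psi>/p.\<close>
  define k where "k = (\<lambda>x. - \<psi> x / l - r * \<psi> A / p x)"
  define k' where "k' = (\<lambda>x. - \<psi>' x / l + r * \<psi> A * p' x / (p x)\<^sup>2)"
  have c: "continuous_on {A..B} \<phi>" "continuous_on {A..B} \<psi>" "continuous_on {A..B} p"
    by (rule DERIV_atLeastAtMost_imp_continuous_on, use d\<phi> d\<psi> dp in blast)+
  have "cmod (integral {A..B} (\<lambda>x. of_real (\<psi> x) * cis (\<phi> x))
           - (G B * cis (\<phi> B) - G A * cis (\<phi> A)) / \<i>) \<le> k B - k A"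
  proof (rule oscillatory_by_parts[OF AB c(1,2), where p = p and g = g and k' = k'])
    show "continuous_on {A..B} G" unfolding G_def
      using c p0 by (intro continuous_intros continuous_on_of_real) auto
    show "continuous_on {A..B} k" unfolding k_def
      using c p0 l by (intro continuous_intros) auto
    fix x assume x: "A < x" "x < B"
    show "(\<phi> has_real_derivative p x) (at x)" using d\<phi> x by simp
    have px: "p x \<noteq> 0" using p0 x by simp
    have dx: "(\<psi> has_real_derivative \<psi>' x) (at x)" "(p has_real_derivative p' x) (at x)"
      using x d\<psi> dp by auto
    have "((\<lambda>x. \<psi> x / p x) has_real_derivative (\<psi>' x / p x - \<psi> x * p' x / (p x)\<^sup>2)) (at x)"
      by (rule derivative_eq_intros dx refl | use px in \<open>simp add: field_simps power2_eq_square\<close>)+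
    thus "(G has_vector_derivative g x) (at x)"
      unfolding G_def g_def
      by (rule has_vector_derivative_of_real)
    show "(k has_real_derivative k' x) (at x)" unfolding k_def k'_def
      by (rule derivative_eq_intros dx refl | use px l in \<open>simp add: field_simps power2_eq_square\<close>)+
    have "cmod (g x + \<i> * of_real (p x) * G x - \<i> * of_real (\<psi> x)) = \<bar>\<psi>' x / p x - \<psi> x * p' x / (p x)\<^sup>2\<bar>"
      using px by (simp add: G_def g_def flip: norm_of_real[where 'a=complex])
    also have "\<dots> \<le> \<bar>\<psi>' x / p x\<bar> + \<bar>\<psi> x * p' x / (p x)\<^sup>2\<bar>" by (rule abs_triangle_ineq4)
    also have "\<bar>\<psi>' x / p x\<bar> \<le> - \<psi>' x / l"
      using pl[of x] \<psi>(2)[of x] x l unfolding abs_divide by (intro frac_le) auto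
    also have "\<bar>\<psi> x * p' x / (p x)\<^sup>2\<bar> \<le> \<psi> A * (r * p' x) / (p x)\<^sup>2"
    proof -
      have "\<bar>p' x\<bar> = r * p' x" using r(1) r(2)[of x] x by auto
      moreover have "\<bar>\<psi> x\<bar> \<le> \<psi> A" using \<psi>A[of x] \<psi>(1)[of x] x by auto
      ultimately show ?thesis unfolding abs_divide abs_mult abs_power2
        using r(2)[of x] x by (intro divide_right_mono mult_mono) auto
    qed
    finally show "cmod (g x + \<i> * of_real (p x) * G x - \<i> * of_real (\<psi> x)) \<le> k' x"
      by (simp add: k'_def mult_ac)
  qed
  hence "cmod (integral {A..B} (\<lambda>x. of_real (\<psi> x) * cis (\<phi> x))) \<le>
      cmod ((G B * cis (\<phi> B) - G A * cis (\<phi> A)) / \<i>) + (k B - k A)"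
    by (rule order_trans[OF norm_triangle_sub add_left_mono])
  also have "cmod ((G B * cis (\<phi> B) - G A * cis (\<phi> A)) / \<i>) \<le> \<psi> B / l + \<psi> A / l"
  proof -
    have *: "cmod (G x * cis (\<phi> x)) \<le> \<psi> x / l" if "A \<le> x" "x \<le> B" for x
      using pl[of x] \<psi>(1)[of x] that l unfolding G_def
      by (auto simp: norm_mult norm_divide intro!: frac_le)
    have "cmod (G B * cis (\<phi> B) - G A * cis (\<phi> A)) \<le> \<psi> B / l + \<psi> A / l"
      using *[of A] *[of B] AB
        by (intro order_trans[OF norm_triangle_ineq4] add_mono) auto
    moreover have "cmod (z / \<i>) = cmod z" for z by (subst norm_divide) simp
    ultimately show ?thesis by metis
  qed
  also have "k B - k A \<le> \<psi> A / l - \<psi> B / l + \<psi> A / l"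
  proof -
    have b: "0 \<le> s * (1 / p x) \<and> s * (1 / p x) \<le> 1 / l" if "A \<le> x" "x \<le> B" for x
    proof -
      have e: "s * (1 / p x) = 1 / (s * p x)" using s(1) by auto
      have "0 \<le> 1 / (s * p x)" "1 / (s * p x) \<le> 1 / l"
        using s(2)[OF that] l by (simp, intro frac_le) auto
      thus ?thesis by (simp only: e)
    qed
    have "r * (1 / p A - 1 / p B) \<le> 1 / l"
    proof -
      define u v where "u = 1 / p A" and "v = 1 / p B"
      have "0 \<le> s * u" "s * u \<le> 1 / l" "0 \<le> s * v" "s * v \<le> 1 / l"
        using b[of A] b[of B] AB by (auto simp: u_def v_def)
      thus ?thesis unfolding u_def[symmetric] v_def[symmetric] using r(1) s(1) by auto
    qed
    hence "\<psi> A * (r * (1 / p A - 1 / p B)) \<le> \<psi> A * (1 / l)"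
      using \<psi>(1)[of A] AB by (intro mult_left_mono) auto
    moreover have "k B - k A = \<psi> A / l - \<psi> B / l + \<psi> A * (r * (1 / p A - 1 / p B))"
      by (simp add: k_def right_diff_distrib mult_ac)
    ultimately show ?thesis by simp
  qed
  finally show ?thesis by simp
qed

text \<open>When the level v is not attained, c is an endpoint and one of the two pieces is empty.
  The disjunctions encode this, so that users need not ask whether a crossing exists.\<close>

lemma increasing_split_point:
  fixes p :: "real \<Rightarrow> real"
  assumes AB: "A \<le> B" and c: "continuous_on {A..B} p"
    and m: "\<And>x y. A \<le> x \<Longrightarrow> x \<le> y \<Longrightarrow> y \<le> B \<Longrightarrow> p x \<le> p y"
  obtains c where "A \<le> c" "c \<le> B" "c = A \<or> p c \<le> v" "c = B \<or> v \<le> p c"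
proof -
  consider "v \<le> p A" | "p B \<le> v" | "p A \<le> v" "v \<le> p B" by linarith
  thus ?thesis
  proof cases
    case 3
    then obtain c where "A \<le> c" "c \<le> B" "p c = v" using IVT'[of p A v B] AB c by auto
    thus ?thesis using that by auto
  qed (use AB that in auto)
qed

text \<open>Because p' \<ge> m, the set where |p| \<le> sqrt m has length at most 2/sqrt m, and the
  trivial bound suffices there. On either side of it the first-derivative estimate applies with l =
  sqrt m, the value that balances the pieces. The constant is 3 + 2 + 3.\<close>

lemma van_der_corput_second:
  fixes \<phi> p p' \<psi> \<psi>' :: "real \<Rightarrow> real"
  assumes AB: "A \<le> B" and m: "0 < m"
    and d\<phi>: "\<And>x. A \<le> x \<Longrightarrow> x \<le> B \<Longrightarrow> (\<phi> has_real_derivative p x) (at x)"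
    and dp: "\<And>x. A \<le> x \<Longrightarrow> x \<le> B \<Longrightarrow> (p has_real_derivative p' x) (at x)"
    and d\<psi>: "\<And>x. A \<le> x \<Longrightarrow> x \<le> B \<Longrightarrow> (\<psi> has_real_derivative \<psi>' x) (at x)"
    and \<psi>: "\<And>x. A \<le> x \<Longrightarrow> x \<le> B \<Longrightarrow> 0 \<le> \<psi> x" "\<And>x. A \<le> x \<Longrightarrow> x \<le> B \<Longrightarrow> \<psi>' x \<le> 0"
    and p': "\<And>x. A \<le> x \<Longrightarrow> x \<le> B \<Longrightarrow> m \<le> p' x"
  shows "cmod (integral {A..B} (\<lambda>x. of_real (\<psi> x) * cis (\<phi> x))) \<le> 8 * \<psi> A / sqrt m"
proof -
  let ?f = "\<lambda>x. complex_of_real (\<psi> x) * cis (\<phi> x)"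
  have c: "continuous_on {A..B} \<phi>" "continuous_on {A..B} \<psi>" "continuous_on {A..B} p"
    by (rule DERIV_atLeastAtMost_imp_continuous_on, use d\<phi> d\<psi> dp in blast)+
  have cf: "continuous_on {A..B} ?f"
    by (intro continuous_intros continuous_on_of_real c)
  have gr: "p x + m * (y - x) \<le> p y" if "A \<le> x" "x \<le> y" "y \<le> B" for x y
  proof (cases "x = y")
    case False
    have "\<exists>z>x. z < y \<and> p y - p x = (y - x) * p' z"
      using False that by (intro MVT2 dp) auto
    then obtain z where z: "z > x" "z < y" "p y - p x = (y - x) * p' z" by auto
    have "(y - x) * m \<le> (y - x) * p' z"
      using z p'[of z] that by (intro mult_left_mono) auto
    thus ?thesis using z by (simp add: algebra_simps)
  qed simp
  have mono: "p x \<le> p y" if "A \<le> x" "x \<le> y" "y \<le> B" for x y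
    using gr[OF that] m that mult_nonneg_nonneg[of m "y - x"] by linarith
  have \<psi>A: "\<psi> x \<le> \<psi> A" if "A \<le> x" "x \<le> B" for x
    using that d\<psi> \<psi>(2)
    by (intro DERIV_nonpos_imp_nonincreasing[of A x \<psi>]) (auto intro: order_trans)
  define d where "d = sqrt m"
  have d: "d > 0" "d * d = m" using m by (auto simp: d_def)
  obtain u where u: "A \<le> u" "u \<le> B" "u = A \<or> p u \<le> -d" "u = B \<or> -d \<le> p u"
    by (rule increasing_split_point[OF AB c(3), of "-d"]) (use mono in auto)
  obtain v where v: "A \<le> v" "v \<le> B" "v = A \<or> p v \<le> d" "v = B \<or> d \<le> p v"
    by (rule increasing_split_point[OF AB c(3), of d]) (use mono in auto)
  have uv: "u \<le> v"
  proof (rule ccontr)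
    assume "\<not> u \<le> v"
    hence "v < u" by simp
    hence "p u \<le> -d" "d \<le> p v" using u v by auto
    moreover have "p v \<le> p u" using mono u v \<open>v < u\<close> by simp
    ultimately show False using d by linarith
  qed
  have len: "v - u \<le> 2 / d"
  proof (cases "u = v")
    case False
    have "-d \<le> p u" "p v \<le> d" using u v uv False by auto
    hence "m * (v - u) \<le> 2 * d" using gr[of u v] u v uv by simp
    hence "d * (d * (v - u)) \<le> d * 2" using d(2) by (simp add: mult.assoc[symmetric])
    hence "d * (v - u) \<le> 2" using d by simp
    thus ?thesis using d by (simp add: field_simps)
  qed (use d in auto)
  have 1: "cmod (integral {A..u} ?f) \<le> 3 * \<psi> A / d"
  proof (cases "u = A")
    case False
    hence pu: "p u \<le> -d" using u by simp
    show ?thesis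
    proof (rule van_der_corput_first[where p = p and p' = p' and \<psi>' = \<psi>'])
      show "(\<forall>x\<in>{A..u}. d \<le> p x) \<or> (\<forall>x\<in>{A..u}. p x \<le> - d)"
        using order_trans[OF mono pu] u by auto
      show "(\<forall>x\<in>{A..u}. 0 \<le> p' x) \<or> (\<forall>x\<in>{A..u}. p' x \<le> 0)"
        using order_trans[OF less_imp_le[OF m] p'] u by auto
    qed (use u d d\<phi> dp d\<psi> \<psi> in auto)
  qed (use \<psi>(1)[of A] AB d in auto)
  have "cmod (integral {v..B} ?f) \<le> 3 * \<psi> v / d"
  proof (cases "v = B")
    case False
    hence pv: "d \<le> p v" using v by simp
    show ?thesis
    proof (rule van_der_corput_first[where p = p and p' = p' and \<psi>' = \<psi>'])
      show "(\<forall>x\<in>{v..B}. d \<le> p x) \<or> (\<forall>x\<in>{v..B}. p x \<le> - d)"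
        using order_trans[OF pv mono] v by auto
      show "(\<forall>x\<in>{v..B}. 0 \<le> p' x) \<or> (\<forall>x\<in>{v..B}. p' x \<le> 0)"
        using order_trans[OF less_imp_le[OF m] p'] v by auto
    qed (use v d d\<phi> dp d\<psi> \<psi> in auto)
  qed (use \<psi>(1)[of B] AB d in auto)
  also have "\<dots> \<le> 3 * \<psi> A / d" using \<psi>A[of v] v d by (intro divide_right_mono) auto
  finally have 3: "cmod (integral {v..B} ?f) \<le> 3 * \<psi> A / d" .
  have "cmod (integral {u..v} ?f) \<le> \<psi> A * (v - u)"
  proof (rule integral_bound[OF uv])
    show "continuous_on {u..v} ?f" using cf by (rule continuous_on_subset) (use u v in auto)
    show "cmod (?f x) \<le> \<psi> A" if "x \<in> {u..v}" for x
      using that \<psi>A[of x] \<psi>(1)[of x] u v by (simp add: norm_mult)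
  qed
  also have "\<dots> \<le> \<psi> A * (2 / d)" using len \<psi>(1)[of A] AB by (intro mult_left_mono) auto
  finally have 2: "cmod (integral {u..v} ?f) \<le> 2 * \<psi> A / d" by (simp add: mult.commute)
  have i: "?f integrable_on {A..B}" by (intro integrable_continuous_real cf)
  have "integral {A..u} ?f + integral {u..B} ?f = integral {A..B} ?f"
    by (rule Henstock_Kurzweil_Integration.integral_combine[OF u(1,2) i])
  moreover have "integral {u..v} ?f + integral {v..B} ?f = integral {u..B} ?f"
    by (rule Henstock_Kurzweil_Integration.integral_combine[OF uv v(2)])
       (rule integrable_on_subinterval[OF i], use u in auto)
  ultimately have "integral {A..B} ?f = integral {A..u} ?f + integral {u..v} ?f + integral {v..B} ?f"
    by (simp add: add.assoc)
  hence "cmod (integral {A..B} ?f) \<le> 3 * \<psi> A / d + 2 * \<psi> A / d + 3 * \<psi> A / d"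
    using 1 2 3 by (auto intro!: order_trans[OF norm_triangle_ineq3'] add_mono simp del: times_divide_eq_left)
  thus ?thesis by (simp add: d_def)
qed

text \<open>Comparable to \<open>(1 + \<xi>\<^sup>2)\<^bsup>- s\<^esup>\<close> for \<open>\<xi> \<ge> 0\<close>, but with monotone derivatives there.\<close>

definition sobolev_weight :: "real \<Rightarrow> real \<Rightarrow> real" where
  "sobolev_weight s \<xi> = (1 + \<xi>) powr (- 2 * s)"

section \<open>The truncated kernel on a half-line\<close>

definition half_kernel :: "real \<Rightarrow> real \<Rightarrow> real \<Rightarrow> real \<Rightarrow> real \<Rightarrow> complex" where
  "half_kernel a s N x t =
     integral {0..N} (\<lambda>\<xi>. of_real (sobolev_weight s \<xi>) * cis (t * \<xi> powr a - x * \<xi>))"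

lemma sobolev_weight_nonneg: "0 \<le> sobolev_weight s \<xi>"
  by (simp add: sobolev_weight_def)

lemma sobolev_weight_le_powr:
  assumes "0 \<le> r" "r \<le> s" "0 < \<xi>"
  shows "sobolev_weight s \<xi> \<le> \<xi> powr (- 2 * r)"
proof -
  have "sobolev_weight s \<xi> \<le> (1 + \<xi>) powr (- 2 * r)"
    unfolding sobolev_weight_def using assms by (intro powr_mono) auto
  also have "\<dots> \<le> \<xi> powr (- 2 * r)" using assms by (intro powr_mono2') auto
  finally show ?thesis .
qed

lemma sobolev_weight_antimono:
  assumes "0 \<le> s" "0 \<le> x" "x \<le> y"
  shows "sobolev_weight s y \<le> sobolev_weight s x"
  unfolding sobolev_weight_def using assms by (intro powr_mono2') auto

lemma sobolev_weight_deriv: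
  assumes "0 \<le> \<xi>"
  shows "(sobolev_weight s has_real_derivative (- 2 * s * (1 + \<xi>) powr (- 2 * s - 1))) (at \<xi>)"
  unfolding sobolev_weight_def [abs_def]
  by (rule derivative_eq_intros refl | use assms in \<open>simp\<close>)+

lemma phase_deriv:
  assumes "0 < \<xi>"
  shows "((\<lambda>\<xi>. t * \<xi> powr a - x * \<xi>) has_real_derivative (t * a * \<xi> powr (a - 1) - x)) (at \<xi>)"
    and "((\<lambda>\<xi>. t * a * \<xi> powr (a - 1) - x) has_real_derivative (t * a * (a - 1) * \<xi> powr (a - 2))) (at \<xi>)"
  by (rule derivative_eq_intros refl | use assms in \<open>simp\<close>)+

lemma half_kernel_integrand_continuous:
  assumes "0 \<le> A" "0 < a"
  shows "continuous_on {A..B} (\<lambda>\<xi>. complex_of_real (sobolev_weight s \<xi>) * cis (t * \<xi> powr a - x * \<xi>))"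
proof -
  have "continuous_on {A..B} (\<lambda>\<xi>. \<xi> powr a)"
    using assms by (intro continuous_on_powr' continuous_intros) auto
  moreover have "continuous_on {A..B} (sobolev_weight s)"
    unfolding sobolev_weight_def [abs_def] using assms by (intro continuous_intros) auto
  ultimately show ?thesis
    by (intro continuous_on_mult continuous_on_of_real continuous_on_cis continuous_on_diff
        continuous_on_const continuous_on_id)
qed

context
  fixes a s x :: real
  assumes a: "a > 1" and s: "0 \<le> s" and x: "x > 0"
begin

abbreviation (input) oscillation where
  "oscillation t \<equiv> \<lambda>\<xi>. complex_of_real (sobolev_weight s \<xi>) * cis (t * \<xi> powr a - x * \<xi>)"

lemma nonstationary_bound:
  assumes "0 < A" "A \<le> B" "0 < l"
    and "(\<forall>\<xi>\<in>{A..B}. l \<le> t * a * \<xi> powr (a - 1) - x) \<or> (\<forall>\<xi>\<in>{A..B}. t * a * \<xi> powr (a - 1) - x \<le> - l)"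
  shows "cmod (integral {A..B} (oscillation t)) \<le> 3 * sobolev_weight s A / l"
proof (rule van_der_corput_first[where p = "\<lambda>\<xi>. t * a * \<xi> powr (a - 1) - x"
      and p' = "\<lambda>\<xi>. t * a * (a - 1) * \<xi> powr (a - 2)"
      and \<psi>' = "\<lambda>\<xi>. - 2 * s * (1 + \<xi>) powr (- 2 * s - 1)"])
  show "(\<forall>\<xi>\<in>{A..B}. 0 \<le> t * a * (a - 1) * \<xi> powr (a - 2)) \<or>
        (\<forall>\<xi>\<in>{A..B}. t * a * (a - 1) * \<xi> powr (a - 2) \<le> 0)"
    using a by (cases "t \<ge> 0") (auto simp: mult_nonpos_nonneg)
qed (use assms phase_deriv sobolev_weight_deriv sobolev_weight_nonneg s in auto)

text \<open>For t \<le> 0 both terms of the phase derivative are at most 0, so there is no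
  stationary point and the derivative is at most -x.\<close>

lemma tail_bound_nonpos:
  assumes "0 < A" "A \<le> B" "t \<le> 0"
  shows "cmod (integral {A..B} (oscillation t)) \<le> 3 * sobolev_weight s A / x"
  using assms a x by (intro nonstationary_bound) (auto simp: mult_nonpos_nonneg)

text \<open>Here x0 is the stationary point. Below x0/2 and above 2 x0 the phase derivative has
  modulus at least c x, which gives the first term. In between, the second derivative is at least of
  order x/x0, which gives the factor sqrt(x0/x); the weight is taken where this middle piece begins.
  The constant D comes from the 8/sqrt m of the second-derivative estimate.\<close>

lemma tail_bound_pos:
  assumes AB: "0 < A" "A \<le> B" and x0: "0 < x0" "t * a * x0 powr (a - 1) = x" and t: "t > 0"
  defines "c \<equiv> 1 - 2 powr (1 - a)" and "D \<equiv> 8 * sqrt (2 * 2 powr (a - 1) / (a - 1))"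
  shows "cmod (integral {A..B} (oscillation t))
     \<le> 6 * sobolev_weight s A / (c * x) + D * sobolev_weight s (max A (x0 / 2)) * sqrt (x0 / x)"
proof -
  let ?f = "oscillation t" and ?\<psi> = "sobolev_weight s"
  have c: "0 < c" "c < 1"
  proof -
    have "(2::real) powr (1 - a) < 2 powr 0" using a by (intro powr_less_mono) auto
    thus "0 < c" "c < 1" by (auto simp: c_def)
  qed
  have half: "t * a * (x0 / 2) powr (a - 1) = x * (1 - c)"
  proof -
    have "(x0 / 2) powr (a - 1) = x0 powr (a - 1) * 2 powr (1 - a)"
      using x0 by (simp add: powr_divide powr_minus_divide[of 2 "a - 1", symmetric] flip: powr_minus_divide)
        (simp add: powr_diff)
    thus ?thesis using x0(2) by (simp add: c_def mult.assoc[symmetric])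
  qed
  \<comment> \<open>With y = 2^(a-1) this is y - 1 \<ge> 1 - 1/y, that is (y - 1)^2 \<ge> 0; thus
    one constant c serves both sides of x0.\<close>
  have double: "t * a * (2 * x0) powr (a - 1) \<ge> x * (1 + c)"
  proof -
    have "1 \<le> (2::real) powr (a - 1)" using a by (intro ge_one_powr_ge_zero) auto
    hence "(2 powr (a - 1) - 1) * (2 powr (a - 1) - 1) \<ge> (0::real)" by simp
    hence "2 - 1 / 2 powr (a - 1) \<le> (2::real) powr (a - 1)"
      by (simp add: field_simps)
    hence "1 + c \<le> 2 powr (a - 1)"
      using powr_minus_divide[of "2::real" "a - 1"] by (simp add: c_def)
    hence "x * (1 + c) \<le> x * 2 powr (a - 1)" using x by simp
    also have "\<dots> = t * a * (2 * x0) powr (a - 1)"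
      using x0 by (simp add: powr_mult mult_ac)
    finally show ?thesis .
  qed
  have mono: "t * a * u powr (a - 1) \<le> t * a * v powr (a - 1)" if "0 \<le> u" "u \<le> v" for u v
    using a t that by (intro mult_left_mono powr_mono2) auto
  \<comment> \<open>Clamping to [A, B] lets any of the three pieces be empty without a separate
    case.\<close>
  define u where "u = max A (min B (x0 / 2))"
  define v where "v = max A (min B (2 * x0))"
  have uv: "A \<le> u" "u \<le> v" "v \<le> B" using AB x0 by (auto simp: u_def v_def)
  have "cmod (integral {A..u} ?f) \<le> 3 * ?\<psi> A / (c * x)"
  proof (cases "u = A")
    case False
    hence u: "u \<le> x0 / 2" by (auto simp: u_def)
    show ?thesis
    proof (rule nonstationary_bound)
      have "t * a * \<xi> powr (a - 1) - x \<le> - (c * x)" if "\<xi> \<in> {A..u}" for \<xi>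
        using mono[of \<xi> "x0 / 2"] that u AB half by (simp add: algebra_simps)
      thus "(\<forall>\<xi>\<in>{A..u}. c * x \<le> t * a * \<xi> powr (a - 1) - x) \<or> (\<forall>\<xi>\<in>{A..u}. t * a * \<xi> powr (a - 1) - x \<le> - (c * x))"
        by blast
    qed (use AB uv c x in auto)
  qed (use sobolev_weight_nonneg[of s A] c x in auto)
  moreover have "cmod (integral {v..B} ?f) \<le> 3 * ?\<psi> A / (c * x)"
  proof (cases "v = B")
    case False
    hence v: "2 * x0 \<le> v" using AB by (auto simp: v_def)
    have "cmod (integral {v..B} ?f) \<le> 3 * ?\<psi> v / (c * x)"
    proof (rule nonstationary_bound)
      have "c * x \<le> t * a * \<xi> powr (a - 1) - x" if "\<xi> \<in> {v..B}" for \<xi>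
        using mono[of "2 * x0" \<xi>] that v AB x0 double by (simp add: algebra_simps)
      thus "(\<forall>\<xi>\<in>{v..B}. c * x \<le> t * a * \<xi> powr (a - 1) - x) \<or> (\<forall>\<xi>\<in>{v..B}. t * a * \<xi> powr (a - 1) - x \<le> - (c * x))"
        by blast
    qed (use AB uv c x in auto)
    also have "\<dots> \<le> 3 * ?\<psi> A / (c * x)"
      using c x uv AB s by (intro divide_right_mono mult_left_mono sobolev_weight_antimono) auto
    finally show ?thesis .
  qed (use sobolev_weight_nonneg[of s A] c x in auto)
  moreover have "cmod (integral {u..v} ?f) \<le> D * ?\<psi> (max A (x0 / 2)) * sqrt (x0 / x)"
  proof (cases "u = v")
    case False
    hence u: "u = max A (x0 / 2)" "u \<ge> x0 / 2" and v: "v \<le> 2 * x0"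
      using x0 AB by (auto simp: u_def v_def split: if_splits)
    \<comment> \<open>The second derivative is (a - 1)/\<xi> times the increasing function t a
      \<xi>^(a-1). Taking the latter at x0/2 and 1/\<xi> at 2 x0 gives a lower bound whatever the
      sign of a - 2.\<close>
    define m where "m = (a - 1) * (x * (1 - c)) / (2 * x0)"
    have m: "0 < m" using a c x x0 by (simp add: m_def)
    have "cmod (integral {u..v} ?f) \<le> 8 * ?\<psi> u / sqrt m"
    proof (rule van_der_corput_second[where p = "\<lambda>\<xi>. t * a * \<xi> powr (a - 1) - x"
      and p' = "\<lambda>\<xi>. t * a * (a - 1) * \<xi> powr (a - 2)"
      and \<psi>' = "\<lambda>\<xi>. - 2 * s * (1 + \<xi>) powr (- 2 * s - 1)"])
      fix \<xi> assume \<xi>: "u \<le> \<xi>" "\<xi> \<le> v"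
      hence pos: "0 < \<xi>" using AB uv by linarith
      have "m = (a - 1) * (t * a * (x0 / 2) powr (a - 1)) / (2 * x0)" by (simp add: m_def half)
      also have "\<dots> \<le> (a - 1) * (t * a * \<xi> powr (a - 1)) / \<xi>"
        using \<xi> u v pos a x0 mono[of "x0 / 2" \<xi>] t
        by (intro frac_le mult_left_mono) auto
      also have "\<dots> = t * a * (a - 1) * \<xi> powr (a - 2)"
      proof -
        have "\<xi> powr (a - 1) = \<xi> powr (a - 2) * \<xi>"
          using pos powr_add[of \<xi> "a - 2" 1] by simp
        thus ?thesis using pos by simp
      qed
      finally show "m \<le> t * a * (a - 1) * \<xi> powr (a - 2)" .
    qed (use uv AB m phase_deriv sobolev_weight_deriv sobolev_weight_nonneg s in auto)
    also have "8 * ?\<psi> u / sqrt m = D * ?\<psi> u * sqrt (x0 / x)"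
    proof -
      have e: "(2::real) powr (a - 1) = 1 / 2 powr (1 - a)"
        using powr_minus_divide[of "2::real" "1 - a"] by simp
      have "1 / m = 2 * 2 powr (a - 1) / (a - 1) * (x0 / x)"
        unfolding m_def c_def e using a x x0 by simp
      hence "sqrt (1 / m) = sqrt (2 * 2 powr (a - 1) / (a - 1)) * sqrt (x0 / x)"
        by (simp only: real_sqrt_mult)
      hence "1 / sqrt m = sqrt (2 * 2 powr (a - 1) / (a - 1)) * sqrt (x0 / x)"
        by (simp only: real_sqrt_divide[of 1] real_sqrt_one)
      hence "8 * ?\<psi> u * (1 / sqrt m) = 8 * ?\<psi> u * (sqrt (2 * 2 powr (a - 1) / (a - 1)) * sqrt (x0 / x))"
        by (rule arg_cong)
      thus ?thesis unfolding D_def by (simp add: mult_ac)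
    qed
    finally show ?thesis using u by simp
  next
    case True
    have "0 \<le> D * ?\<psi> (max A (x0 / 2)) * sqrt (x0 / x)"
      using a x x0 by (simp add: D_def sobolev_weight_nonneg)
    thus ?thesis using True by simp
  qed
  moreover have "integral {A..B} ?f = integral {A..u} ?f + integral {u..v} ?f + integral {v..B} ?f"
  proof -
    have i: "?f integrable_on {C..B}" if "0 \<le> C" for C
      using a that by (intro integrable_continuous_real half_kernel_integrand_continuous) auto
    have "integral {A..u} ?f + integral {u..B} ?f = integral {A..B} ?f"
      by (rule Henstock_Kurzweil_Integration.integral_combine) (use uv i AB in auto)
    moreover have "integral {u..v} ?f + integral {v..B} ?f = integral {u..B} ?f"
      by (rule Henstock_Kurzweil_Integration.integral_combine) (use uv i AB in auto)
    ultimately show ?thesis by (simp add: add.assoc)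
  qed
  ultimately show ?thesis
    using norm_triangle_ineq3'[of "integral {A..u} ?f" "integral {u..v} ?f" "integral {v..B} ?f"]
    by simp
qed

end

text \<open>The cut at frequency 1/x is dictated by scaling. Below it the modulus of the integrand
  is integrated, and r < 1/2 makes \<xi>^(-2r) integrable at 0; above it the tail bounds apply.
  Allowing r < s matters for large s: with r = 1/4 the bound still controls the singularity at x =
  0.\<close>

lemma half_kernel_bound:
  fixes a s r :: real
  assumes a: "a > 1" and r: "1 / 4 \<le> r" "r \<le> s" "r < 1 / 2"
  obtains C where "0 \<le> C"
    "\<And>N x t. 0 < N \<Longrightarrow> 0 < x \<Longrightarrow> cmod (half_kernel a s N x t) \<le> C * x powr (2 * r - 1)"
proof -
  define c :: real where "c = 1 - 2 powr (1 - a)"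
  define D where "D = 8 * sqrt (2 * 2 powr (a - 1) / (a - 1))"
  define C where "C = 1 / (1 - 2 * r) + 3 + 6 / c + D * sqrt 2"
  have c: "0 < c"
    using a powr_less_mono[of "1 - a" 0 "2::real"] by (simp add: c_def)
  have D: "0 \<le> D" using a by (simp add: D_def)
  have s: "0 \<le> s" using r by simp
  have start: "cmod (integral {0..M} (\<lambda>\<xi>. of_real (sobolev_weight s \<xi>) * cis (t * \<xi> powr a - x * \<xi>)))
      \<le> 1 / (1 - 2 * r) * M powr (1 - 2 * r)" (is "cmod (integral _ ?f) \<le> _") if "0 < M" for M x t
  proof -
    have i: "?f integrable_on {0..M}"
      using a by (intro integrable_continuous_real half_kernel_integrand_continuous) auto
    have p: "((\<lambda>\<xi>. \<xi> powr (- 2 * r)) has_integral (M powr (1 - 2 * r) / (1 - 2 * r))) {0..M}"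
      using has_integral_powr_from_0[of "-2*r" M] r that by (simp add: add.commute)
    have "norm (integral {0<..<M} ?f) \<le> integral {0<..<M} (\<lambda>\<xi>. \<xi> powr (- 2 * r))"
    proof (rule integral_norm_bound_integral)
      show "?f integrable_on {0<..<M}" "(\<lambda>\<xi>. \<xi> powr (- 2 * r)) integrable_on {0<..<M}"
        using i p by (auto simp: integrable_on_Icc_iff_Ioo[symmetric] has_integral_integrable)
      show "norm (?f \<xi>) \<le> \<xi> powr (- 2 * r)" if "\<xi> \<in> {0<..<M}" for \<xi>
        using sobolev_weight_le_powr[of r s \<xi>] r that
        by (simp add: norm_mult sobolev_weight_nonneg)
    qed
    thus ?thesis using integral_unique[OF p] by (simp add: integral_open_interval_real)
  qed
  have "cmod (half_kernel a s N x t) \<le> C * x powr (2 * r - 1)" if N: "0 < N" and x: "0 < x" for N x t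
  proof (cases "N \<le> 1 / x")
    case True
    have "cmod (half_kernel a s N x t) \<le> 1 / (1 - 2 * r) * N powr (1 - 2 * r)"
      unfolding half_kernel_def by (rule start[OF N])
    also have "\<dots> \<le> 1 / (1 - 2 * r) * (1 / x) powr (1 - 2 * r)"
      using True r N by (intro mult_left_mono powr_mono2) auto
    also have "(1 / x) powr (1 - 2 * r) = x powr (2 * r - 1)"
      using x powr_minus_divide[of x "1 - 2 * r"] by (simp add: powr_divide)
    also have "1 / (1 - 2 * r) * x powr (2 * r - 1) \<le> C * x powr (2 * r - 1)"
      using c D by (intro mult_right_mono) (auto simp: C_def)
    finally show ?thesis .
  next
    case False
    let ?f = "\<lambda>\<xi>. complex_of_real (sobolev_weight s \<xi>) * cis (t * \<xi> powr a - x * \<xi>)"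
    have A: "0 < 1 / x" "1 / x \<le> N" using x False by auto
    have w: "sobolev_weight s (1 / x) / x \<le> x powr (2 * r - 1)"
    proof -
      have "sobolev_weight s (1 / x) \<le> (1 / x) powr (- 2 * r)"
        using r A by (intro sobolev_weight_le_powr) auto
      also have "\<dots> = x powr (2 * r)" using x powr_minus_divide[of x "2 * r"] by (simp add: powr_divide)
      finally have "sobolev_weight s (1 / x) / x \<le> x powr (2 * r) / x"
        using x by (intro divide_right_mono) auto
      thus ?thesis using x by (simp add: powr_diff)
    qed
    have tail: "cmod (integral {1 / x..N} ?f) \<le> (3 + 6 / c + D * sqrt 2) * x powr (2 * r - 1)"
    proof (cases "t \<le> 0")
      case True
      have "cmod (integral {1 / x..N} ?f) \<le> 3 * (sobolev_weight s (1 / x) / x)"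
        using tail_bound_nonpos[OF a s x A True] by simp
      also have "\<dots> \<le> 3 * x powr (2 * r - 1)" using w by simp
      also have "\<dots> \<le> (3 + 6 / c + D * sqrt 2) * x powr (2 * r - 1)"
        using c D by (intro mult_right_mono) auto
      finally show ?thesis .
    next
      case False
      hence t: "t > 0" by simp
      define x0 where "x0 = (x / (t * a)) powr (1 / (a - 1))"
      have x0: "0 < x0" "t * a * x0 powr (a - 1) = x"
        using a t x by (auto simp: x0_def powr_powr)
      define m where "m = max (1 / x) (x0 / 2)"
      have m: "0 < m" "1 / x \<le> m" "x0 \<le> 2 * m"
        using A(1) by (auto simp: m_def less_max_iff_disj)
      have "sobolev_weight s m * sqrt (x0 / x) \<le> m powr (- 2 * r) * sqrt (2 * m / x)"
        using m x x0 r by (intro mult_mono sobolev_weight_le_powr real_sqrt_le_mono divide_right_mono) auto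
      also have "\<dots> = sqrt 2 * (m powr (- 2 * r) * m powr (1 / 2) * x powr (- 1 / 2))"
        using m x by (simp add: powr_half_sqrt real_sqrt_mult real_sqrt_divide powr_minus_divide)
      also have "m powr (- 2 * r) * m powr (1 / 2) = m powr (1 / 2 - 2 * r)"
        by (simp flip: powr_add)
      \<comment> \<open>This is the use of r \<ge> 1/4: the stationary contribution does not grow
        with m, so the worst case is m = 1/x, for every t.\<close>
      also have "m powr (1 / 2 - 2 * r) \<le> (1 / x) powr (1 / 2 - 2 * r)"
        using m A r by (intro powr_mono2') auto
      also have "(1 / x) powr (1 / 2 - 2 * r) = x powr (2 * r - 1 / 2)"
        using x powr_minus_divide[of x "1 / 2 - 2 * r"] by (simp add: powr_divide)
      also have "sqrt 2 * (x powr (2 * r - 1 / 2) * x powr (- 1 / 2)) = sqrt 2 * x powr (2 * r - 1)"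
        by (simp flip: powr_add)
      finally have 2: "sobolev_weight s m * sqrt (x0 / x) \<le> sqrt 2 * x powr (2 * r - 1)"
        using x by simp
      have "cmod (integral {1 / x..N} ?f) \<le> 6 * sobolev_weight s (1 / x) / (c * x) + D * sobolev_weight s m * sqrt (x0 / x)"
        using tail_bound_pos[OF a s x A x0 t] unfolding c_def D_def m_def by blast
      also have "\<dots> = 6 / c * (sobolev_weight s (1 / x) / x) + D * (sobolev_weight s m * sqrt (x0 / x))"
        by simp
      also have "\<dots> \<le> 6 / c * x powr (2 * r - 1) + D * (sqrt 2 * x powr (2 * r - 1))"
        using w 2 c D by (intro add_mono mult_left_mono) auto
      also have "\<dots> \<le> (3 + 6 / c + D * sqrt 2) * x powr (2 * r - 1)"
        by (simp add: algebra_simps)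
      finally show ?thesis .
    qed
    have i: "?f integrable_on {0..N}"
      using a by (intro integrable_continuous_real half_kernel_integrand_continuous) auto
    have "half_kernel a s N x t = integral {0..1 / x} ?f + integral {1 / x..N} ?f"
      unfolding half_kernel_def
      by (rule Henstock_Kurzweil_Integration.integral_combine[symmetric]) (use A i in auto)
    hence "cmod (half_kernel a s N x t) \<le> cmod (integral {0..1 / x} ?f) + cmod (integral {1 / x..N} ?f)"
      by (simp add: norm_triangle_ineq)
    also have "\<dots> \<le> 1 / (1 - 2 * r) * (1 / x) powr (1 - 2 * r) + (3 + 6 / c + D * sqrt 2) * x powr (2 * r - 1)"
      by (intro add_mono start tail A)
    also have "(1 / x) powr (1 - 2 * r) = x powr (2 * r - 1)"
      using x powr_minus_divide[of x "1 - 2 * r"] by (simp add: powr_divide)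
    finally show ?thesis by (simp add: C_def algebra_simps)
  qed
  moreover have "0 \<le> C" using c D r by (simp add: C_def)
  ultimately show ?thesis using that by blast
qed

text \<open>The contribution \<open>1 / (\<i> x)\<close> of the endpoint 0 is not integrable at infinity, but it cancels between
  the two half-lines in \<open>maximal_kernel\<close>. This matters only for \<open>q = 2\<close>.\<close>

lemma half_kernel_near_zero:
  fixes a s d c :: real
  assumes a: "a > 1" and s: "0 < s" and d: "0 < d" "d < a - 1" "d \<le> 2 * s" and c: "0 < c" "c < 1"
  obtains C where "0 \<le> C"
    "\<And>R x t. 0 \<le> R \<Longrightarrow> 1 \<le> x \<Longrightarrow> \<bar>t\<bar> \<le> 1 \<Longrightarrow> a * \<bar>t\<bar> * R powr (a - 1) \<le> (1 - c) * x \<Longrightarrow>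
       cmod (half_kernel a s R x t - 1 / (\<i> * of_real x))
         \<le> sobolev_weight s R / (c * x) + C * x powr (- 1 - d / (a - 1))"
proof -
  define Q where "Q = (a - 1) / (a - 1 - d) * a powr (d / (a - 1)) / c\<^sup>2"
  have Q0: "0 \<le> Q" using c d a by (simp add: Q_def)
  define C where "C = 4 * s + 2 * s / c\<^sup>2 + Q
     + 2 * s / c\<^sup>2 + 4 * s / c ^ 3"
  have "cmod (half_kernel a s R x t - 1 / (\<i> * of_real x))
         \<le> sobolev_weight s R / (c * x) + C * x powr (- 1 - d / (a - 1))"
    if R: "0 \<le> R" and x: "1 \<le> x" and t: "\<bar>t\<bar> \<le> 1" and small: "a * \<bar>t\<bar> * R powr (a - 1) \<le> (1 - c) * x"
    for R x t
  proof -
    define m where "m = c * x"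
    have m: "m > 0" using c x by (simp add: m_def)
    let ?\<psi> = "sobolev_weight s"
    define \<psi>1 where "\<psi>1 = (\<lambda>\<xi>::real. - 2 * s * (1 + \<xi>) powr (- 2 * s - 1))"
    define \<psi>2 where "\<psi>2 = (\<lambda>\<xi>::real. 2 * s * (2 * s + 1) * (1 + \<xi>) powr (- 2 * s - 2))"
    define \<phi> where "\<phi> = (\<lambda>\<xi>. t * \<xi> powr a - x * \<xi>)"
    define p where "p = (\<lambda>\<xi>. t * a * \<xi> powr (a - 1) - x)"
    define p' where "p' = (\<lambda>\<xi>. t * a * (a - 1) * \<xi> powr (a - 2))"
    \<comment> \<open>the second term of \<open>G\<close> removes \<open>\<psi>' / p\<close>, which decays too slowly in \<open>x\<close>, from the remainder\<close>
    define G where "G = (\<lambda>\<xi>. complex_of_real (?\<psi> \<xi> / p \<xi>) + \<i> * of_real (\<psi>1 \<xi> / (p \<xi>)\<^sup>2))"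
    define g where "g = (\<lambda>\<xi>. complex_of_real ((\<psi>1 \<xi> * p \<xi> - ?\<psi> \<xi> * p' \<xi>) / (p \<xi> * p \<xi>))
        + \<i> * of_real ((\<psi>2 \<xi> * (p \<xi>)\<^sup>2 - \<psi>1 \<xi> * (2 * p \<xi> * p' \<xi>)) / ((p \<xi>)\<^sup>2 * (p \<xi>)\<^sup>2)))"
    \<comment> \<open>Antiderivative of bounds for the three error terms \<psi> |p'|/p^2,
      \<psi>''/p^2 and 2 |\<psi>'| |p'|/|p|^3. The first uses \<psi> \<le> \<xi>^(-d), which trades
      decay of the weight for decay in x; the condition d < a - 1 keeps the antiderivative finite at
      0.\<close>
    define k where "k = (\<lambda>\<xi>. a * (a - 1) * \<bar>t\<bar> * \<xi> powr (a - 1 - d) / (a - 1 - d) / m\<^sup>2 + \<psi>1 \<xi> / m\<^sup>2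
        + 4 * s * a * \<bar>t\<bar> * \<xi> powr (a - 1) / m ^ 3)"
    define k' where "k' = (\<lambda>\<xi>. a * (a - 1) * \<bar>t\<bar> * \<xi> powr (a - 2 - d) / m\<^sup>2 + \<psi>2 \<xi> / m\<^sup>2
        + 4 * s * (a * (a - 1) * \<bar>t\<bar> * \<xi> powr (a - 2)) / m ^ 3)"
    have pm: "m \<le> \<bar>p \<xi>\<bar>" if "0 \<le> \<xi>" "\<xi> \<le> R" for \<xi>
    proof -
      have "\<bar>t * a * \<xi> powr (a - 1)\<bar> = a * \<bar>t\<bar> * \<xi> powr (a - 1)" using a by (simp add: abs_mult)
      also have "\<dots> \<le> a * \<bar>t\<bar> * R powr (a - 1)"
        using a that by (intro mult_left_mono powr_mono2) auto
      finally have "\<bar>t * a * \<xi> powr (a - 1)\<bar> \<le> (1 - c) * x" using small by simp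
      thus ?thesis by (simp add: p_def m_def algebra_simps)
    qed
    hence p0: "p \<xi> \<noteq> 0" if "0 \<le> \<xi>" "\<xi> \<le> R" for \<xi> using m that by force
    have powc: "continuous_on {0..R} (\<lambda>\<xi>. \<xi> powr b)" if "b > 0" for b
      using that by (intro continuous_on_powr' continuous_intros) auto
    have cp: "continuous_on {0..R} p"
      unfolding p_def using a by (intro continuous_on_diff continuous_on_mult powc continuous_on_const) auto
    have c\<psi>: "continuous_on {0..R} ?\<psi>" "continuous_on {0..R} \<psi>1"
      unfolding sobolev_weight_def [abs_def] \<psi>1_def by (intro continuous_intros; auto)+
    have main: "cmod (integral {0..R} (\<lambda>\<xi>. of_real (?\<psi> \<xi>) * cis (\<phi> \<xi>))
        - (G R * cis (\<phi> R) - G 0 * cis (\<phi> 0)) / \<i>) \<le> k R - k 0"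
    proof (rule oscillatory_by_parts[where p = p and g = g and k' = k'])
      show "continuous_on {0..R} \<phi>"
        unfolding \<phi>_def using a
        by (intro continuous_on_diff continuous_on_mult powc continuous_on_const continuous_on_id) auto
      show "continuous_on {0..R} G"
        unfolding G_def using p0
        by (intro continuous_on_add continuous_on_mult continuous_on_const continuous_on_of_real
              continuous_on_divide continuous_on_power cp c\<psi>) auto
      show "continuous_on {0..R} k"
        unfolding k_def using m a d
        by (intro continuous_on_add continuous_on_mult continuous_on_const
              continuous_on_divide c\<psi> powc) auto
      fix \<xi> assume \<xi>: "0 < \<xi>" "\<xi> < R"
      have px: "p \<xi> \<noteq> 0" "m \<le> \<bar>p \<xi>\<bar>" using p0 pm \<xi> by auto
      show "(\<phi> has_real_derivative p \<xi>) (at \<xi>)"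
        unfolding \<phi>_def p_def using phase_deriv(1) \<xi> by simp
      have dp: "(p has_real_derivative p' \<xi>) (at \<xi>)"
        unfolding p_def p'_def using phase_deriv(2) \<xi> by simp
      have d\<psi>: "(?\<psi> has_real_derivative \<psi>1 \<xi>) (at \<xi>)"
        unfolding \<psi>1_def using sobolev_weight_deriv \<xi> by simp
      have d\<psi>1: "(\<psi>1 has_real_derivative \<psi>2 \<xi>) (at \<xi>)"
        unfolding \<psi>1_def \<psi>2_def
        by (rule derivative_eq_intros refl | use \<xi> in \<open>simp add: algebra_simps\<close>)+
      have dp2: "((\<lambda>\<xi>. (p \<xi>)\<^sup>2) has_real_derivative (2 * p \<xi> * p' \<xi>)) (at \<xi>)"
        using DERIV_power[OF dp, of 2] by (simp add: mult_ac)
      show "(G has_vector_derivative g \<xi>) (at \<xi>)"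
        unfolding G_def g_def
        by (intro has_vector_derivative_add has_vector_derivative_mult_right has_vector_derivative_of_real
              DERIV_divide d\<psi> dp d\<psi>1 dp2) (use px in auto)
      show "(k has_real_derivative k' \<xi>) (at \<xi>)"
      proof -
        have dpow: "((\<lambda>\<xi>. \<xi> powr b) has_real_derivative b * \<xi> powr (b - 1)) (at \<xi>)" for b
          using \<xi> by (intro has_real_derivative_powr) auto
        have "(k has_real_derivative
          (a * (a - 1) * \<bar>t\<bar> * ((a - 1 - d) * \<xi> powr (a - 1 - d - 1)) / (a - 1 - d) / m\<^sup>2 + \<psi>2 \<xi> / m\<^sup>2
            + 4 * s * a * \<bar>t\<bar> * ((a - 1) * \<xi> powr (a - 1 - 1)) / m ^ 3)) (at \<xi>)"
          unfolding k_def by (intro DERIV_add DERIV_cdivide DERIV_cmult dpow d\<psi>1)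
        moreover have "q * ((a - 1 - d) * w) / (a - 1 - d) = q * w" for q w :: real
          using d by simp
        ultimately show ?thesis by (simp add: k'_def mult_ac diff_diff_eq)
      qed
      have "g \<xi> + \<i> * of_real (p \<xi>) * G \<xi> - \<i> * of_real (?\<psi> \<xi>) =
         of_real (- ?\<psi> \<xi> * p' \<xi> / (p \<xi>)\<^sup>2) + \<i> * of_real (\<psi>2 \<xi> / (p \<xi>)\<^sup>2 - 2 * \<psi>1 \<xi> * p' \<xi> / (p \<xi>) ^ 3)"
        using px by (simp add: G_def g_def field_simps power2_eq_square power3_eq_cube)
      also have "cmod \<dots> \<le> \<bar>- ?\<psi> \<xi> * p' \<xi> / (p \<xi>)\<^sup>2\<bar> + \<bar>\<psi>2 \<xi> / (p \<xi>)\<^sup>2 - 2 * \<psi>1 \<xi> * p' \<xi> / (p \<xi>) ^ 3\<bar>"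
        by (rule order_trans[OF norm_triangle_ineq]) (simp add: norm_mult del: of_real_divide of_real_diff of_real_mult of_real_minus)
      also have "\<dots> \<le> \<bar>- ?\<psi> \<xi> * p' \<xi> / (p \<xi>)\<^sup>2\<bar> + (\<bar>\<psi>2 \<xi> / (p \<xi>)\<^sup>2\<bar> + \<bar>2 * \<psi>1 \<xi> * p' \<xi> / (p \<xi>) ^ 3\<bar>)"
        by (intro add_left_mono abs_triangle_ineq4)
      also have "\<dots> = ?\<psi> \<xi> * \<bar>p' \<xi>\<bar> / \<bar>p \<xi>\<bar>\<^sup>2 + \<psi>2 \<xi> / \<bar>p \<xi>\<bar>\<^sup>2 + 2 * \<bar>\<psi>1 \<xi>\<bar> * \<bar>p' \<xi>\<bar> / \<bar>p \<xi>\<bar> ^ 3"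
      proof -
        have "0 \<le> \<psi>2 \<xi>" using s by (simp add: \<psi>2_def)
        thus ?thesis using sobolev_weight_nonneg[of s \<xi>]
          by (simp add: abs_mult power_abs)
      qed
      also have "\<dots> \<le> \<xi> powr (- d) * (a * (a - 1) * \<bar>t\<bar> * \<xi> powr (a - 2)) / m\<^sup>2 + \<psi>2 \<xi> / m\<^sup>2
          + 2 * (2 * s) * (a * (a - 1) * \<bar>t\<bar> * \<xi> powr (a - 2)) / m ^ 3"
      proof -
        have 1: "?\<psi> \<xi> \<le> \<xi> powr (- d)"
          using sobolev_weight_le_powr[of "d / 2" s \<xi>] d \<xi> by simp
        have 2: "\<bar>p' \<xi>\<bar> = a * (a - 1) * \<bar>t\<bar> * \<xi> powr (a - 2)" using a by (simp add: p'_def abs_mult)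
        have "(1 + \<xi>) powr (- 2 * s - 1) \<le> 1 powr (- 2 * s - 1)" using \<xi> s by (intro powr_mono2') auto
        hence 3: "\<bar>\<psi>1 \<xi>\<bar> \<le> 2 * s" using s by (simp add: \<psi>1_def abs_mult)
        have "0 \<le> \<psi>2 \<xi>" using s by (simp add: \<psi>2_def)
        thus ?thesis unfolding 2 using 1 3 px m a
          by (intro add_mono frac_le mult_mono power_mono) auto
      qed
      also have "\<xi> powr (- d) * (a * (a - 1) * \<bar>t\<bar> * \<xi> powr (a - 2)) = a * (a - 1) * \<bar>t\<bar> * \<xi> powr (a - 2 - d)"
        using powr_add[of \<xi> "- d" "a - 2"] by (simp add: algebra_simps)
      finally show "cmod (g \<xi> + \<i> * of_real (p \<xi>) * G \<xi> - \<i> * of_real (?\<psi> \<xi>)) \<le> k' \<xi>"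
        by (simp add: k'_def)
    qed (use R c\<psi> in auto)
    define y where "y = x powr (- 1 - d / (a - 1))"
    have d1: "0 < d / (a - 1)" "d / (a - 1) < 1" using d a by auto
    have xy: "1 / x\<^sup>2 \<le> y"
    proof -
      have "1 / x\<^sup>2 = x powr (- 2)" using x by (simp add: powr_minus_divide powr_numeral)
      also have "\<dots> \<le> y" unfolding y_def using x d1 by (intro powr_mono) auto
      finally show ?thesis .
    qed
    have y0: "0 \<le> y" by (simp add: y_def)
    have \<psi>1b: "\<bar>\<psi>1 \<xi>\<bar> \<le> 2 * s" if "0 \<le> \<xi>" for \<xi>
    proof -
      have "(1 + \<xi>) powr (- 2 * s - 1) \<le> 1 powr (- 2 * s - 1)" using that s by (intro powr_mono2') auto
      thus ?thesis using s by (simp add: \<psi>1_def abs_mult)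
    qed
    have m2: "1 / m\<^sup>2 \<le> y / c\<^sup>2"
      using divide_right_mono[OF xy, of "c\<^sup>2"] by (simp add: m_def power_mult_distrib mult.commute)
    have GR: "cmod (G R) \<le> ?\<psi> R / (c * x) + 2 * s * (y / c\<^sup>2)"
    proof -
      have "cmod (G R) \<le> \<bar>?\<psi> R / p R\<bar> + \<bar>\<psi>1 R / (p R)\<^sup>2\<bar>"
        unfolding G_def by (rule order_trans[OF norm_triangle_ineq]) (simp add: norm_mult del: of_real_divide)
      also have "\<dots> = ?\<psi> R / \<bar>p R\<bar> + \<bar>\<psi>1 R\<bar> / \<bar>p R\<bar>\<^sup>2"
        by (simp add: sobolev_weight_nonneg)
      also have "\<dots> \<le> ?\<psi> R / m + 2 * s / m\<^sup>2"
        using pm[of R] R m s \<psi>1b[of R]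
        by (intro add_mono frac_le power_mono) (auto simp: sobolev_weight_nonneg)
      also have "2 * s / m\<^sup>2 \<le> 2 * s * (y / c\<^sup>2)"
        using mult_left_mono[OF m2, of "2 * s"] s by simp
      finally show ?thesis by (simp add: m_def)
    qed
    \<comment> \<open>Since p(0) = -x and \<psi>(0) = 1, the lower endpoint contributes exactly
      1/(\<i> x), up to the O(1/x^2) from the second term of \<open>G\<close>.\<close>
    have G0: "cmod (- G 0 / \<i> - 1 / (\<i> * of_real x)) \<le> 2 * s * y"
    proof -
      have "G 0 = of_real (- 1 / x) + \<i> * of_real (- 2 * s / x\<^sup>2)"
        using a by (simp add: G_def p_def sobolev_weight_def \<psi>1_def)
      hence "- G 0 / \<i> - 1 / (\<i> * of_real x) = of_real (2 * s / x\<^sup>2)"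
        using x by (simp only:) (simp add: field_simps power2_eq_square)
      hence "cmod (- G 0 / \<i> - 1 / (\<i> * of_real x)) = 2 * s * (1 / x\<^sup>2)"
        using s by (simp add: norm_divide norm_mult norm_power)
      also have "\<dots> \<le> 2 * s * y" using xy s by (intro mult_left_mono) auto
      finally show ?thesis .
    qed
    have tR: "\<bar>t\<bar> * R powr (a - 1) \<le> x / a"
    proof -
      have "a * \<bar>t\<bar> * R powr (a - 1) \<le> x"
      proof -
        have "(1 - c) * x \<le> 1 * x" using c x by (intro mult_right_mono) auto
        thus ?thesis using small by linarith
      qed
      thus ?thesis using a by (simp add: field_simps)
    qed
    \<comment> \<open>Interpolation: the factor |t|^(d/(a-1)) is at most 1 because |t| \<le> 1, and
      the remaining power is one of |t| R^(a-1), which is at most x/a.\<close>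
    have tRd: "a * \<bar>t\<bar> * R powr (a - 1 - d) \<le> a powr (d / (a - 1)) * x powr (1 - d / (a - 1))"
    proof -
      have "\<bar>t\<bar> * R powr (a - 1 - d) = \<bar>t\<bar> powr (d / (a - 1)) * (\<bar>t\<bar> * R powr (a - 1)) powr (1 - d / (a - 1))"
      proof -
        have "(a - 1) * (1 - d / (a - 1)) = a - 1 - d" using a by (simp add: field_simps)
        moreover have "\<bar>t\<bar> powr (d / (a - 1)) * \<bar>t\<bar> powr (1 - d / (a - 1)) = \<bar>t\<bar>"
          by (simp flip: powr_add)
        ultimately show ?thesis by (simp add: powr_mult powr_powr mult.assoc[symmetric])
      qed
      also have "\<dots> \<le> 1 * (x / a) powr (1 - d / (a - 1))"
        using t tR d1 by (intro mult_mono powr_mono2 powr_le1) auto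
      also have "\<dots> = x powr (1 - d / (a - 1)) / a powr (1 - d / (a - 1))"
        using x a by (simp add: powr_divide)
      also have "a powr (1 - d / (a - 1)) = a / a powr (d / (a - 1))"
        using a by (simp add: powr_diff)
      finally have "\<bar>t\<bar> * R powr (a - 1 - d) \<le> x powr (1 - d / (a - 1)) / (a / a powr (d / (a - 1)))" .
      hence "a * (\<bar>t\<bar> * R powr (a - 1 - d)) \<le> a * (x powr (1 - d / (a - 1)) / (a / a powr (d / (a - 1))))"
        using a by (intro mult_left_mono) auto
      thus ?thesis using a by (simp add: field_simps)
    qed
    have "k R - k 0 = (a - 1) / (a - 1 - d) * (a * \<bar>t\<bar> * R powr (a - 1 - d)) / m\<^sup>2 + (\<psi>1 R - \<psi>1 0) / m\<^sup>2
        + 4 * s * (a * (\<bar>t\<bar> * R powr (a - 1))) / m ^ 3"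
      using diff_divide_distrib[of "\<psi>1 R" "\<psi>1 0" "m\<^sup>2"] by (simp add: k_def mult_ac)
    also have "\<dots> \<le> (a - 1) / (a - 1 - d) * (a powr (d / (a - 1)) * x powr (1 - d / (a - 1))) / m\<^sup>2 + 2 * s / m\<^sup>2
        + 4 * s * x / m ^ 3"
    proof -
      have "\<psi>1 R \<le> 0" using s by (simp add: \<psi>1_def)
      hence "\<psi>1 R - \<psi>1 0 \<le> 2 * s" using \<psi>1b[of 0] by linarith
      moreover have "a * (\<bar>t\<bar> * R powr (a - 1)) \<le> x" using tR a by (simp add: field_simps)
      ultimately show ?thesis using tRd m s d
        by (intro add_mono divide_right_mono mult_left_mono) auto
    qed
    also have "\<dots> = (a - 1) / (a - 1 - d) * a powr (d / (a - 1)) / c\<^sup>2 * (x powr (1 - d / (a - 1)) / x\<^sup>2)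
       + 2 * s * (1 / m\<^sup>2) + 4 * s / c ^ 3 * (1 / x\<^sup>2)"
      using x c by (simp add: m_def power_mult_distrib field_simps power3_eq_cube power2_eq_square)
    also have "x powr (1 - d / (a - 1)) / x\<^sup>2 = y"
    proof -
      have "x\<^sup>2 = x powr 2" using x by (simp add: powr_numeral)
      thus ?thesis unfolding y_def by (simp flip: powr_diff)
    qed
    finally have "k R - k 0 \<le> Q * y + 2 * s * (1 / m\<^sup>2) + 4 * s / c ^ 3 * (1 / x\<^sup>2)"
      by (simp only: Q_def)
    also have "\<dots> \<le> Q * y + 2 * s * (y / c\<^sup>2) + 4 * s / c ^ 3 * y"
      using m2 xy s c Q0 by (intro add_mono mult_left_mono) auto
    finally have kR: "k R - k 0 \<le> Q * y + 2 * s * (y / c\<^sup>2) + 4 * s / c ^ 3 * y" .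
    have "half_kernel a s R x t - 1 / (\<i> * of_real x) =
       (integral {0..R} (\<lambda>\<xi>. of_real (?\<psi> \<xi>) * cis (\<phi> \<xi>)) - (G R * cis (\<phi> R) - G 0 * cis (\<phi> 0)) / \<i>)
       + (G R * cis (\<phi> R) / \<i> + (- G 0 / \<i> - 1 / (\<i> * of_real x)))"
      using a by (simp add: half_kernel_def \<phi>_def right_diff_distrib)
    also have "cmod \<dots> \<le> (k R - k 0) + (cmod (G R) + 2 * s * y)"
      using main G0
      by (intro order_trans[OF norm_triangle_ineq] add_mono) (auto simp: norm_mult norm_divide)
    also have "\<dots> \<le> ?\<psi> R / (c * x) + C * y"
    proof -
      have "C * y = 4 * s * y + 2 * s * (y / c\<^sup>2) + Q * y + 2 * s * (y / c\<^sup>2) + 4 * s / c ^ 3 * y"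
        by (simp add: C_def distrib_right)
      moreover have "0 \<le> s * y" using y0 s by simp
      ultimately show ?thesis using kR GR by simp
    qed
    finally show ?thesis by (simp add: y_def)
  qed
  moreover have "0 \<le> C" using c s d a by (simp add: C_def Q_def)
  ultimately show ?thesis using that by blast
qed

text \<open>The range is cut at x0/2: the expansion at the endpoint 0 is used below, the tail bounds
  above. Since |t| \<le> 1, x0 is at least (x/a)^(1/(a-1)), which turns powers of x0 into powers of
  x. The first condition on \<beta> comes from the stationary region, the second from the remainder
  at 0. The term N^(-2s) is the boundary term of a truncation that occurs before x0/2.\<close>

lemma half_kernel_asymptotics:
  fixes a s \<beta> d :: real
  assumes a: "a > 1" and s: "1 / 4 \<le> s" and d: "0 < d" "d < a - 1" "d \<le> 2 * s"
    and \<beta>: "\<beta> \<le> 1 / 2 + (2 * s - 1 / 2) / (a - 1)" "\<beta> \<le> 1 + d / (a - 1)"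
  obtains C where "0 \<le> C"
    "\<And>N x t. 1 \<le> N \<Longrightarrow> 1 \<le> x \<Longrightarrow> \<bar>t\<bar> \<le> 1 \<Longrightarrow>
       cmod (half_kernel a s N x t - 1 / (\<i> * of_real x)) \<le> C * (x powr (- \<beta>) + N powr (- 2 * s))"
proof -
  define c :: real where "c = 1 - 2 powr (1 - a)"
  define D where "D = 8 * sqrt (2 * 2 powr (a - 1) / (a - 1))"
  have c: "0 < c" "c < 1"
    using a powr_less_mono[of "1 - a" 0 "2::real"] by (simp_all add: c_def)
  have D: "0 \<le> D" using a by (simp add: D_def)
  have s0: "0 < s" "0 \<le> s" using s by auto
  obtain C0 where C0: "0 \<le> C0"
    "\<And>R x t. 0 \<le> R \<Longrightarrow> 1 \<le> x \<Longrightarrow> \<bar>t\<bar> \<le> 1 \<Longrightarrow> a * \<bar>t\<bar> * R powr (a - 1) \<le> (1 - c) * x \<Longrightarrow>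
       cmod (half_kernel a s R x t - 1 / (\<i> * of_real x))
         \<le> sobolev_weight s R / (c * x) + C0 * x powr (- 1 - d / (a - 1))"
    using half_kernel_near_zero[OF a s0(1) d c] by blast
  define E where "E = 2 powr (2 * s) * a powr (2 * s / (a - 1))"
  define F where "F = 2 powr (2 * s) * a powr (- ((1 / 2 - 2 * s) / (a - 1)))"
  have EF: "0 \<le> E" "0 \<le> F" by (auto simp: E_def F_def)
  define C where "C = 1 / c + C0 + (1 / c + 3 + 6 / c) * E + D * F"
  have C: "0 \<le> C" using c C0 D EF by (simp add: C_def)
  have "cmod (half_kernel a s N x t - 1 / (\<i> * of_real x)) \<le> C * (x powr (- \<beta>) + N powr (- 2 * s))"
    if N: "1 \<le> N" and x: "1 \<le> x" and t: "\<bar>t\<bar> \<le> 1" for N x t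
  proof -
    have y: "x powr (- 1 - d / (a - 1)) \<le> x powr (- \<beta>)"
      using x \<beta> by (intro powr_mono) auto
    \<comment> \<open>The modulus of t makes the same cut available for negative t, where nothing is
      stationary. For t = 0 the formula degenerates to 0, hence the separate alternative in the case
      distinction.\<close>
    define x0 where "x0 = (x / (\<bar>t\<bar> * a)) powr (1 / (a - 1))"
    show ?thesis
    proof (cases "t = 0 \<or> N \<le> x0 / 2")
      case True
      have "a * \<bar>t\<bar> * N powr (a - 1) \<le> (1 - c) * x"
      proof (cases "t = 0")
        case False
        hence "N powr (a - 1) \<le> (x0 / 2) powr (a - 1)" using True a N by (intro powr_mono2) auto
        also have "\<dots> = x / (\<bar>t\<bar> * a) * 2 powr (1 - a)"
        proof -
          have "x0 powr (a - 1) = x / (\<bar>t\<bar> * a)" using x a False by (simp add: x0_def powr_powr)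
          moreover have "1 / 2 powr (a - 1) = (2::real) powr (1 - a)"
            using powr_minus_divide[of "2::real" "a - 1"] by simp
          ultimately show ?thesis
            by (simp only: powr_divide) (metis mult.right_neutral times_divide_eq_right)
        qed
        finally have "a * \<bar>t\<bar> * N powr (a - 1) \<le> a * \<bar>t\<bar> * (x / (\<bar>t\<bar> * a) * 2 powr (1 - a))"
          using a by (intro mult_left_mono) auto
        also have "\<dots> = (1 - c) * x" using False a by (simp add: c_def)
        finally show ?thesis .
      qed (use c x in auto)
      hence "cmod (half_kernel a s N x t - 1 / (\<i> * of_real x))
         \<le> sobolev_weight s N / (c * x) + C0 * x powr (- 1 - d / (a - 1))"
        using C0(2)[of N x t] N x t by simp
      also have "sobolev_weight s N / (c * x) \<le> N powr (- 2 * s) / (c * 1)"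
        using sobolev_weight_le_powr[of s s N] s0 N c x
        by (intro frac_le mult_left_mono) auto
      also have "C0 * x powr (- 1 - d / (a - 1)) \<le> C0 * x powr (- \<beta>)"
        using y C0 by (intro mult_left_mono) auto
      also have "N powr (- 2 * s) / (c * 1) = 1 / c * N powr (- 2 * s)" by simp
      also have "1 / c * N powr (- 2 * s) \<le> C * N powr (- 2 * s)"
        using C0 c EF D by (intro mult_right_mono) (auto simp: C_def)
      also have "C0 * x powr (- \<beta>) \<le> C * x powr (- \<beta>)"
        using C0 c EF D by (intro mult_right_mono) (auto simp: C_def)
      finally show ?thesis by (simp add: algebra_simps)
    next
      case False
      hence t0: "t \<noteq> 0" and Nx: "x0 / 2 \<le> N" by auto
      have x0: "0 < x0" using x a t0 by (simp add: x0_def)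
      have x0a: "\<bar>t\<bar> * a * x0 powr (a - 1) = x" using x a t0 by (simp add: x0_def powr_powr)
      have x0l: "(x / a) powr (1 / (a - 1)) \<le> x0"
        unfolding x0_def using x a t t0 by (intro powr_mono2 divide_left_mono) auto
      have pl: "0 < (x / a) powr (1 / (a - 1))" using x a by simp
      define w where "w = sobolev_weight s (x0 / 2)"
      have w0: "0 \<le> w" by (simp add: w_def sobolev_weight_nonneg)
      have w: "w \<le> 2 powr (2 * s) * x0 powr (- 2 * s)"
      proof -
        have "w \<le> (x0 / 2) powr (- 2 * s)"
          unfolding w_def using x0 s0 by (intro sobolev_weight_le_powr) auto
        also have "\<dots> = x0 powr (- 2 * s) * (1 / 2 powr (- 2 * s))" using x0 by (simp add: powr_divide)
        also have "1 / 2 powr (- 2 * s) = (2::real) powr (2 * s)"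
          using powr_minus_divide[of "2::real" "- 2 * s"] by simp
        finally show ?thesis by (simp add: mult.commute)
      qed
      have wx: "w / x \<le> E * x powr (- \<beta>)"
      proof -
        have "x0 powr (- 2 * s) \<le> ((x / a) powr (1 / (a - 1))) powr (- 2 * s)"
          using x0l pl s0 by (intro powr_mono2') auto
        also have "\<dots> = x powr (- (2 * s / (a - 1))) * (1 / a powr (- (2 * s / (a - 1))))"
          using x a by (simp add: powr_powr powr_divide)
        also have "1 / a powr (- (2 * s / (a - 1))) = a powr (2 * s / (a - 1))"
          using powr_minus_divide[of a "- (2 * s / (a - 1))"] by simp
        finally have "w \<le> 2 powr (2 * s) * (x powr (- (2 * s / (a - 1))) * a powr (2 * s / (a - 1)))"
          by (intro order_trans[OF w mult_left_mono]) auto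
        hence "w / x \<le> 2 powr (2 * s) * (x powr (- (2 * s / (a - 1))) * a powr (2 * s / (a - 1))) / x"
          using x by (intro divide_right_mono) auto
        also have "\<dots> = E * (x powr (- (2 * s / (a - 1))) / x)" by (simp add: E_def)
        also have "x powr (- (2 * s / (a - 1))) / x = x powr (- (2 * s / (a - 1)) - 1)"
          using x by (simp add: powr_diff)
        also have "E * \<dots> \<le> E * x powr (- \<beta>)"
        proof -
          have "d / (a - 1) \<le> 2 * s / (a - 1)" using d a by (intro divide_right_mono) auto
          hence "- (2 * s / (a - 1)) - 1 \<le> - \<beta>" using \<beta>(2) by linarith
          thus ?thesis using EF x by (intro mult_left_mono powr_mono) auto
        qed
        finally show ?thesis .
      qed
      have wq: "w * sqrt (x0 / x) \<le> F * x powr (- \<beta>)"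
      proof -
        have "w * sqrt (x0 / x) \<le> 2 powr (2 * s) * x0 powr (- 2 * s) * sqrt (x0 / x)"
          using w x0 x by (intro mult_right_mono) auto
        also have "\<dots> = 2 powr (2 * s) * (x0 powr (- 2 * s) * x0 powr (1 / 2)) * x powr (- (1 / 2))"
          using x x0 by (simp add: powr_half_sqrt real_sqrt_divide powr_minus_divide)
        also have "x0 powr (- 2 * s) * x0 powr (1 / 2) = x0 powr (1 / 2 - 2 * s)"
          by (simp flip: powr_add)
        \<comment> \<open>By s \<ge> 1/4 the exponent of x0 is at most 0, so the lower bound for x0
          can be inserted.\<close>
        also have "x0 powr (1 / 2 - 2 * s) \<le> ((x / a) powr (1 / (a - 1))) powr (1 / 2 - 2 * s)"
          using x0l pl s by (intro powr_mono2') auto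
        also have "((x / a) powr (1 / (a - 1))) powr (1 / 2 - 2 * s)
            = x powr ((1 / 2 - 2 * s) / (a - 1)) * (1 / a powr ((1 / 2 - 2 * s) / (a - 1)))"
          using x a by (simp add: powr_powr powr_divide)
        also have "1 / a powr ((1 / 2 - 2 * s) / (a - 1)) = a powr (- ((1 / 2 - 2 * s) / (a - 1)))"
          by (simp only: powr_minus_divide)
        also have "2 powr (2 * s) * (x powr ((1 / 2 - 2 * s) / (a - 1)) * a powr (- ((1 / 2 - 2 * s) / (a - 1)))) * x powr (- (1 / 2))
           = F * (x powr ((1 / 2 - 2 * s) / (a - 1)) * x powr (- (1 / 2)))" by (simp add: F_def mult_ac)
        also have "x powr ((1 / 2 - 2 * s) / (a - 1)) * x powr (- (1 / 2)) = x powr ((1 / 2 - 2 * s) / (a - 1) + - (1 / 2))"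
          by (simp only: powr_add)
        also have "F * \<dots> \<le> F * x powr (- \<beta>)"
        proof -
          have "(1 / 2 - 2 * s) / (a - 1) = - ((2 * s - 1 / 2) / (a - 1))"
            by (simp only: minus_divide_left minus_diff_eq)
          hence "(1 / 2 - 2 * s) / (a - 1) + - (1 / 2) \<le> - \<beta>" using \<beta>(1) by linarith
          thus ?thesis using EF x by (intro mult_left_mono powr_mono) auto
        qed
        finally show ?thesis by (simp add: mult_right_mono)
      qed
      have "(x0 / 2) powr (a - 1) = x0 powr (a - 1) * 2 powr (1 - a)"
        using x0 powr_minus_divide[of "2::real" "a - 1"] by (simp add: powr_divide)
      hence "a * \<bar>t\<bar> * (x0 / 2) powr (a - 1) = (1 - c) * x"
        using x0a by (simp add: c_def mult_ac)
      hence 1: "cmod (half_kernel a s (x0 / 2) x t - 1 / (\<i> * of_real x))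
         \<le> w / (c * x) + C0 * x powr (- 1 - d / (a - 1))"
        using C0(2)[of "x0 / 2" x t] x0 x t by (simp add: w_def)
      let ?f = "\<lambda>\<xi>. complex_of_real (sobolev_weight s \<xi>) * cis (t * \<xi> powr a - x * \<xi>)"
      have A: "0 < x0 / 2" "0 < x" using x0 x by auto
      have 2: "cmod (integral {x0 / 2..N} ?f) \<le> (3 + 6 / c) * (w / x) + D * (w * sqrt (x0 / x))"
      proof (cases "t > 0")
        case True
        have "cmod (integral {x0 / 2..N} ?f) \<le> 6 * w / (c * x) + D * sobolev_weight s (max (x0 / 2) (x0 / 2)) * sqrt (x0 / x)"
          unfolding w_def c_def D_def
          by (rule tail_bound_pos[OF a s0(2) A(2,1) Nx x0]) (use x0a True in auto)
        also have "\<dots> = 6 / c * (w / x) + D * (w * sqrt (x0 / x))" by (simp add: w_def)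
        also have "\<dots> \<le> (3 + 6 / c) * (w / x) + D * (w * sqrt (x0 / x))"
          using w0 x by (intro add_right_mono mult_right_mono) auto
        finally show ?thesis .
      next
        case False
        have "cmod (integral {x0 / 2..N} ?f) \<le> 3 * (w / x)"
          using tail_bound_nonpos[OF a s0(2) A(2,1) Nx, of t] False by (simp add: w_def)
        also have "\<dots> \<le> (3 + 6 / c) * (w / x)" using c w0 x by (intro mult_right_mono) auto
        also have "\<dots> \<le> (3 + 6 / c) * (w / x) + D * (w * sqrt (x0 / x))"
          using D w0 x x0 by simp
        finally show ?thesis .
      qed
      have i: "?f integrable_on {0..N}"
        using a by (intro integrable_continuous_real half_kernel_integrand_continuous) auto
      have "half_kernel a s N x t = half_kernel a s (x0 / 2) x t + integral {x0 / 2..N} ?f"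
        unfolding half_kernel_def
        by (rule Henstock_Kurzweil_Integration.integral_combine[symmetric]) (use A Nx i in auto)
      hence "cmod (half_kernel a s N x t - 1 / (\<i> * of_real x)) \<le>
         cmod (half_kernel a s (x0 / 2) x t - 1 / (\<i> * of_real x)) + cmod (integral {x0 / 2..N} ?f)"
        using norm_triangle_ineq[of "half_kernel a s (x0 / 2) x t - 1 / (\<i> * of_real x)" "integral {x0 / 2..N} ?f"]
        by (simp add: diff_add_eq)
      also have "\<dots> \<le> (w / (c * x) + C0 * x powr (- 1 - d / (a - 1))) + ((3 + 6 / c) * (w / x) + D * (w * sqrt (x0 / x)))"
        by (intro add_mono 1 2)
      also have "\<dots> = (1 / c + 3 + 6 / c) * (w / x) + C0 * x powr (- 1 - d / (a - 1)) + D * (w * sqrt (x0 / x))"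
        by (simp add: algebra_simps)
      also have "\<dots> \<le> (1 / c + 3 + 6 / c) * (E * x powr (- \<beta>)) + C0 * x powr (- \<beta>) + D * (F * x powr (- \<beta>))"
        using wx wq y c C0 D by (intro add_mono mult_left_mono) auto
      also have "\<dots> = ((1 / c + 3 + 6 / c) * E + C0 + D * F) * x powr (- \<beta>)"
        by (simp add: algebra_simps)
      also have "\<dots> \<le> C * x powr (- \<beta>)"
        using c by (intro mult_right_mono) (auto simp: C_def)
      also have "\<dots> \<le> C * (x powr (- \<beta>) + N powr (- 2 * s))"
        using C by (intro mult_left_mono) auto
      finally show ?thesis .
    qed
  qed
  thus ?thesis using that C by blast
qed

text \<open>Truncated because the integral does not converge absolutely for \<open>s \<le> 1 / 2\<close>.\<close>

definition maximal_kernel :: "real \<Rightarrow> real \<Rightarrow> real \<Rightarrow> real \<Rightarrow> real \<Rightarrow> complex" where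
  "maximal_kernel a s N x t =
     (LINT \<xi>|lborel. indicator {-N..N} \<xi> * (of_real (sobolev_weight s \<bar>\<xi>\<bar>) * cis (t * \<bar>\<xi>\<bar> powr a + x * \<xi>)))"

section \<open>The truncated kernel on the line\<close>

lemma maximal_kernel_eq:
  assumes "a > 1" "0 \<le> N"
  shows "maximal_kernel a s N x t = half_kernel a s N x t + half_kernel a s N (- x) t"
    and "half_kernel a s N (- x) t = cnj (half_kernel a s N x (- t))"
proof -
  let ?g = "\<lambda>\<xi>. of_real (sobolev_weight s \<bar>\<xi>\<bar>) * cis (t * \<bar>\<xi>\<bar> powr a + x * \<xi>)"
  have pc: "continuous_on A (\<lambda>\<xi>. \<bar>\<xi>\<bar> powr a)" for A :: "real set"
    using assms by (intro continuous_on_powr' continuous_intros) auto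
  have c: "continuous_on A ?g" for A
    unfolding sobolev_weight_def
    by (intro continuous_on_mult continuous_on_of_real continuous_on_cis continuous_on_add pc
         continuous_on_const continuous_on_id continuous_on_powr continuous_on_rabs) auto
  have i: "set_integrable lborel {-N..N} ?g"
    by (rule borel_integrable_atLeastAtMost') (rule c)
  have "maximal_kernel a s N x t = integral {-N..N} ?g"
  proof -
    have "indicator A \<xi> *\<^sub>R z = indicator A \<xi> * z" for A and \<xi> :: real and z :: complex
      by (simp add: indicator_def)
    thus ?thesis
      using set_borel_integral_eq_integral(2)[OF i]
      by (simp add: maximal_kernel_def set_lebesgue_integral_def)
  qed
  also have "\<dots> = integral {-N..0} ?g + integral {0..N} ?g"
    by (rule Henstock_Kurzweil_Integration.integral_combine[symmetric])
       (use assms c in \<open>auto intro: integrable_continuous_real\<close>)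
  also have "integral {-N..0} ?g = integral {0..N} (\<lambda>\<xi>. ?g (- \<xi>))"
    using Henstock_Kurzweil_Integration.integral_reflect_real[of N 0 "\<lambda>\<xi>. ?g (- \<xi>)"] by simp
  also have "\<dots> = half_kernel a s N x t"
    unfolding half_kernel_def by (rule integral_cong) auto
  also have "integral {0..N} ?g = half_kernel a s N (- x) t"
    unfolding half_kernel_def by (rule integral_cong) auto
  finally show "maximal_kernel a s N x t = half_kernel a s N x t + half_kernel a s N (- x) t" .
  show "half_kernel a s N (- x) t = cnj (half_kernel a s N x (- t))"
    unfolding half_kernel_def integral_cnj
    by (rule integral_cong) (simp add: cis_cnj add.commute)
qed

text \<open>This form reduces all bounds to positive x and exhibits the cancellation: conjugation
  changes the sign of 1/(\<i> |x|), so this term may be subtracted from both halves without changing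
  the sum.\<close>

lemma maximal_kernel_abs:
  assumes "a > 1" "0 \<le> N"
  shows "maximal_kernel a s N x t = half_kernel a s N \<bar>x\<bar> t + cnj (half_kernel a s N \<bar>x\<bar> (- t))"
proof (cases "x \<ge> 0")
  case True
  thus ?thesis using maximal_kernel_eq[OF assms, of s x t] by simp
next
  case False
  thus ?thesis using maximal_kernel_eq(1)[OF assms, of s x t] maximal_kernel_eq(2)[OF assms, of s "- x" t]
    by (simp add: add.commute)
qed

lemma maximal_kernel_bound:
  fixes a s r :: real
  assumes "a > 1" "1 / 4 \<le> r" "r \<le> s" "r < 1 / 2"
  obtains C where "0 \<le> C"
    "\<And>N x t. 0 < N \<Longrightarrow> x \<noteq> 0 \<Longrightarrow> cmod (maximal_kernel a s N x t) \<le> C * \<bar>x\<bar> powr (2 * r - 1)"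
proof -
  obtain C where C: "0 \<le> C"
    "\<And>N x t. 0 < N \<Longrightarrow> 0 < x \<Longrightarrow> cmod (half_kernel a s N x t) \<le> C * x powr (2 * r - 1)"
    using half_kernel_bound[OF assms] by blast
  have "cmod (maximal_kernel a s N x t) \<le> (2 * C) * \<bar>x\<bar> powr (2 * r - 1)" if "0 < N" "x \<noteq> 0" for N x t
  proof -
    have "cmod (maximal_kernel a s N x t) \<le> cmod (half_kernel a s N \<bar>x\<bar> t) + cmod (half_kernel a s N \<bar>x\<bar> (- t))"
      using that norm_triangle_ineq[of "half_kernel a s N \<bar>x\<bar> t" "cnj (half_kernel a s N \<bar>x\<bar> (- t))"]
      by (simp add: maximal_kernel_abs[OF assms(1)])
    thus ?thesis using C(2)[of N "\<bar>x\<bar>" t] C(2)[of N "\<bar>x\<bar>" "- t"] that by simp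
  qed
  thus ?thesis using that[of "2 * C"] C(1) by simp
qed

lemma maximal_kernel_decay:
  fixes a s \<beta> d :: real
  assumes "a > 1" "1 / 4 \<le> s" "0 < d" "d < a - 1" "d \<le> 2 * s"
    "\<beta> \<le> 1 / 2 + (2 * s - 1 / 2) / (a - 1)" "\<beta> \<le> 1 + d / (a - 1)"
  obtains C where "0 \<le> C"
    "\<And>N x t. 1 \<le> N \<Longrightarrow> 1 \<le> \<bar>x\<bar> \<Longrightarrow> \<bar>t\<bar> \<le> 1 \<Longrightarrow>
       cmod (maximal_kernel a s N x t) \<le> C * (\<bar>x\<bar> powr (- \<beta>) + N powr (- 2 * s))"
proof -
  obtain C where C: "0 \<le> C" "\<And>N x t. 1 \<le> N \<Longrightarrow> 1 \<le> x \<Longrightarrow> \<bar>t\<bar> \<le> 1 \<Longrightarrow>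
       cmod (half_kernel a s N x t - 1 / (\<i> * of_real x)) \<le> C * (x powr (- \<beta>) + N powr (- 2 * s))"
    using half_kernel_asymptotics[OF assms] by blast
  have "cmod (maximal_kernel a s N x t) \<le> (2 * C) * (\<bar>x\<bar> powr (- \<beta>) + N powr (- 2 * s))"
    if "1 \<le> N" "1 \<le> \<bar>x\<bar>" "\<bar>t\<bar> \<le> 1" for N x t
  proof -
    let ?h = "\<lambda>t. half_kernel a s N \<bar>x\<bar> t - 1 / (\<i> * of_real \<bar>x\<bar>)"
    have "maximal_kernel a s N x t = ?h t + cnj (?h (- t))"
      using that by (simp add: maximal_kernel_abs[OF assms(1)])
    hence "cmod (maximal_kernel a s N x t) \<le> cmod (?h t) + cmod (?h (- t))"
      using norm_triangle_ineq[of "?h t" "cnj (?h (- t))"] by (simp only: complex_mod_cnj)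
    thus ?thesis using C(2)[of N "\<bar>x\<bar>" t] C(2)[of N "\<bar>x\<bar>" "- t"] that by simp
  qed
  thus ?thesis using that[of "2 * C"] C(1) by simp
qed

section \<open>Fractional integration\<close>

text \<open>The origin belongs to neither open half-line; with h 0 = 0 the splitting of the
  integrand is an identity at every point.\<close>

lemma nn_integral_real_even_translate:
  fixes h :: "real \<Rightarrow> real"
  assumes [measurable]: "h \<in> borel_measurable borel" and "h 0 = 0"
  shows "(\<integral>\<^sup>+y. ennreal (h \<bar>x - y\<bar>) \<partial>lborel) = 2 * (\<integral>\<^sup>+y. ennreal (h y) * indicator {0<..} y \<partial>lborel)"
proof -
  let ?g = "\<lambda>y. ennreal (h y) * indicator {0<..} y"
  have refl: "(\<integral>\<^sup>+y. g (x - y) \<partial>lborel) = (\<integral>\<^sup>+y. g y \<partial>lborel)"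
    if [measurable]: "g \<in> borel_measurable borel" for g :: "real \<Rightarrow> ennreal" and x :: real
    using nn_integral_real_affine[OF that, of "-1" x] by simp
  have "(\<integral>\<^sup>+y. ennreal (h \<bar>x - y\<bar>) \<partial>lborel) = (\<integral>\<^sup>+y. ennreal (h \<bar>y\<bar>) \<partial>lborel)"
    by (rule refl) simp
  also have "\<dots> = (\<integral>\<^sup>+y. ?g y + ?g (0 - y) \<partial>lborel)"
    by (rule nn_integral_cong) (use assms in \<open>auto simp: indicator_def\<close>)
  also have "\<dots> = (\<integral>\<^sup>+y. ?g y \<partial>lborel) + (\<integral>\<^sup>+y. ?g (0 - y) \<partial>lborel)"
    by (rule nn_integral_add) auto
  also have "(\<integral>\<^sup>+y. ?g (0 - y) \<partial>lborel) = (\<integral>\<^sup>+y. ?g y \<partial>lborel)" by (rule refl) simp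
  finally show ?thesis by (simp add: mult_2)
qed

lemma ennreal_double: "ennreal (2 * z) = 2 * ennreal z"
  by (simp add: ennreal_mult')

lemma ennreal_linear_combination:
  assumes "0 \<le> a" "0 \<le> b" "0 \<le> c" "0 \<le> A" "0 \<le> B" "0 \<le> D"
  shows "ennreal (a * A + b * B + c * D) = ennreal a * ennreal A + ennreal b * ennreal B + ennreal c * ennreal D"
  using assms by (simp add: ennreal_mult)

lemma nn_integral_powr_near:
  assumes "l < 1" "0 \<le> r"
  shows "(\<integral>\<^sup>+y. ennreal (\<bar>x - y\<bar> powr (- l) * indicator {..r} \<bar>x - y\<bar>) \<partial>lborel) = ennreal (2 * (r powr (1 - l) / (1 - l)))"
proof -
  have "(\<integral>\<^sup>+y. ennreal (y powr (- l) * indicator {..r} y) * indicator {0<..} y \<partial>lborel)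
      = (\<integral>\<^sup>+y. ennreal (if y \<in> {0..r} then y powr (- l) else 0) \<partial>lborel)"
    by (rule nn_integral_cong) (auto simp: indicator_def)
  also have "\<dots> = ennreal (r powr (1 - l) / (1 - l))"
  proof (rule nn_integral_has_integral_lborel)
    show "((\<lambda>y. if y \<in> {0..r} then y powr (- l) else 0) has_integral (r powr (1 - l) / (1 - l))) UNIV"
      unfolding has_integral_restrict_UNIV
      using has_integral_powr_from_0[of "- l" r] assms by (simp add: add.commute)
  qed auto
  finally have "(\<integral>\<^sup>+y. ennreal (y powr (- l) * indicator {..r} y) * indicator {0<..} y \<partial>lborel)
      = ennreal (r powr (1 - l) / (1 - l))" .
  moreover have "(\<integral>\<^sup>+y. ennreal (\<bar>x - y\<bar> powr (- l) * indicator {..r} \<bar>x - y\<bar>) \<partial>lborel)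
      = 2 * (\<integral>\<^sup>+y. ennreal (y powr (- l) * indicator {..r} y) * indicator {0<..} y \<partial>lborel)"
    by (rule nn_integral_real_even_translate[of "\<lambda>y. y powr (- l) * indicator {..r} y" x]) auto
  ultimately show ?thesis by (simp only: ennreal_double)
qed

lemma nn_integral_powr_far:
  assumes "0 < r" "1 < e"
  shows "(\<integral>\<^sup>+y. ennreal (\<bar>x - y\<bar> powr (- e) * indicator {r<..} \<bar>x - y\<bar>) \<partial>lborel)
    \<le> ennreal (2 * (r powr (1 - e) / (e - 1)))"
proof -
  have "(\<integral>\<^sup>+y. ennreal (y powr (- e) * indicator {r<..} y) * indicator {0<..} y \<partial>lborel)
      \<le> (\<integral>\<^sup>+y. ennreal (if y \<in> {r..} then y powr (- e) else 0) \<partial>lborel)"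
    by (rule nn_integral_mono) (auto simp: indicator_def)
  also have "\<dots> = ennreal (r powr (1 - e) / (e - 1))"
  proof (rule nn_integral_has_integral_lborel)
    have "- (r powr (- e + 1)) / (- e + 1) = r powr (1 - e) / (e - 1)"
      using assms by (simp add: divide_simps add.commute) (simp add: algebra_simps)
    thus "((\<lambda>y. if y \<in> {r..} then y powr (- e) else 0) has_integral (r powr (1 - e) / (e - 1))) UNIV"
      unfolding has_integral_restrict_UNIV
      using has_integral_powr_to_inf[of "- e" r] assms by simp
  qed auto
  finally have "2 * (\<integral>\<^sup>+y. ennreal (y powr (- e) * indicator {r<..} y) * indicator {0<..} y \<partial>lborel)
      \<le> 2 * ennreal (r powr (1 - e) / (e - 1))"
    by (rule mult_left_mono) simp
  moreover have "(\<integral>\<^sup>+y. ennreal (\<bar>x - y\<bar> powr (- e) * indicator {r<..} \<bar>x - y\<bar>) \<partial>lborel)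
      = 2 * (\<integral>\<^sup>+y. ennreal (y powr (- e) * indicator {r<..} y) * indicator {0<..} y \<partial>lborel)"
    by (rule nn_integral_real_even_translate[of "\<lambda>y. y powr (- e) * indicator {r<..} y" x]) auto
  ultimately show ?thesis by (simp only: ennreal_double)
qed

lemma nn_integral_inverse_square_far:
  assumes "0 < r"
  shows "(\<integral>\<^sup>+y. ennreal (\<bar>x - y\<bar> powr (- 2) * indicator {r<..} \<bar>x - y\<bar>) \<partial>lborel) \<le> ennreal (2 / r)"
  using nn_integral_powr_far[of r 2 x] assms by (simp add: powr_minus_divide)

text \<open>The pairs with \<open>u y \<le> u x\<close> suffice by symmetry. At distance at most \<open>u x powr (- p)\<close> one uses
  \<open>u y \<le> u x\<close>; beyond it, Young's inequality with the weight that balances the two parts.\<close>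

lemma Hardy_Littlewood_Sobolev_normalized:
  fixes u :: "real \<Rightarrow> real" and q :: real
  assumes q: "2 < q" and [measurable]: "u \<in> borel_measurable borel" and u: "\<And>x. 0 \<le> u x"
    and le: "(\<integral>\<^sup>+x. ennreal (u x powr (q / (q - 1))) \<partial>lborel) \<le> 1"
  shows "(\<integral>\<^sup>+x. \<integral>\<^sup>+y. ennreal (u x * u y * \<bar>x - y\<bar> powr (- 2 / q)) \<partial>lborel \<partial>lborel)
     \<le> ennreal (2 * (2 / (1 - 2 / q) + 3))"
proof -
  define p where "p = q / (q - 1)"
  have p: "p > 1" "p * (1 - 2 / q) = 2 - p" "1 / p + 1 / q = 1" "p / q = p - 1"
    using q by (auto simp: p_def field_simps)
  define C where "C = 2 / (1 - 2 / q) + 3"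
  have l: "2 / q < 1" "0 < 2 / q" using q by auto
  have C: "0 \<le> C" using l by (simp add: C_def)
  have inner: "(\<integral>\<^sup>+y. ennreal ((if u y \<le> u x then u y else 0) * \<bar>x - y\<bar> powr (- 2 / q)) \<partial>lborel)
      \<le> ennreal (C * u x powr (p - 1))" if ux: "u x > 0" for x
  proof -
    define v where "v = u x"
    have v: "v > 0" using ux by (simp add: v_def)
    define r where "r = v powr (- p)"
    have r: "r > 0" using v by (simp add: r_def)
    have "(if u y \<le> v then u y else 0) * \<bar>x - y\<bar> powr (- 2 / q)
        \<le> v * (\<bar>x - y\<bar> powr (- 2 / q) * indicator {..r} \<bar>x - y\<bar>) + v powr (p - 1) * u y powr p
          + 1 / v * (\<bar>x - y\<bar> powr (- 2) * indicator {r<..} \<bar>x - y\<bar>)" for y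
    proof (cases "u y \<le> v \<and> u y > 0")
      case False
      hence "(if u y \<le> v then u y else 0) = 0" using u[of y] by auto
      moreover have "0 \<le> v * (\<bar>x - y\<bar> powr (- 2 / q) * indicator {..r} \<bar>x - y\<bar>) + v powr (p - 1) * u y powr p
          + 1 / v * (\<bar>x - y\<bar> powr (- 2) * indicator {r<..} \<bar>x - y\<bar>)"
        using v by (intro add_nonneg_nonneg mult_nonneg_nonneg) auto
      ultimately show ?thesis by (simp only: mult_zero_left)
    next
      case uy: True
      show ?thesis
      proof (cases "\<bar>x - y\<bar> \<le> r")
        case True
        have "u y * \<bar>x - y\<bar> powr (- 2 / q) + 0 \<le> v * \<bar>x - y\<bar> powr (- 2 / q) + v powr (p - 1) * u y powr p"
          using uy by (intro add_mono mult_right_mono) auto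
        thus ?thesis using True uy by (simp add: indicator_def)
      next
        case False
        define z where "z = \<bar>x - y\<bar>"
        have z: "z > r" using False by (simp add: z_def)
        hence z0: "z > 0" using r by linarith
        \<comment> \<open>The powers of v are fixed by homogeneity. Young's inequality then yields
          v^(p-1) u(y)^p and z^(-2)/v, and the latter integrates over z > r to at most 2/(r v) = 2
          v^(p-1). The part with z \<le> r produces the same power of v.\<close>
        define A where "A = v powr (1 - 1 / p) * u y"
        define B where "B = v powr (- (1 - 1 / p)) * z powr (- 2 / q)"
        have AB: "0 \<le> A" "0 \<le> B" using uy v z0 by (auto simp: A_def B_def)
        have "u y * z powr (- 2 / q) = A * B"
        proof -
          have "v powr (1 - 1 / p) * v powr (- (1 - 1 / p)) = 1"
            using v by (simp flip: powr_add)
          thus ?thesis unfolding A_def B_def by (metis mult.assoc mult.commute mult.right_neutral)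
        qed
        also have "A * B \<le> A powr p / p + B powr q / q"
          using p q AB by (intro Youngs_inequality) auto
        also have "\<dots> \<le> A powr p / 1 + B powr q / 1"
          using p(1) q by (intro add_mono divide_left_mono) auto
        also have "A powr p / 1 + B powr q / 1 = A powr p + B powr q" by simp
        also have "A powr p = v powr (p - 1) * u y powr p"
        proof -
          have "(1 - 1 / p) * p = p - 1" using p(1) by (simp add: field_simps)
          thus ?thesis using uy v by (simp add: A_def powr_mult powr_powr)
        qed
        also have "B powr q = 1 / v * z powr (- 2)"
        proof -
          have "(1 - 1 / p) * q = 1" using p(3) q by (simp add: field_simps)
          hence "- (1 - 1 / p) * q = - 1" by (simp only: mult_minus_left)
          moreover have "- 2 / q * q = - 2" using q by simp
          ultimately have "B powr q = v powr (- 1) * z powr (- 2)"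
            unfolding B_def using v z0 by (simp only: powr_mult powr_powr)
          thus ?thesis using v by (simp add: powr_minus_divide)
        qed
        finally show ?thesis using False z uy by (simp add: z_def indicator_def)
      qed
    qed
    hence "(\<integral>\<^sup>+y. ennreal ((if u y \<le> v then u y else 0) * \<bar>x - y\<bar> powr (- 2 / q)) \<partial>lborel)
      \<le> (\<integral>\<^sup>+y. ennreal (v * (\<bar>x - y\<bar> powr (- 2 / q) * indicator {..r} \<bar>x - y\<bar>) + v powr (p - 1) * u y powr p
          + 1 / v * (\<bar>x - y\<bar> powr (- 2) * indicator {r<..} \<bar>x - y\<bar>)) \<partial>lborel)"
      by (intro nn_integral_mono ennreal_leI)
    also have "\<dots> = (\<integral>\<^sup>+y. ennreal v * ennreal (\<bar>x - y\<bar> powr (- 2 / q) * indicator {..r} \<bar>x - y\<bar>) + ennreal (v powr (p - 1)) * ennreal (u y powr p)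
          + ennreal (1 / v) * ennreal (\<bar>x - y\<bar> powr (- 2) * indicator {r<..} \<bar>x - y\<bar>) \<partial>lborel)"
      using v by (intro nn_integral_cong ennreal_linear_combination) auto
    also have "\<dots> = ennreal v * (\<integral>\<^sup>+y. ennreal (\<bar>x - y\<bar> powr (- 2 / q) * indicator {..r} \<bar>x - y\<bar>) \<partial>lborel)
        + ennreal (v powr (p - 1)) * (\<integral>\<^sup>+y. ennreal (u y powr p) \<partial>lborel)
          + ennreal (1 / v) * (\<integral>\<^sup>+y. ennreal (\<bar>x - y\<bar> powr (- 2) * indicator {r<..} \<bar>x - y\<bar>) \<partial>lborel)"
      by (simp add: nn_integral_add nn_integral_cmult)
    also have "\<dots> \<le> ennreal v * ennreal (2 * (r powr (1 - 2 / q) / (1 - 2 / q)))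
        + ennreal (v powr (p - 1)) * ennreal 1 + ennreal (1 / v) * ennreal (2 / r)"
      using nn_integral_powr_near[of "2 / q" r x] nn_integral_inverse_square_far[of r x] le r l
      by (intro add_mono mult_left_mono) (simp_all add: p_def)
    also have "\<dots> = ennreal (v * (2 * (r powr (1 - 2 / q) / (1 - 2 / q))) + v powr (p - 1) * 1 + 1 / v * (2 / r))"
      using v r l by (intro ennreal_linear_combination[symmetric]) auto
    also have "v * (2 * (r powr (1 - 2 / q) / (1 - 2 / q))) + v powr (p - 1) * 1 + 1 / v * (2 / r) = C * v powr (p - 1)"
    proof -
      have "- p * (1 - 2 / q) = p - 2" using p(2) by simp
      hence "r powr (1 - 2 / q) = v powr (p - 2)" unfolding r_def by (simp only: powr_powr)
      hence 1: "v * r powr (1 - 2 / q) = v powr (p - 1)"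
        using v powr_add[of v 1 "p - 2"] by simp
      have "1 / r = v powr p" using v by (simp add: r_def powr_minus_divide)
      hence 2: "1 / v * (1 / r) = v powr (p - 1)" using v by (simp add: powr_diff)
      have "v * (2 * (r powr (1 - 2 / q) / (1 - 2 / q))) + v powr (p - 1) * 1 + 1 / v * (2 / r)
        = 2 / (1 - 2 / q) * (v * r powr (1 - 2 / q)) + v powr (p - 1) + 2 * (1 / v * (1 / r))"
        by simp
      also have "\<dots> = C * v powr (p - 1)" unfolding 1 2 by (simp add: C_def distrib_right)
      finally show ?thesis .
    qed
    finally show ?thesis by (simp add: v_def)
  qed
  let ?F = "\<lambda>x y. ennreal (u x * ((if u y \<le> u x then u y else 0) * \<bar>x - y\<bar> powr (- 2 / q)))"
  have half: "(\<integral>\<^sup>+x. \<integral>\<^sup>+y. ?F x y \<partial>lborel \<partial>lborel) \<le> ennreal C"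
  proof -
    have "(\<integral>\<^sup>+x. \<integral>\<^sup>+y. ?F x y \<partial>lborel \<partial>lborel) \<le> (\<integral>\<^sup>+x. ennreal C * ennreal (u x powr p) \<partial>lborel)"
    proof (rule nn_integral_mono)
      fix x
      have "(\<integral>\<^sup>+y. ?F x y \<partial>lborel) = ennreal (u x) * (\<integral>\<^sup>+y. ennreal ((if u y \<le> u x then u y else 0) * \<bar>x - y\<bar> powr (- 2 / q)) \<partial>lborel)"
        using u by (simp add: ennreal_mult' nn_integral_cmult)
      also have "\<dots> \<le> ennreal C * ennreal (u x powr p)"
      proof (cases "u x > 0")
        case True
        have "ennreal (u x) * (\<integral>\<^sup>+y. ennreal ((if u y \<le> u x then u y else 0) * \<bar>x - y\<bar> powr (- 2 / q)) \<partial>lborel)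
           \<le> ennreal (u x) * ennreal (C * u x powr (p - 1))"
          by (intro mult_left_mono inner True) simp
        also have "\<dots> = ennreal C * ennreal (u x powr p)"
          using True C powr_add[of "u x" 1 "p - 1"] by (simp add: ennreal_mult'[symmetric] mult_ac)
        finally show ?thesis .
      qed (use u[of x] in simp)
      finally show "(\<integral>\<^sup>+y. ?F x y \<partial>lborel) \<le> ennreal C * ennreal (u x powr p)" .
    qed
    also have "\<dots> = ennreal C * (\<integral>\<^sup>+x. ennreal (u x powr p) \<partial>lborel)" by (simp add: nn_integral_cmult)
    also have "\<dots> \<le> ennreal C * 1" using le by (intro mult_left_mono) (simp_all add: p_def)
    finally show ?thesis by simp
  qed
  have "(\<integral>\<^sup>+x. \<integral>\<^sup>+y. ennreal (u x * u y * \<bar>x - y\<bar> powr (- 2 / q)) \<partial>lborel \<partial>lborel)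
    \<le> (\<integral>\<^sup>+x. \<integral>\<^sup>+y. ?F x y + ?F y x \<partial>lborel \<partial>lborel)"
  proof (intro nn_integral_mono)
    fix x y
    have "u x * u y * \<bar>x - y\<bar> powr (- 2 / q) \<le> u x * ((if u y \<le> u x then u y else 0) * \<bar>x - y\<bar> powr (- 2 / q))
      + u y * ((if u x \<le> u y then u x else 0) * \<bar>y - x\<bar> powr (- 2 / q))"
      using u[of x] u[of y] by (cases "u y \<le> u x") (auto simp: indicator_def abs_minus_commute)
    thus "ennreal (u x * u y * \<bar>x - y\<bar> powr (- 2 / q)) \<le> ?F x y + ?F y x"
      using u[of x] u[of y] by (simp add: ennreal_plus[symmetric] del: ennreal_plus)
  qed
  also have "\<dots> = (\<integral>\<^sup>+x. \<integral>\<^sup>+y. ?F x y \<partial>lborel \<partial>lborel) + (\<integral>\<^sup>+x. \<integral>\<^sup>+y. ?F y x \<partial>lborel \<partial>lborel)"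
    by (simp add: nn_integral_add)
  also have "(\<integral>\<^sup>+x. \<integral>\<^sup>+y. ?F y x \<partial>lborel \<partial>lborel) = (\<integral>\<^sup>+y. \<integral>\<^sup>+x. ?F y x \<partial>lborel \<partial>lborel)"
    by (rule lborel_pair.Fubini') simp
  also have "(\<integral>\<^sup>+x. \<integral>\<^sup>+y. ?F x y \<partial>lborel \<partial>lborel) + (\<integral>\<^sup>+y. \<integral>\<^sup>+x. ?F y x \<partial>lborel \<partial>lborel) \<le> ennreal C + ennreal C"
    using half by (intro add_mono)
  also have "\<dots> = ennreal (2 * C)" using C by (simp flip: ennreal_plus)
  finally show ?thesis by (simp add: C_def)
qed

text \<open>The form has degree 2 in u, so dividing by the norm \<open>P powr (1 / p)\<close>
  reduces it to the normalized case and explains the exponent of P. When the norm vanishes this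
  division is impossible, but then u is 0 almost everywhere.\<close>

lemma Hardy_Littlewood_Sobolev:
  fixes u :: "real \<Rightarrow> real" and q P :: real
  assumes q: "2 < q" and [measurable]: "u \<in> borel_measurable borel" and u: "\<And>x. 0 \<le> u x"
    and P: "(\<integral>\<^sup>+x. ennreal (u x powr (q / (q - 1))) \<partial>lborel) = ennreal P" "0 \<le> P"
  shows "(\<integral>\<^sup>+x. \<integral>\<^sup>+y. ennreal (u x * u y * \<bar>x - y\<bar> powr (- 2 / q)) \<partial>lborel \<partial>lborel)
     \<le> ennreal (2 * (2 / (1 - 2 / q) + 3) * P powr (2 / (q / (q - 1))))"
proof -
  define p where "p = q / (q - 1)"
  have p: "p > 1" using q by (simp add: p_def)
  show ?thesis
  proof (cases "P = 0")
    case True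
    have "AE x in lborel. ennreal (u x powr p) = 0"
      using P True by (simp add: nn_integral_0_iff_AE p_def)
    hence 0: "AE x in lborel. u x = 0"
      by eventually_elim (use u in \<open>auto simp: ennreal_eq_0_iff\<close>)
    hence "AE x in lborel. (\<integral>\<^sup>+y. ennreal (u x * u y * \<bar>x - y\<bar> powr (- 2 / q)) \<partial>lborel) = 0"
      by eventually_elim simp
    hence "(\<integral>\<^sup>+x. \<integral>\<^sup>+y. ennreal (u x * u y * \<bar>x - y\<bar> powr (- 2 / q)) \<partial>lborel \<partial>lborel) = 0"
      by (subst nn_integral_0_iff_AE) auto
    thus ?thesis by simp
  next
    case False
    hence P0: "P > 0" using P by simp
    define c where "c = P powr (1 / p)"
    have c: "c > 0" using P0 by (simp add: c_def)
    have cp: "c powr p = P" using P0 p by (simp add: c_def powr_powr)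
    have le1: "(\<integral>\<^sup>+x. \<integral>\<^sup>+y. ennreal (u x / c * (u y / c) * \<bar>x - y\<bar> powr (- 2 / q)) \<partial>lborel \<partial>lborel)
      \<le> ennreal (2 * (2 / (1 - 2 / q) + 3))"
    proof (rule Hardy_Littlewood_Sobolev_normalized[OF q])
      have "(\<integral>\<^sup>+x. ennreal ((u x / c) powr p) \<partial>lborel) = (\<integral>\<^sup>+x. ennreal (1 / P) * ennreal (u x powr p) \<partial>lborel)"
        using u c cp P0 by (intro nn_integral_cong) (simp add: powr_divide ennreal_mult'[symmetric])
      also have "\<dots> = ennreal (1 / P) * ennreal P"
        using P by (simp add: nn_integral_cmult p_def)
      also have "\<dots> = 1" using P0 by (simp add: ennreal_mult'[symmetric])
      finally show "(\<integral>\<^sup>+x. ennreal ((u x / c) powr (q / (q - 1))) \<partial>lborel) \<le> 1" by (simp add: p_def)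
    qed (use u c in auto)
    have "(\<integral>\<^sup>+x. \<integral>\<^sup>+y. ennreal (u x * u y * \<bar>x - y\<bar> powr (- 2 / q)) \<partial>lborel \<partial>lborel)
      = (\<integral>\<^sup>+x. \<integral>\<^sup>+y. ennreal (c * c) * ennreal (u x / c * (u y / c) * \<bar>x - y\<bar> powr (- 2 / q)) \<partial>lborel \<partial>lborel)"
      using c by (intro nn_integral_cong) (simp add: ennreal_mult'[symmetric])
    also have "\<dots> = ennreal (c * c) * (\<integral>\<^sup>+x. \<integral>\<^sup>+y. ennreal (u x / c * (u y / c) * \<bar>x - y\<bar> powr (- 2 / q)) \<partial>lborel \<partial>lborel)"
      by (simp add: nn_integral_cmult)
    also have "\<dots> \<le> ennreal (c * c) * ennreal (2 * (2 / (1 - 2 / q) + 3))"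
      by (intro mult_left_mono le1) simp
    also have "\<dots> = ennreal (2 * (2 / (1 - 2 / q) + 3) * (c * c))"
      using c by (simp add: ennreal_mult'[symmetric] mult.commute)
    also have "c * c = P powr (2 / p)" by (simp add: c_def flip: powr_add)
    finally show ?thesis by (simp add: p_def)
  qed
qed

text \<open>The substitute for fractional integration at q = 2, where the power kernel would be
  |x|^(-1). For an integrable kernel it is enough to separate u(x) u(y) into squares and integrate
  out one variable.\<close>

lemma Schur_convolution:
  fixes u k :: "real \<Rightarrow> real"
  assumes [measurable]: "u \<in> borel_measurable borel" "k \<in> borel_measurable borel"
    and u: "\<And>x. 0 \<le> u x" and k: "\<And>x. 0 \<le> k x"
    and K: "(\<integral>\<^sup>+x. ennreal (k \<bar>x\<bar>) \<partial>lborel) \<le> ennreal K"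
    and P: "(\<integral>\<^sup>+x. ennreal (u x powr 2) \<partial>lborel) = ennreal P" "0 \<le> P" "0 \<le> K"
  shows "(\<integral>\<^sup>+x. \<integral>\<^sup>+y. ennreal (u x * u y * k \<bar>x - y\<bar>) \<partial>lborel \<partial>lborel) \<le> ennreal (2 * K * P)"
proof -
  let ?F = "\<lambda>x y. ennreal (u x powr 2) * ennreal (k \<bar>x - y\<bar>)"
  have half: "(\<integral>\<^sup>+x. \<integral>\<^sup>+y. ?F x y \<partial>lborel \<partial>lborel) \<le> ennreal (K * P)"
  proof -
    have *: "(\<integral>\<^sup>+y. ennreal (k \<bar>x - y\<bar>) \<partial>lborel) \<le> ennreal K" for x
      using K nn_integral_real_affine[of "\<lambda>y. ennreal (k \<bar>y\<bar>)" "-1" x] by simp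
    have "(\<integral>\<^sup>+x. \<integral>\<^sup>+y. ?F x y \<partial>lborel \<partial>lborel) = (\<integral>\<^sup>+x. ennreal (u x powr 2) * (\<integral>\<^sup>+y. ennreal (k \<bar>x - y\<bar>) \<partial>lborel) \<partial>lborel)"
      by (simp add: nn_integral_cmult)
    also have "\<dots> \<le> (\<integral>\<^sup>+x. ennreal (u x powr 2) * ennreal K \<partial>lborel)"
      by (intro nn_integral_mono mult_left_mono *) simp
    also have "\<dots> = ennreal P * ennreal K" using P by (simp add: nn_integral_multc)
    finally show ?thesis using P by (simp add: ennreal_mult' mult.commute)
  qed
  have "(\<integral>\<^sup>+x. \<integral>\<^sup>+y. ennreal (u x * u y * k \<bar>x - y\<bar>) \<partial>lborel \<partial>lborel)
    \<le> (\<integral>\<^sup>+x. \<integral>\<^sup>+y. ?F x y + ?F y x \<partial>lborel \<partial>lborel)"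
  proof (intro nn_integral_mono)
    fix x y
    have "u x * u y \<le> (u x)\<^sup>2 + (u y)\<^sup>2"
      using sum_squares_bound[of "u x" "u y"] mult_nonneg_nonneg[OF u[of x] u[of y]] by linarith
    hence "u x * u y * k \<bar>x - y\<bar> \<le> u x powr 2 * k \<bar>x - y\<bar> + u y powr 2 * k \<bar>y - x\<bar>"
      using mult_right_mono[OF _ k[of "\<bar>x - y\<bar>"]] u
      by (fastforce simp: powr_numeral abs_minus_commute distrib_right)
    thus "ennreal (u x * u y * k \<bar>x - y\<bar>) \<le> ?F x y + ?F y x"
      using k by (simp add: ennreal_mult'[symmetric] ennreal_plus[symmetric] del: ennreal_plus)
  qed
  also have "\<dots> = (\<integral>\<^sup>+x. \<integral>\<^sup>+y. ?F x y \<partial>lborel \<partial>lborel) + (\<integral>\<^sup>+x. \<integral>\<^sup>+y. ?F y x \<partial>lborel \<partial>lborel)"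
    by (simp add: nn_integral_add)
  also have "(\<integral>\<^sup>+x. \<integral>\<^sup>+y. ?F y x \<partial>lborel \<partial>lborel) = (\<integral>\<^sup>+y. \<integral>\<^sup>+x. ?F y x \<partial>lborel \<partial>lborel)"
    by (rule lborel_pair.Fubini') simp
  also have "(\<integral>\<^sup>+x. \<integral>\<^sup>+y. ?F x y \<partial>lborel \<partial>lborel) + (\<integral>\<^sup>+y. \<integral>\<^sup>+x. ?F y x \<partial>lborel \<partial>lborel) \<le> ennreal (K * P) + ennreal (K * P)"
    using half by (intro add_mono)
  also have "\<dots> = ennreal (2 * K * P)" using P by (simp flip: ennreal_plus)
  finally show ?thesis .
qed

section \<open>Duality and linearization of the maximal function\<close>

lemma sobolev_weight_measurable [measurable]: "sobolev_weight s \<in> borel_measurable borel"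
  unfolding sobolev_weight_def [abs_def] by measurable

lemma borel_measurable_cnj [measurable (raw)]:
  assumes "f \<in> borel_measurable M"
  shows "(\<lambda>x. cnj (f x)) \<in> borel_measurable M"
  by (rule measurable_compose[OF assms]) (intro borel_measurable_continuous_onI continuous_intros)

definition plane_wave :: "real \<Rightarrow> real \<Rightarrow> real \<Rightarrow> real \<Rightarrow> complex" where
  "plane_wave a t x \<xi> = cis (t * \<bar>\<xi>\<bar> powr a + x * \<xi>)"

lemma norm_plane_wave [simp]: "cmod (plane_wave a t x \<xi>) = 1"
  by (simp add: plane_wave_def)

lemma plane_wave_measurable [measurable (raw)]:
  assumes [measurable]: "f \<in> borel_measurable M" "g \<in> borel_measurable M" "h \<in> borel_measurable M"
  shows "(\<lambda>x. plane_wave a (f x) (g x) (h x)) \<in> borel_measurable M"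
  unfolding plane_wave_def cis_conv_exp by measurable

lemma plane_wave_mult_cnj:
  "plane_wave a t x \<xi> * cnj (plane_wave a t' x' \<xi>) = plane_wave a (t - t') (x - x') \<xi>"
  by (simp add: plane_wave_def cis_cnj cis_mult algebra_simps)

lemma propagator_eq: "propagator a t f x = (LINT \<xi>|lborel. plane_wave a t x \<xi> * fourier f \<xi>)"
  by (simp add: propagator_def plane_wave_def cis_conv_exp exp_add[symmetric] algebra_simps)

text \<open>The exchanges of integrals in the duality argument share this shape: an integrable
  factor in each variable, coupled only through a bounded phase, so the product is integrable over
  the plane.\<close>

lemma Fubini_bounded_phase:
  fixes A B :: "real \<Rightarrow> complex" and c :: "real \<Rightarrow> real \<Rightarrow> complex"
  assumes A: "integrable lborel A" and B: "integrable lborel B"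
    and c [measurable]: "case_prod c \<in> borel_measurable (borel \<Otimes>\<^sub>M borel)" and c1: "\<And>x \<xi>. cmod (c x \<xi>) \<le> 1"
  shows "(LINT x|lborel. A x * (LINT \<xi>|lborel. c x \<xi> * B \<xi>)) = (LINT \<xi>|lborel. (LINT x|lborel. A x * c x \<xi>) * B \<xi>)"
proof -
  have [measurable]: "A \<in> borel_measurable borel" "B \<in> borel_measurable borel"
    using A B by (auto dest: borel_measurable_integrable)
  have fin: "(\<integral>\<^sup>+x. ennreal (cmod (A x)) \<partial>lborel) < \<infinity>" "(\<integral>\<^sup>+x. ennreal (cmod (B x)) \<partial>lborel) < \<infinity>"
    using A B by (auto simp: integrable_iff_bounded)
  have "integrable (lborel \<Otimes>\<^sub>M lborel) (\<lambda>(x, \<xi>). A x * c x \<xi> * B \<xi>)"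
  proof (rule integrableI_bounded)
    have "(\<integral>\<^sup>+z. ennreal (cmod (case z of (x, \<xi>) \<Rightarrow> A x * c x \<xi> * B \<xi>)) \<partial>(lborel \<Otimes>\<^sub>M lborel))
      = (\<integral>\<^sup>+x. \<integral>\<^sup>+\<xi>. ennreal (cmod (A x * c x \<xi> * B \<xi>)) \<partial>lborel \<partial>lborel)"
      by (subst lborel.nn_integral_fst[symmetric]) auto
    also have "\<dots> \<le> (\<integral>\<^sup>+x. \<integral>\<^sup>+\<xi>. ennreal (cmod (A x)) * ennreal (cmod (B \<xi>)) \<partial>lborel \<partial>lborel)"
    proof (intro nn_integral_mono)
      fix x \<xi>
      have "cmod (A x * c x \<xi> * B \<xi>) \<le> cmod (A x) * 1 * cmod (B \<xi>)"
        unfolding norm_mult by (intro mult_mono c1) auto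
      thus "ennreal (cmod (A x * c x \<xi> * B \<xi>)) \<le> ennreal (cmod (A x)) * ennreal (cmod (B \<xi>))"
        by (simp add: ennreal_mult'[symmetric])
    qed
    also have "\<dots> = (\<integral>\<^sup>+x. ennreal (cmod (A x)) \<partial>lborel) * (\<integral>\<^sup>+x. ennreal (cmod (B x)) \<partial>lborel)"
      by (simp add: nn_integral_cmult nn_integral_multc)
    also have "\<dots> < \<infinity>" using fin by (simp add: ennreal_mult_less_top)
    finally show "(\<integral>\<^sup>+z. ennreal (cmod (case z of (x, \<xi>) \<Rightarrow> A x * c x \<xi> * B \<xi>)) \<partial>(lborel \<Otimes>\<^sub>M lborel)) < \<infinity>" .
  qed simp
  from lborel_pair.Fubini_integral[OF this]
  have "(LINT \<xi>|lborel. LINT x|lborel. A x * c x \<xi> * B \<xi>) = (LINT x|lborel. LINT \<xi>|lborel. A x * c x \<xi> * B \<xi>)" .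
  moreover have "(LINT x|lborel. A x * c x \<xi> * B \<xi>) = (LINT x|lborel. A x * c x \<xi>) * B \<xi>" for \<xi>
    by simp
  moreover have "(LINT \<xi>|lborel. A x * c x \<xi> * B \<xi>) = A x * (LINT \<xi>|lborel. c x \<xi> * B \<xi>)" for x
    by (simp add: mult.assoc)
  ultimately show ?thesis by simp
qed

lemma maximal_kernel_plane_wave:
  "maximal_kernel a s N x t = (LINT \<xi>|lborel. plane_wave a t x \<xi> * (indicator {-N..N} \<xi> * of_real (sobolev_weight s \<bar>\<xi>\<bar>)))"
  by (simp add: maximal_kernel_def plane_wave_def mult_ac)

text \<open>Integrability is not among the hypotheses because a non-integrable function has Bochner
  integral 0. The inequality can thus be applied to the kernel integrals directly.\<close>

lemma norm_integral_le_nn_integral: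
  fixes f :: "'a \<Rightarrow> 'b :: {banach, second_countable_topology}"
  shows "ennreal (norm (integral\<^sup>L M f)) \<le> (\<integral>\<^sup>+x. ennreal (norm (f x)) \<partial>M)"
proof (cases "integrable M f")
  case True
  thus ?thesis by (rule integral_norm_bound_ennreal)
qed (simp add: not_integrable_integral_eq)

text \<open>Here \<open>W\<close> is the transpose of the linearized propagator applied to
  \<open>w\<close>. Writing |W|^2 as W times its conjugate, the two plane waves multiply to one with
  the differences of times and positions, and the \<xi>-integral becomes the kernel. The cutoff N
  makes the weight integrable, as the exchange of integrals requires.\<close>

lemma TT_star_identity:
  fixes w :: "real \<Rightarrow> complex" and \<tau> :: "real \<Rightarrow> real" and a :: real
  assumes w: "integrable lborel w" and \<tau> [measurable]: "\<tau> \<in> borel_measurable borel" and s: "0 \<le> s" and N: "0 \<le> N"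
  defines "W \<equiv> \<lambda>\<xi>. (LINT x|lborel. w x * plane_wave a (\<tau> x) x \<xi>)"
  shows "(LINT \<xi>|lborel. indicator {-N..N} \<xi> * (sobolev_weight s \<bar>\<xi>\<bar> * (cmod (W \<xi>))\<^sup>2))
     = (LINT x|lborel. w x * (LINT y|lborel. cnj (w y) * maximal_kernel a s N (x - y) (\<tau> x - \<tau> y)))"
    and "integrable lborel (\<lambda>\<xi>. indicator {-N..N} \<xi> * (sobolev_weight s \<bar>\<xi>\<bar> * (cmod (W \<xi>))\<^sup>2))"
    and "W \<in> borel_measurable borel" and "cmod (W \<xi>) \<le> (LINT x|lborel. cmod (w x))"
proof -
  define L where "L = (LINT x|lborel. cmod (w x))"
  have [measurable]: "w \<in> borel_measurable borel" using w by (auto dest: borel_measurable_integrable)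
  have Wm [measurable]: "W \<in> borel_measurable borel"
  proof -
    have "case_prod (\<lambda>\<xi> x. w x * plane_wave a (\<tau> x) x \<xi>) \<in> borel_measurable (borel \<Otimes>\<^sub>M lborel)"
      by measurable
    from lborel.borel_measurable_lebesgue_integral[OF this] show ?thesis by (simp add: W_def)
  qed
  show "W \<in> borel_measurable borel" by (rule Wm)
  have Wb: "cmod (W \<xi>) \<le> L" for \<xi>
    unfolding W_def L_def by (rule order_trans[OF integral_norm_bound]) (simp add: norm_mult)
  thus "cmod (W \<xi>) \<le> (LINT x|lborel. cmod (w x))" by (simp add: L_def)
  define \<Psi> where "\<Psi> = (\<lambda>\<xi>. indicator {-N..N} \<xi> * complex_of_real (sobolev_weight s \<bar>\<xi>\<bar>))"
  have [measurable]: "\<Psi> \<in> borel_measurable borel" unfolding \<Psi>_def by measurable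
  have weight1: "sobolev_weight s \<bar>\<xi>\<bar> \<le> 1" for \<xi>
  proof -
    have "(1 + \<bar>\<xi>\<bar>) powr (- 2 * s) \<le> 1 powr (- 2 * s)" using s by (intro powr_mono2') auto
    thus ?thesis by (simp add: sobolev_weight_def)
  qed
  have \<Psi>1: "cmod (\<Psi> \<xi>) \<le> 1" for \<xi>
    using weight1[of \<xi>] by (simp add: \<Psi>_def norm_mult indicator_def sobolev_weight_nonneg)
  have \<Psi>: "integrable lborel \<Psi>"
  proof (rule integrableI_bounded_set[where A = "{-N..N}" and B = 1])
    show "AE \<xi> in lborel. \<xi> \<notin> {- N..N} \<longrightarrow> \<Psi> \<xi> = 0" by (simp add: \<Psi>_def)
  qed (use \<Psi>1 N in auto)
  have L0: "0 \<le> L" by (simp add: L_def)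
  have \<Psi>W: "integrable lborel (\<lambda>\<xi>. \<Psi> \<xi> * cnj (W \<xi>))"
  proof (rule integrableI_bounded_set[where A = "{-N..N}" and B = "1 * L"])
    show "AE \<xi> in lborel. \<xi> \<in> {- N..N} \<longrightarrow> norm (\<Psi> \<xi> * cnj (W \<xi>)) \<le> 1 * L"
      unfolding norm_mult complex_mod_cnj by (intro AE_I2 impI mult_mono \<Psi>1 Wb) auto
    show "AE \<xi> in lborel. \<xi> \<notin> {- N..N} \<longrightarrow> \<Psi> \<xi> * cnj (W \<xi>) = 0" by (simp add: \<Psi>_def)
  qed (use N in auto)
  show "integrable lborel (\<lambda>\<xi>. indicator {-N..N} \<xi> * (sobolev_weight s \<bar>\<xi>\<bar> * (cmod (W \<xi>))\<^sup>2))"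
  proof (rule integrableI_bounded_set[where A = "{-N..N}" and B = "1 * (1 * L\<^sup>2)"])
    show "AE \<xi> in lborel. \<xi> \<in> {- N..N} \<longrightarrow> norm (indicator {-N..N} \<xi> * (sobolev_weight s \<bar>\<xi>\<bar> * (cmod (W \<xi>))\<^sup>2)) \<le> 1 * (1 * L\<^sup>2)"
      unfolding norm_mult by (intro AE_I2 impI mult_mono) (auto simp: weight1 Wb power_mono sobolev_weight_nonneg indicator_def)
  qed (use N in auto)
  have inner: "(LINT \<xi>|lborel. plane_wave a (\<tau> x) x \<xi> * (\<Psi> \<xi> * cnj (W \<xi>)))
    = (LINT y|lborel. cnj (w y) * maximal_kernel a s N (x - y) (\<tau> x - \<tau> y))" for x
  proof -
    have "(LINT \<xi>|lborel. plane_wave a (\<tau> x) x \<xi> * (\<Psi> \<xi> * cnj (W \<xi>)))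
      = (LINT \<xi>|lborel. (LINT y|lborel. cnj (w y) * (plane_wave a (\<tau> x) x \<xi> * cnj (plane_wave a (\<tau> y) y \<xi>))) * \<Psi> \<xi>)"
    proof (rule Bochner_Integration.integral_cong[OF refl])
      fix \<xi>
      have "cnj (W \<xi>) = (LINT y|lborel. cnj (w y) * cnj (plane_wave a (\<tau> y) y \<xi>))"
        unfolding W_def by (subst Bochner_Integration.integral_cnj[symmetric]) simp
      hence "plane_wave a (\<tau> x) x \<xi> * cnj (W \<xi>)
          = (LINT y|lborel. plane_wave a (\<tau> x) x \<xi> * (cnj (w y) * cnj (plane_wave a (\<tau> y) y \<xi>)))"
        by (simp only: Bochner_Integration.integral_mult_right_zero)
      also have "\<dots> = (LINT y|lborel. cnj (w y) * (plane_wave a (\<tau> x) x \<xi> * cnj (plane_wave a (\<tau> y) y \<xi>)))"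
        by (simp only: mult_ac)
      finally have "plane_wave a (\<tau> x) x \<xi> * cnj (W \<xi>) * \<Psi> \<xi>
        = (LINT y|lborel. cnj (w y) * (plane_wave a (\<tau> x) x \<xi> * cnj (plane_wave a (\<tau> y) y \<xi>))) * \<Psi> \<xi>"
        by (rule arg_cong)
      thus "plane_wave a (\<tau> x) x \<xi> * (\<Psi> \<xi> * cnj (W \<xi>))
        = (LINT y|lborel. cnj (w y) * (plane_wave a (\<tau> x) x \<xi> * cnj (plane_wave a (\<tau> y) y \<xi>))) * \<Psi> \<xi>"
        by (simp only: mult.assoc mult.commute[of "\<Psi> \<xi>" "cnj (W \<xi>)"])
    qed
    also have "\<dots> = (LINT y|lborel. cnj (w y) * (LINT \<xi>|lborel. (plane_wave a (\<tau> x) x \<xi> * cnj (plane_wave a (\<tau> y) y \<xi>)) * \<Psi> \<xi>))"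
    proof (rule Fubini_bounded_phase[symmetric])
      show "integrable lborel (\<lambda>y. cnj (w y))" using w by simp
      show "(\<lambda>(y, \<xi>). plane_wave a (\<tau> x) x \<xi> * cnj (plane_wave a (\<tau> y) y \<xi>)) \<in> borel_measurable (borel \<Otimes>\<^sub>M borel)"
        by measurable
    qed (simp_all add: \<Psi> norm_mult)
    also have "\<dots> = (LINT y|lborel. cnj (w y) * maximal_kernel a s N (x - y) (\<tau> x - \<tau> y))"
      unfolding plane_wave_mult_cnj maximal_kernel_plane_wave \<Psi>_def ..
    finally show ?thesis .
  qed
  have "complex_of_real (LINT \<xi>|lborel. indicator {-N..N} \<xi> * (sobolev_weight s \<bar>\<xi>\<bar> * (cmod (W \<xi>))\<^sup>2))
    = (LINT \<xi>|lborel. complex_of_real (indicator {-N..N} \<xi> * (sobolev_weight s \<bar>\<xi>\<bar> * (cmod (W \<xi>))\<^sup>2)))"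
    by (rule integral_complex_of_real[symmetric])
  also have "\<dots> = (LINT \<xi>|lborel. W \<xi> * (\<Psi> \<xi> * cnj (W \<xi>)))"
  proof (rule Bochner_Integration.integral_cong[OF refl])
    fix \<xi>
    have "complex_of_real ((cmod (W \<xi>))\<^sup>2) = W \<xi> * cnj (W \<xi>)" by (rule complex_norm_square)
    thus "complex_of_real (indicator {-N..N} \<xi> * (sobolev_weight s \<bar>\<xi>\<bar> * (cmod (W \<xi>))\<^sup>2)) = W \<xi> * (\<Psi> \<xi> * cnj (W \<xi>))"
      by (simp add: \<Psi>_def indicator_def del: of_real_power)
  qed
  also have "\<dots> = (LINT x|lborel. w x * (LINT \<xi>|lborel. plane_wave a (\<tau> x) x \<xi> * (\<Psi> \<xi> * cnj (W \<xi>))))"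
    unfolding W_def[of] by (rule Fubini_bounded_phase[symmetric, OF w \<Psi>W[unfolded W_def]]) auto
  also have "\<dots> = (LINT x|lborel. w x * (LINT y|lborel. cnj (w y) * maximal_kernel a s N (x - y) (\<tau> x - \<tau> y)))"
    by (simp only: inner)
  finally show "(LINT \<xi>|lborel. indicator {-N..N} \<xi> * (sobolev_weight s \<bar>\<xi>\<bar> * (cmod (W \<xi>))\<^sup>2))
     = (LINT x|lborel. w x * (LINT y|lborel. cnj (w y) * maximal_kernel a s N (x - y) (\<tau> x - \<tau> y)))" .
qed

lemma one_plus_square_powr_pos: "0 < (1 + \<bar>\<xi> :: real\<bar>\<^sup>2) powr s"
proof -
  have "1 + \<bar>\<xi>\<bar>\<^sup>2 \<noteq> 0" using zero_le_power2[of "\<bar>\<xi>\<bar>"] by linarith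
  thus ?thesis by (simp only: powr_gt_zero) simp
qed

text \<open>From (1 + |\<xi>|)^2 \<le> 2 (1 + |\<xi>|^2). This is where the monotone weight of the
  kernel takes over from the Sobolev weight; the factor \<open>2 powr s\<close> survives into the
  final constant.\<close>

lemma sobolev_weight_lower:
  assumes "0 \<le> s"
  shows "1 / (1 + \<bar>\<xi>\<bar>\<^sup>2) powr s \<le> 2 powr s * sobolev_weight s \<bar>\<xi>\<bar>"
proof -
  have "(1 + \<bar>\<xi>\<bar>)\<^sup>2 \<le> 2 * (1 + \<bar>\<xi>\<bar>\<^sup>2)"
    using sum_squares_bound[of 1 "\<bar>\<xi>\<bar>"] by (simp add: power2_sum)
  hence "((1 + \<bar>\<xi>\<bar>)\<^sup>2) powr s \<le> (2 * (1 + \<bar>\<xi>\<bar>\<^sup>2)) powr s"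
    using assms by (intro powr_mono2) auto
  also have "\<dots> = 2 powr s * (1 + \<bar>\<xi>\<bar>\<^sup>2) powr s" by (rule powr_mult)
  also have "((1 + \<bar>\<xi>\<bar>)\<^sup>2) powr s = (1 + \<bar>\<xi>\<bar>) powr (2 * s)"
    by (simp add: powr_powr flip: powr_numeral)
  finally have "(1 + \<bar>\<xi>\<bar>) powr (2 * s) \<le> 2 powr s * (1 + \<bar>\<xi>\<bar>\<^sup>2) powr s" .
  moreover have "0 < 1 + \<bar>\<xi>\<bar>\<^sup>2" by (simp add: add_pos_nonneg)
  ultimately show ?thesis
    by (simp add: sobolev_weight_def powr_minus_divide field_simps)
qed

text \<open>Duality: \<open>w\<close> is chosen such that \<open>w F = \<bar>F\<bar>\<^sup>q\<close> on the interval, and \<open>TT\<^sup>*\<close> turns the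
  square of the dual norm of \<open>w\<close> into the kernel form.\<close>

lemma linearized_estimate:
  fixes g :: "real \<Rightarrow> complex" and \<tau> k :: "real \<Rightarrow> real" and a q s H R D M :: real
  assumes q: "2 \<le> q" and s: "0 < s" and g: "integrable lborel g"
    and H: "(\<integral>\<^sup>+\<xi>. ennreal ((1 + \<bar>\<xi>\<bar>\<^sup>2) powr s * (cmod (g \<xi>))\<^sup>2) \<partial>lborel) = ennreal H" "0 \<le> H"
    and \<tau> [measurable]: "\<tau> \<in> borel_measurable borel" and \<tau>01: "\<And>x. 0 < \<tau> x \<and> \<tau> x < 1"
    and k [measurable]: "k \<in> borel_measurable borel" and k0: "\<And>x. 0 \<le> k x" and M: "0 \<le> M"
    and kernel: "\<And>N x t. 1 \<le> N \<Longrightarrow> x \<noteq> 0 \<Longrightarrow> \<bar>t\<bar> \<le> 1 \<Longrightarrow>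
        cmod (maximal_kernel a s N x t) \<le> k \<bar>x\<bar> + M * N powr (- 2 * s)"
    and form: "\<And>u P. u \<in> borel_measurable borel \<Longrightarrow> (\<And>x. 0 \<le> u x) \<Longrightarrow> 0 \<le> P \<Longrightarrow>
        (\<integral>\<^sup>+x. ennreal (u x powr (q / (q - 1))) \<partial>lborel) = ennreal P \<Longrightarrow>
        (\<integral>\<^sup>+x. \<integral>\<^sup>+y. ennreal (u x * u y * k \<bar>x - y\<bar>) \<partial>lborel \<partial>lborel) \<le> ennreal (D * P powr (2 / (q / (q - 1))))"
    and D: "0 \<le> D" and R: "0 \<le> R"
  defines "F \<equiv> \<lambda>x. (LINT \<xi>|lborel. plane_wave a (\<tau> x) x \<xi> * g \<xi>)"
  shows "(\<integral>\<^sup>+x. ennreal (indicator {-R..R} x * cmod (F x) powr q) \<partial>lborel) \<le> ennreal ((2 powr s * D * H) powr (q / 2))"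
proof -
  have [measurable]: "g \<in> borel_measurable borel" using g by (auto dest: borel_measurable_integrable)
  have Fm [measurable]: "F \<in> borel_measurable borel"
  proof -
    have "case_prod (\<lambda>x \<xi>. plane_wave a (\<tau> x) x \<xi> * g \<xi>) \<in> borel_measurable (borel \<Otimes>\<^sub>M lborel)"
      by measurable
    from lborel.borel_measurable_lebesgue_integral[OF this] show ?thesis by (simp add: F_def)
  qed
  define G where "G = (LINT \<xi>|lborel. cmod (g \<xi>))"
  have FG: "cmod (F x) \<le> G" for x
    unfolding F_def G_def by (rule order_trans[OF integral_norm_bound]) (simp add: norm_mult)
  define p where "p = q / (q - 1)"
  have p: "1 < p" "p * (q - 1) = q" "2 - 2 / p = 2 / q" using q by (auto simp: p_def field_simps)
  define u where "u = (\<lambda>x. indicator {-R..R} x * cmod (F x) powr (q - 1))"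
  define w where "w = (\<lambda>x. of_real (indicator {-R..R} x * cmod (F x) powr (q - 2)) * cnj (F x))"
  have [measurable]: "u \<in> borel_measurable borel" "w \<in> borel_measurable borel"
    unfolding u_def w_def by measurable
  have wu: "cmod (w x) = u x" for x
  proof (cases "F x = 0")
    case False
    hence "cmod (F x) powr (q - 2) * cmod (F x) = cmod (F x) powr (q - 1)"
      using powr_add[of "cmod (F x)" "q - 2" 1] by simp
    thus ?thesis by (simp add: w_def u_def norm_mult indicator_def)
  qed (simp add: w_def u_def)
  have wF: "w x * F x = of_real (indicator {-R..R} x * cmod (F x) powr q)" for x
  proof (cases "F x = 0")
    case False
    have "cnj (F x) * F x = of_real ((cmod (F x))\<^sup>2)" by (simp only: complex_norm_square mult.commute)
    hence "w x * F x = of_real (indicator {-R..R} x * cmod (F x) powr (q - 2)) * of_real ((cmod (F x))\<^sup>2)"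
      by (simp only: w_def mult.assoc)
    also have "\<dots> = of_real (indicator {-R..R} x * (cmod (F x) powr (q - 2) * (cmod (F x))\<^sup>2))"
      by (simp only: of_real_mult mult.assoc)
    also have "cmod (F x) powr (q - 2) * (cmod (F x))\<^sup>2 = cmod (F x) powr q"
      using False powr_add[of "cmod (F x)" "q - 2" 2] by (simp add: powr_numeral)
    finally show ?thesis .
  qed (simp add: w_def)
  \<comment> \<open>The a priori information on F is boundedness. The restriction to [-R, R] makes X
    finite, which is what allows dividing by a power of X at the end.\<close>
  have int: "integrable lborel (\<lambda>x. indicator {-R..R} x * cmod (F x) powr b)" if "0 \<le> b" for b
  proof (rule integrableI_bounded_set[where A = "{-R..R}" and B = "G powr b"])
    show "AE x in lborel. x \<in> {-R..R} \<longrightarrow> norm (indicator {-R..R} x * cmod (F x) powr b) \<le> G powr b"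
      using FG that by (intro AE_I2) (auto intro!: powr_mono2)
  qed (use R in auto)
  have u: "integrable lborel u" unfolding u_def using q by (intro int) auto
  have w: "integrable lborel w"
    using u by (rule Bochner_Integration.integrable_bound) (use wu in \<open>auto simp: u_def\<close>)
  define U where "U = (LINT x|lborel. u x)"
  have u0: "0 \<le> u x" for x by (simp add: u_def)
  have U: "0 \<le> U" "(\<integral>\<^sup>+x. ennreal (u x) \<partial>lborel) = ennreal U"
    using u u0 by (auto simp: U_def nn_integral_eq_integral)
  define X where "X = (LINT x|lborel. indicator {-R..R} x * cmod (F x) powr q)"
  have X0: "0 \<le> X" by (simp add: X_def)
  have X: "(\<integral>\<^sup>+x. ennreal (indicator {-R..R} x * cmod (F x) powr q) \<partial>lborel) = ennreal X"
    unfolding X_def by (rule nn_integral_eq_integral) (use int q in auto)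
  have uP: "(\<integral>\<^sup>+x. ennreal (u x powr (q / (q - 1))) \<partial>lborel) = ennreal X"
  proof -
    have "u x powr (q / (q - 1)) = indicator {-R..R} x * cmod (F x) powr q" for x
      using p by (simp add: u_def indicator_def powr_powr p_def[symmetric] mult.commute)
    thus ?thesis using X by simp
  qed
  define W where "W = (\<lambda>\<xi>. (LINT x|lborel. w x * plane_wave a (\<tau> x) x \<xi>))"
  have s0: "0 \<le> s" using s by simp
  have Weq: "(LINT x|lborel. w x * plane_wave a (\<tau> x) x \<xi>) = W \<xi>" for \<xi> by (simp add: W_def)
  note TT = TT_star_identity[OF w \<tau> s0, where a = a, unfolded Weq]
  have Wm [measurable]: "W \<in> borel_measurable borel" by (rule TT(3)[of 1]) simp
  have WU: "cmod (W \<xi>) \<le> U" for \<xi> using TT(4)[of 1 \<xi>] by (simp add: wu U_def)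
  have XW: "complex_of_real X = (LINT \<xi>|lborel. W \<xi> * g \<xi>)"
  proof -
    have "complex_of_real X = (LINT x|lborel. w x * F x)"
      unfolding X_def wF by (rule integral_complex_of_real[symmetric])
    also have "\<dots> = (LINT \<xi>|lborel. W \<xi> * g \<xi>)"
      unfolding F_def W_def by (rule Fubini_bounded_phase[OF w g]) auto
    finally show ?thesis .
  qed
  let ?b = "\<lambda>\<xi>. (1 + \<bar>\<xi>\<bar>\<^sup>2) powr s"
  have bg: "integrable lborel (\<lambda>\<xi>. ?b \<xi> * (cmod (g \<xi>))\<^sup>2)"
    by (rule integrableI_nonneg) (use H in auto)
  have bgH: "(LINT \<xi>|lborel. ?b \<xi> * (cmod (g \<xi>))\<^sup>2) = H"
    using H by (simp add: integral_eq_nn_integral)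
  have gW: "integrable lborel (\<lambda>\<xi>. cmod (W \<xi> * g \<xi>))"
  proof (rule Bochner_Integration.integrable_bound)
    show "integrable lborel (\<lambda>\<xi>. U * cmod (g \<xi>))" using g by auto
    show "AE \<xi> in lborel. norm (cmod (W \<xi> * g \<xi>)) \<le> norm (U * cmod (g \<xi>))"
      using WU U by (intro AE_I2) (auto simp: norm_mult intro!: mult_right_mono)
  qed auto
  \<comment> \<open>The Cauchy-Schwarz inequality in additive form with a free parameter \<theta>.
    In this form it can be applied pointwise in \<xi> and integrated term by term; \<theta> is
    optimized afterwards.\<close>
  have main: "X \<le> \<theta> / 2 * H + 2 powr s / (2 * \<theta>) * (D * X powr (2 / p))" if \<theta>: "0 < \<theta>" for \<theta>
  proof -
    define Q where "Q = (\<lambda>N. (LINT \<xi>|lborel. indicator {-N..N} \<xi> * (sobolev_weight s \<bar>\<xi>\<bar> * (cmod (W \<xi>))\<^sup>2)))"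
    have Q: "Q N \<le> D * X powr (2 / p) + M * N powr (- 2 * s) * (U * U)" if N: "1 \<le> N" for N
    proof -
      have "ennreal (cmod (complex_of_real (Q N))) \<le>
        (\<integral>\<^sup>+x. ennreal (cmod (w x * (LINT y|lborel. cnj (w y) * maximal_kernel a s N (x - y) (\<tau> x - \<tau> y)))) \<partial>lborel)"
        unfolding Q_def using TT(1)[of N] N by (simp only: norm_integral_le_nn_integral)
      also have "\<dots> \<le> (\<integral>\<^sup>+x. ennreal (u x) * (\<integral>\<^sup>+y. ennreal (u y * (k \<bar>x - y\<bar> + M * N powr (- 2 * s))) \<partial>lborel) \<partial>lborel)"
      proof (rule nn_integral_mono)
        fix x
        have "ennreal (cmod (w x * (LINT y|lborel. cnj (w y) * maximal_kernel a s N (x - y) (\<tau> x - \<tau> y))))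
          = ennreal (u x) * ennreal (cmod (LINT y|lborel. cnj (w y) * maximal_kernel a s N (x - y) (\<tau> x - \<tau> y)))"
          by (simp add: norm_mult wu ennreal_mult'')
        also have "ennreal (cmod (LINT y|lborel. cnj (w y) * maximal_kernel a s N (x - y) (\<tau> x - \<tau> y)))
          \<le> (\<integral>\<^sup>+y. ennreal (cmod (cnj (w y) * maximal_kernel a s N (x - y) (\<tau> x - \<tau> y))) \<partial>lborel)"
          by (rule norm_integral_le_nn_integral)
        also have "\<dots> \<le> (\<integral>\<^sup>+y. ennreal (u y * (k \<bar>x - y\<bar> + M * N powr (- 2 * s))) \<partial>lborel)"
        proof (rule nn_integral_mono_AE)
          \<comment> \<open>The kernel bound excludes x = y, where \<open>k\<close> need not control
            anything; one point is a null set.\<close>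
          have "AE y in lborel. y \<noteq> x" by (rule AE_lborel_singleton)
          thus "AE y in lborel. ennreal (cmod (cnj (w y) * maximal_kernel a s N (x - y) (\<tau> x - \<tau> y)))
             \<le> ennreal (u y * (k \<bar>x - y\<bar> + M * N powr (- 2 * s)))"
          proof eventually_elim
            fix y assume "y \<noteq> x"
            moreover have "\<bar>\<tau> x - \<tau> y\<bar> \<le> 1" using \<tau>01[of x] \<tau>01[of y] by auto
            ultimately show "ennreal (cmod (cnj (w y) * maximal_kernel a s N (x - y) (\<tau> x - \<tau> y)))
             \<le> ennreal (u y * (k \<bar>x - y\<bar> + M * N powr (- 2 * s)))"
              unfolding norm_mult complex_mod_cnj wu
              by (intro ennreal_leI mult_left_mono kernel N u0) auto
          qed
        qed
        finally show "ennreal (cmod (w x * (LINT y|lborel. cnj (w y) * maximal_kernel a s N (x - y) (\<tau> x - \<tau> y))))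
          \<le> ennreal (u x) * (\<integral>\<^sup>+y. ennreal (u y * (k \<bar>x - y\<bar> + M * N powr (- 2 * s))) \<partial>lborel)"
          by (simp add: mult_left_mono)
      qed
      also have "\<dots> = (\<integral>\<^sup>+x. (\<integral>\<^sup>+y. ennreal (u x * u y * k \<bar>x - y\<bar>) \<partial>lborel)
          + ennreal (M * N powr (- 2 * s)) * ennreal U * ennreal (u x) \<partial>lborel)"
      proof (rule nn_integral_cong)
        fix x
        have "ennreal (u x) * (\<integral>\<^sup>+y. ennreal (u y * (k \<bar>x - y\<bar> + M * N powr (- 2 * s))) \<partial>lborel)
          = (\<integral>\<^sup>+y. ennreal (u x) * ennreal (u y * (k \<bar>x - y\<bar> + M * N powr (- 2 * s))) \<partial>lborel)"
          by (rule nn_integral_cmult[symmetric]) simp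
        also have "\<dots> = (\<integral>\<^sup>+y. ennreal (u x * u y * k \<bar>x - y\<bar>) + ennreal (u x * (M * N powr (- 2 * s))) * ennreal (u y) \<partial>lborel)"
          using u0 k0 M by (intro nn_integral_cong)
            (simp add: ennreal_mult[symmetric] ennreal_plus[symmetric] algebra_simps del: ennreal_plus)
        also have "\<dots> = (\<integral>\<^sup>+y. ennreal (u x * u y * k \<bar>x - y\<bar>) \<partial>lborel) + ennreal (u x * (M * N powr (- 2 * s))) * ennreal U"
          by (simp add: nn_integral_add nn_integral_cmult U(2))
        finally show "ennreal (u x) * (\<integral>\<^sup>+y. ennreal (u y * (k \<bar>x - y\<bar> + M * N powr (- 2 * s))) \<partial>lborel)
          = (\<integral>\<^sup>+y. ennreal (u x * u y * k \<bar>x - y\<bar>) \<partial>lborel) + ennreal (M * N powr (- 2 * s)) * ennreal U * ennreal (u x)"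
          using u0 M by (simp add: ennreal_mult mult_ac)
      qed
      also have "\<dots> = (\<integral>\<^sup>+x. \<integral>\<^sup>+y. ennreal (u x * u y * k \<bar>x - y\<bar>) \<partial>lborel \<partial>lborel) + ennreal (M * N powr (- 2 * s)) * ennreal U * ennreal U"
        by (simp add: nn_integral_add nn_integral_cmult U(2))
      also have "\<dots> \<le> ennreal (D * X powr (2 / p)) + ennreal (M * N powr (- 2 * s)) * ennreal U * ennreal U"
        unfolding p_def by (intro add_right_mono form u0 X0 uP) simp
      also have "\<dots> = ennreal (D * X powr (2 / p) + M * N powr (- 2 * s) * (U * U))"
        using U M D by (simp add: ennreal_mult[symmetric] ennreal_plus[symmetric] mult.assoc del: ennreal_plus)
      finally have "ennreal (cmod (complex_of_real (Q N))) \<le> ennreal (D * X powr (2 / p) + M * N powr (- 2 * s) * (U * U))" .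
      hence "cmod (complex_of_real (Q N)) \<le> D * X powr (2 / p) + M * N powr (- 2 * s) * (U * U)"
        using U M D by (subst (asm) ennreal_le_iff) auto
      thus ?thesis by simp
    qed
    \<comment> \<open>The kernel form controls only the frequencies up to N. The others are left as
      they are and disappear by dominated convergence, with the integrable majorant |W g|.\<close>
    define T where "T = (\<lambda>N::nat. (LINT \<xi>|lborel. indicator (- {- real N..real N}) \<xi> * cmod (W \<xi> * g \<xi>)))"
    have le: "X \<le> T N + (\<theta> / 2 * H + 2 powr s / (2 * \<theta>) * (D * X powr (2 / p) + M * real N powr (- 2 * s) * (U * U)))"
      if N: "1 \<le> N" for N
    proof -
      have N1: "1 \<le> real N" using N by simp
      have iT: "integrable lborel (\<lambda>\<xi>. indicator (- {- real N..real N}) \<xi> * cmod (W \<xi> * g \<xi>))"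
        using gW by (rule Bochner_Integration.integrable_bound) (auto simp: indicator_def)
      have iQ: "integrable lborel (\<lambda>\<xi>. indicator {- real N..real N} \<xi> * (sobolev_weight s \<bar>\<xi>\<bar> * (cmod (W \<xi>))\<^sup>2))"
        using N1 by (intro TT(2)) auto
      have "X = cmod (LINT \<xi>|lborel. W \<xi> * g \<xi>)" using X0 by (simp flip: XW)
      also have "\<dots> \<le> (LINT \<xi>|lborel. cmod (W \<xi> * g \<xi>))" by (rule integral_norm_bound)
      also have "\<dots> \<le> (LINT \<xi>|lborel. indicator (- {- real N..real N}) \<xi> * cmod (W \<xi> * g \<xi>) +
         (\<theta> / 2 * (?b \<xi> * (cmod (g \<xi>))\<^sup>2) + 2 powr s / (2 * \<theta>) * (indicator {- real N..real N} \<xi> * (sobolev_weight s \<bar>\<xi>\<bar> * (cmod (W \<xi>))\<^sup>2))))"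
      proof (rule integral_mono[OF gW])
        show "integrable lborel (\<lambda>\<xi>. indicator (- {- real N..real N}) \<xi> * cmod (W \<xi> * g \<xi>) +
         (\<theta> / 2 * (?b \<xi> * (cmod (g \<xi>))\<^sup>2) + 2 powr s / (2 * \<theta>) * (indicator {- real N..real N} \<xi> * (sobolev_weight s \<bar>\<xi>\<bar> * (cmod (W \<xi>))\<^sup>2))))"
          by (intro Bochner_Integration.integrable_add integrable_mult_right iT iQ bg)
        fix \<xi> :: real
        show "cmod (W \<xi> * g \<xi>) \<le> indicator (- {- real N..real N}) \<xi> * cmod (W \<xi> * g \<xi>) +
         (\<theta> / 2 * (?b \<xi> * (cmod (g \<xi>))\<^sup>2) + 2 powr s / (2 * \<theta>) * (indicator {- real N..real N} \<xi> * (sobolev_weight s \<bar>\<xi>\<bar> * (cmod (W \<xi>))\<^sup>2)))"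
        proof (cases "\<xi> \<in> {- real N..real N}")
          case False
          have "0 \<le> \<theta> / 2 * (?b \<xi> * (cmod (g \<xi>))\<^sup>2)" using \<theta> by simp
          thus ?thesis using False by simp
        next
          case True
          define b where "b = ?b \<xi>"
          have b: "b > 0" unfolding b_def by (rule one_plus_square_powr_pos)
          define A B where "A = cmod (g \<xi>)" and "B = cmod (W \<xi>)"
          have "A * B \<le> \<theta> / 2 * (b * A\<^sup>2) + 1 / (2 * \<theta>) * (1 / b * B\<^sup>2)"
          proof -
            have "0 \<le> (\<theta> * b * A - B)\<^sup>2" by simp
            hence "2 * \<theta> * b * (A * B) \<le> (\<theta> * b)\<^sup>2 * A\<^sup>2 + B\<^sup>2"
              by (simp add: power2_eq_square algebra_simps)
            hence "2 * \<theta> * b * (A * B) / (2 * \<theta> * b) \<le> ((\<theta> * b)\<^sup>2 * A\<^sup>2 + B\<^sup>2) / (2 * \<theta> * b)"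
              using \<theta> b by (intro divide_right_mono) auto
            thus ?thesis using \<theta> b by (simp add: field_simps power2_eq_square)
          qed
          also have "1 / b * B\<^sup>2 \<le> 2 powr s * sobolev_weight s \<bar>\<xi>\<bar> * B\<^sup>2"
            unfolding b_def by (intro mult_right_mono sobolev_weight_lower s0) simp
          hence "1 / (2 * \<theta>) * (1 / b * B\<^sup>2) \<le> 1 / (2 * \<theta>) * (2 powr s * sobolev_weight s \<bar>\<xi>\<bar> * B\<^sup>2)"
            using \<theta> by (intro mult_left_mono) auto
          finally show ?thesis using True
            by (simp add: A_def B_def b_def norm_mult mult_ac)
        qed
      qed
      also have "\<dots> = T N + (\<theta> / 2 * H + 2 powr s / (2 * \<theta>) * Q (real N))"
        unfolding T_def Q_def bgH[symmetric]
        by (simp only: Bochner_Integration.integral_add Bochner_Integration.integrable_add integrable_mult_right iT iQ bg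
            Bochner_Integration.integral_mult_right_zero)
      also have "\<dots> \<le> T N + (\<theta> / 2 * H + 2 powr s / (2 * \<theta>) * (D * X powr (2 / p) + M * real N powr (- 2 * s) * (U * U)))"
        using \<theta> N1 by (intro add_left_mono mult_left_mono Q) auto
      finally show ?thesis .
    qed
    have T: "T \<longlonglongrightarrow> 0"
    proof -
      have "T \<longlonglongrightarrow> (LINT \<xi>::real|lborel. 0)" unfolding T_def
      proof (rule integral_dominated_convergence[where w = "\<lambda>\<xi>. cmod (W \<xi> * g \<xi>)"])
        show "AE \<xi> in lborel. (\<lambda>N. indicator (- {- real N..real N}) \<xi> * cmod (W \<xi> * g \<xi>)) \<longlonglongrightarrow> 0"
        proof (rule AE_I2)
          fix \<xi> :: real
          have "\<forall>\<^sub>F N in sequentially. \<bar>\<xi>\<bar> \<le> real N"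
            using eventually_ge_at_top[of "nat \<lceil>\<bar>\<xi>\<bar>\<rceil>"] by eventually_elim linarith
          hence "\<forall>\<^sub>F N in sequentially. indicator (- {- real N..real N}) \<xi> * cmod (W \<xi> * g \<xi>) = 0"
            by eventually_elim (auto simp: indicator_def)
          thus "(\<lambda>N. indicator (- {- real N..real N}) \<xi> * cmod (W \<xi> * g \<xi>)) \<longlonglongrightarrow> 0"
            by (rule tendsto_eventually)
        qed
      qed (use gW in \<open>auto simp: indicator_def\<close>)
      thus ?thesis by simp
    qed
    have "(\<lambda>N. real N powr (- 2 * s)) \<longlonglongrightarrow> 0"
      using s by (intro tendsto_neg_powr filterlim_real_sequentially) auto
    hence "(\<lambda>N. T N + (\<theta> / 2 * H + 2 powr s / (2 * \<theta>) * (D * X powr (2 / p) + M * real N powr (- 2 * s) * (U * U))))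
        \<longlonglongrightarrow> 0 + (\<theta> / 2 * H + 2 powr s / (2 * \<theta>) * (D * X powr (2 / p) + M * 0 * (U * U)))"
      by (intro tendsto_intros T)
    hence "X \<le> 0 + (\<theta> / 2 * H + 2 powr s / (2 * \<theta>) * (D * X powr (2 / p) + M * 0 * (U * U)))"
      by (rule tendsto_lowerbound) (use le in \<open>auto simp: eventually_sequentially\<close>)
    thus ?thesis by simp
  qed
  have "X \<le> (2 powr s * D * H) powr (q / 2)"
  proof (cases "X = 0")
    case False
    hence Xp: "X > 0" using X0 by simp
    define E where "E = 2 powr s * (D * X powr (2 / p))"
    have E: "0 \<le> E" using D by (simp add: E_def)
    \<comment> \<open>The optimal choice \<theta> = X/H gives X \<le> X/2 + H E/(2 X). For H = 0 any
      large \<theta> works, and (E + 1)/X already gives X \<le> X/2.\<close>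
    have HX: "X\<^sup>2 \<le> H * E"
    proof (cases "H = 0")
      case True
      have "X \<le> E / (2 * ((E + 1) / X))" using main[of "(E + 1) / X"] Xp E True by (simp add: E_def mult_ac)
      also have "\<dots> = X * (E / (2 * (E + 1)))" by (simp add: field_simps)
      also have "\<dots> \<le> X * (1 / 2)" using E Xp by (intro mult_left_mono) (auto simp: field_simps)
      finally show ?thesis using Xp by simp
    next
      case False
      hence "H > 0" using H by simp
      hence "X \<le> X / H / 2 * H + E / (2 * (X / H))" using main[of "X / H"] Xp by (simp add: E_def mult_ac)
      hence "X \<le> H * E / X" using Xp \<open>H > 0\<close> by (simp add: field_simps)
      thus ?thesis using Xp by (simp add: field_simps power2_eq_square)
    qed
    \<comment> \<open>Since 2 - 2/p = 2/q, dividing by the power of X contained in E leaves exactly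
      the power whose (q/2)-th power is X.\<close>
    have "X powr (2 / q) = X\<^sup>2 / X powr (2 / p)"
      using Xp by (simp add: powr_diff powr_numeral flip: p(3))
    also have "\<dots> \<le> H * E / X powr (2 / p)" using HX by (intro divide_right_mono) auto
    also have "\<dots> = 2 powr s * D * H" using Xp by (simp add: E_def)
    finally have "(X powr (2 / q)) powr (q / 2) \<le> (2 powr s * D * H) powr (q / 2)"
      using q by (intro powr_mono2) auto
    thus ?thesis using Xp q by (simp add: powr_powr)
  qed simp
  thus ?thesis unfolding X by (rule ennreal_leI)
qed

section \<open>From linearized operators to the maximal function\<close>

lemma ennreal_power_ennreal: "0 \<le> r \<Longrightarrow> ennreal_power (ennreal r) p = ennreal (r powr p)"
  by (simp add: ennreal_power_def)

lemma ennreal_power_mono: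
  assumes "0 \<le> p" "x \<le> y"
  shows "ennreal_power x p \<le> ennreal_power y p"
proof (cases "y = \<infinity>")
  case False
  hence "x \<noteq> \<infinity>" using assms(2) by (auto simp: top_unique)
  thus ?thesis using assms False
    by (auto simp: ennreal_power_def top.not_eq_extremum intro!: ennreal_leI powr_mono2 enn2real_mono)
qed (simp add: ennreal_power_def)

lemma ennreal_power_inverse: "0 < p \<Longrightarrow> ennreal_power (ennreal_power x p) (1 / p) = x"
  by (cases x) (auto simp: ennreal_power_ennreal powr_powr ennreal_power_def)

lemma ennreal_power_inverse': "0 < p \<Longrightarrow> ennreal_power (ennreal_power x (1 / p)) p = x"
  using ennreal_power_inverse[of "1 / p" x] by simp

text \<open>The power and its inverse are monotone, so the bound can be transferred to each member
  of the family, passed to the supremum there and transferred back.\<close>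

lemma ennreal_power_SUP_le:
  assumes "0 < p" "\<And>i. i \<in> I \<Longrightarrow> ennreal_power (f i) p \<le> z"
  shows "ennreal_power (SUP i\<in>I. f i) p \<le> z"
proof -
  have "f i \<le> ennreal_power z (1 / p)" if "i \<in> I" for i
    using ennreal_power_mono[OF _ assms(2)[OF that], of "1 / p"] assms(1)
    by (simp add: ennreal_power_inverse)
  hence "(SUP i\<in>I. f i) \<le> ennreal_power z (1 / p)" by (rule SUP_least)
  from ennreal_power_mono[OF _ this, of p] show ?thesis using assms(1) by (simp add: ennreal_power_inverse')
qed

lemma propagator_measurable:
  assumes [measurable]: "fourier f \<in> borel_measurable borel" "\<tau> \<in> borel_measurable borel"
  shows "(\<lambda>x. propagator a (\<tau> x) f x) \<in> borel_measurable borel"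
proof -
  have "case_prod (\<lambda>x \<xi>. plane_wave a (\<tau> x) x \<xi> * fourier f \<xi>) \<in> borel_measurable (borel \<Otimes>\<^sub>M lborel)"
    by measurable
  from lborel.borel_measurable_lebesgue_integral[OF this] show ?thesis by (simp add: propagator_eq)
qed

lemma propagator_continuous_time:
  assumes "integrable lborel (fourier f)"
  shows "isCont (\<lambda>t. propagator a t f x) t"
proof (rule continuous_at_sequentiallyI)
  fix u :: "nat \<Rightarrow> real" assume u: "u \<longlonglongrightarrow> t"
  have [measurable]: "fourier f \<in> borel_measurable borel" using assms by (auto dest: borel_measurable_integrable)
  show "(\<lambda>n. propagator a (u n) f x) \<longlonglongrightarrow> propagator a t f x"
    unfolding propagator_eq
  proof (rule integral_dominated_convergence[where w = "\<lambda>\<xi>. cmod (fourier f \<xi>)"])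
    show "AE \<xi> in lborel. (\<lambda>n. plane_wave a (u n) x \<xi> * fourier f \<xi>) \<longlonglongrightarrow> plane_wave a t x \<xi> * fourier f \<xi>"
      unfolding plane_wave_def cis_conv_exp by (intro AE_I2 tendsto_intros u)
  qed (use assms in \<open>auto simp: norm_mult\<close>)
qed

text \<open>Finite stages of a measurable selection: stage n is a best time among the first n + 1
  candidates. Each stage takes finitely many values and is decided by comparing measurable
  functions, so it stays Borel in x.\<close>

primrec running_argmax :: "(nat \<Rightarrow> real) \<Rightarrow> (real \<Rightarrow> real \<Rightarrow> real) \<Rightarrow> nat \<Rightarrow> real \<Rightarrow> real" where
  "running_argmax t S 0 x = t 0"
| "running_argmax t S (Suc n) x =
     (if S (running_argmax t S n x) x < S (t (Suc n)) x then t (Suc n) else running_argmax t S n x)"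

lemma running_argmax_max: "k \<le> n \<Longrightarrow> S (t k) x \<le> S (running_argmax t S n x) x"
  by (induction n) (auto simp: le_Suc_eq intro: order_trans less_imp_le)

lemma running_argmax_range: "running_argmax t S n x \<in> range t"
  by (induction n) auto

lemma running_argmax_mono: "S (running_argmax t S n x) x \<le> S (running_argmax t S (Suc n) x) x"
  by auto

text \<open>By continuity in time, bounds at the countably many rational times carry over to all
  times. Along an enumeration of them the values at the running best time increase to the supremum,
  so monotone convergence carries the uniform bound for measurable \<tau> over to the maximal
  function.\<close>

lemma maximal_function_from_linearized:
  fixes q :: real
  assumes q: "0 < q" and f: "integrable lborel (fourier f)"
    and le: "\<And>\<tau> R. \<tau> \<in> borel_measurable borel \<Longrightarrow> (\<And>x. 0 < \<tau> x \<and> \<tau> x < 1) \<Longrightarrow> 0 \<le> R \<Longrightarrow>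
       (\<integral>\<^sup>+x. ennreal (indicator {-R..R} x * cmod (propagator a (\<tau> x) f x) powr q) \<partial>lborel) \<le> B"
  shows "(\<integral>\<^sup>+x. ennreal_power (maximal_function a f x) q \<partial>lborel) \<le> B"
proof -
  have [measurable]: "fourier f \<in> borel_measurable borel" using f by (auto dest: borel_measurable_integrable)
  define T where "T = \<rat> \<inter> {0<..<1::real}"
  have T: "countable T" "T \<noteq> {}"
  proof -
    show "countable T" unfolding T_def by (intro countable_Int1 countable_rat)
    have "1 / 2 \<in> T" by (simp add: T_def)
    thus "T \<noteq> {}" by blast
  qed
  define t where "t = from_nat_into T"
  have t: "range t = T" unfolding t_def using T by (intro range_from_nat_into)
  define S where "S = (\<lambda>s x. cmod (propagator a s f x))"
  define \<tau> where "\<tau> = running_argmax t S"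
  have Sm: "(\<lambda>x. S (\<sigma> x) x) \<in> borel_measurable borel" if "\<sigma> \<in> borel_measurable borel" for \<sigma>
    unfolding S_def using propagator_measurable[OF _ that] by measurable
  have \<tau>m [measurable]: "\<tau> n \<in> borel_measurable borel" for n
  proof (induction n)
    case 0
    show ?case unfolding \<tau>_def by (simp add: running_argmax_def)
  next
    case (Suc n)
    have [measurable]: "\<tau> n \<in> borel_measurable borel" "(\<lambda>x. S (\<tau> n x) x) \<in> borel_measurable borel"
      "(\<lambda>x. S (t (Suc n)) x) \<in> borel_measurable borel"
      using Suc Sm[OF Suc] Sm[of "\<lambda>_. t (Suc n)"] by auto
    have "\<tau> (Suc n) = (\<lambda>x. if S (\<tau> n x) x < S (t (Suc n)) x then t (Suc n) else \<tau> n x)"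
      unfolding \<tau>_def by (rule ext) simp
    also have "\<dots> \<in> borel_measurable borel" by measurable
    finally show ?case .
  qed
  have \<tau>T: "\<tau> n x \<in> T" for n x unfolding \<tau>_def t[symmetric] by (rule running_argmax_range)
  \<comment> \<open>The cutoff to [-n, n] grows together with the set of candidate times, so a
    single monotone limit removes both restrictions.\<close>
  define u where "u = (\<lambda>n x. ennreal (indicator {-real n..real n} x * S (\<tau> n x) x powr q))"
  have um [measurable]: "u n \<in> borel_measurable borel" for n
    unfolding u_def using Sm[OF \<tau>m] by measurable
  have inc: "incseq u"
  proof (rule incseq_SucI, rule le_funI)
    fix n x
    have "S (\<tau> n x) x \<le> S (\<tau> (Suc n) x) x" unfolding \<tau>_def by (rule running_argmax_mono)
    hence "S (\<tau> n x) x powr q \<le> S (\<tau> (Suc n) x) x powr q" using q by (intro powr_mono2) (auto simp: S_def)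
    thus "u n x \<le> u (Suc n) x" unfolding u_def by (intro ennreal_leI mult_mono) (auto simp: indicator_def)
  qed
  have "(\<integral>\<^sup>+x. ennreal_power (maximal_function a f x) q \<partial>lborel) \<le> (\<integral>\<^sup>+x. (SUP n. u n x) \<partial>lborel)"
  proof (rule nn_integral_mono)
    fix x :: real
    define z where "z = (SUP n. u n x)"
    have T_le: "ennreal (S r x powr q) \<le> z" if rT: "r \<in> T" for r
    proof -
      obtain k where k: "r = t k" using rT t by blast
      \<comment> \<open>Large enough that r is among the candidates and that x lies inside the
        cutoff.\<close>
      define n where "n = max k (nat \<lceil>\<bar>x\<bar>\<rceil>)"
      have n: "k \<le> n" "\<bar>x\<bar> \<le> real n" unfolding n_def by linarith+
      have "S r x \<le> S (\<tau> n x) x" unfolding k \<tau>_def by (rule running_argmax_max[OF n(1)])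
      hence "S r x powr q \<le> S (\<tau> n x) x powr q" using q by (intro powr_mono2) (auto simp: S_def)
      also have "\<dots> = indicator {-real n..real n} x * S (\<tau> n x) x powr q" using n(2) by (simp add: indicator_def abs_le_iff)
      finally have "ennreal (S r x powr q) \<le> u n x" unfolding u_def by (rule ennreal_leI)
      thus ?thesis unfolding z_def by (rule SUP_upper2[OF UNIV_I])
    qed
    have "ennreal_power (maximal_function a f x) q \<le> z"
      unfolding maximal_function_def
    proof (rule ennreal_power_SUP_le[OF q])
      fix s :: real assume s: "s \<in> {0<..<1}"
      have "ennreal (S s x powr q) \<le> z"
      proof (cases z)
        case (real z')
        have "S s x powr q \<le> z'"
        proof (rule ccontr)
          assume "\<not> S s x powr q \<le> z'"
          hence gt: "S s x powr q > z'" by simp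
          have "isCont (\<lambda>s. S s x powr q) s"
          proof -
            have "isCont (\<lambda>s. S s x) s" unfolding S_def by (intro isCont_norm propagator_continuous_time f)
            thus ?thesis using q unfolding isCont_def by (intro tendsto_powr' tendsto_const) (auto simp: S_def)
          qed
          hence "((\<lambda>s. S s x powr q) \<longlongrightarrow> S s x powr q) (at s)" by (simp add: isCont_def)
          hence "\<forall>\<^sub>F r in at s. z' < S r x powr q" using gt by (rule order_tendstoD)
          then obtain d where d: "d > 0" "\<And>r. r \<noteq> s \<Longrightarrow> dist r s < d \<Longrightarrow> z' < S r x powr q"
            unfolding eventually_at by auto
          obtain r where r: "r \<in> \<rat>" "s < r" "r < min 1 (s + d)"
            using Rats_dense_in_real[of s "min 1 (s + d)"] d s by auto
          have "r \<in> T" using r s by (simp add: T_def)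
          from T_le[OF this] have "S r x powr q \<le> z'" using real by simp
          moreover have "z' < S r x powr q" using r by (intro d) (auto simp: dist_real_def)
          ultimately show False by simp
        qed
        thus ?thesis using real by (simp add: ennreal_leI)
      qed simp
      thus "ennreal_power (ennreal (cmod (propagator a s f x))) q \<le> z"
        by (simp add: ennreal_power_ennreal S_def)
    qed
    thus "ennreal_power (maximal_function a f x) q \<le> (SUP n. u n x)" by (simp only: z_def)
  qed
  also have "\<dots> = (SUP n. \<integral>\<^sup>+x. u n x \<partial>lborel)"
    by (rule nn_integral_monotone_convergence_SUP[OF inc]) simp
  also have "\<dots> \<le> B"
  proof (rule SUP_least)
    fix n
    show "(\<integral>\<^sup>+x. u n x \<partial>lborel) \<le> B" unfolding u_def S_def
    proof (rule le)
      show "0 < \<tau> n x \<and> \<tau> n x < 1" for x using \<tau>T[of n x] by (simp add: T_def)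
    qed auto
  qed
  finally show ?thesis .
qed

lemma schwartz_borel_measurable:
  assumes "schwartz f"
  shows "f \<in> borel_measurable borel"
proof -
  have "f differentiable (at x)" for x
    using assms unfolding schwartz_def by (metis funpow_0 nth_derivative_def)
  hence "continuous_on UNIV f"
    by (intro continuous_at_imp_continuous_on) (auto intro: differentiable_imp_continuous_within)
  thus ?thesis by (rule borel_measurable_continuous_onI)
qed

lemma fourier_borel_measurable:
  assumes "schwartz f"
  shows "fourier f \<in> borel_measurable borel"
proof -
  note [measurable] = schwartz_borel_measurable[OF assms]
  have "case_prod (\<lambda>\<xi> x. exp (- \<i> * complex_of_real (x * \<xi>)) * f x) \<in> borel_measurable (borel \<Otimes>\<^sub>M lborel)"
    by measurable
  from lborel.borel_measurable_lebesgue_integral[OF this] show ?thesis by (simp add: fourier_def [abs_def])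
qed

text \<open>Multiplication by a unimodular plane wave does not affect integrability, and the Bochner
  integral of a non-integrable function is 0. A non-integrable transform is therefore a trivial case
  of the estimates.\<close>

lemma maximal_function_not_integrable:
  assumes "\<not> integrable lborel (fourier f)" "fourier f \<in> borel_measurable borel"
  shows "maximal_function a f x = 0"
proof -
  note [measurable] = assms(2)
  have "propagator a t f x = 0" for t
  proof -
    have "\<not> integrable lborel (\<lambda>\<xi>. plane_wave a t x \<xi> * fourier f \<xi>)"
    proof
      assume "integrable lborel (\<lambda>\<xi>. plane_wave a t x \<xi> * fourier f \<xi>)"
      hence "integrable lborel (fourier f)"
        by (rule Bochner_Integration.integrable_bound) (auto simp: norm_mult)
      thus False using assms by simp
    qed
    thus ?thesis by (simp add: propagator_eq not_integrable_integral_eq)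
  qed
  thus ?thesis by (simp add: maximal_function_def)
qed

text \<open>The common end of the arguments for finite q: what depends on the exponents enters
  through a pointwise majorant of the kernel and a bound for its bilinear form on the dual space.
  The power q/2 of the linearized estimate and the outer power 1/q combine to the square root in the
  Sobolev norm.\<close>

lemma maximal_estimate_finite_from_kernel:
  fixes k :: "real \<Rightarrow> real" and a q s D M :: real
  assumes q: "2 \<le> q" and s: "0 < s"
    and k [measurable]: "k \<in> borel_measurable borel" and k0: "\<And>x. 0 \<le> k x" and M: "0 \<le> M"
    and kernel: "\<And>N x t. 1 \<le> N \<Longrightarrow> x \<noteq> 0 \<Longrightarrow> \<bar>t\<bar> \<le> 1 \<Longrightarrow>
        cmod (maximal_kernel a s N x t) \<le> k \<bar>x\<bar> + M * N powr (- 2 * s)"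
    and form: "\<And>u P. u \<in> borel_measurable borel \<Longrightarrow> (\<And>x. 0 \<le> u x) \<Longrightarrow> 0 \<le> P \<Longrightarrow>
        (\<integral>\<^sup>+x. ennreal (u x powr (q / (q - 1))) \<partial>lborel) = ennreal P \<Longrightarrow>
        (\<integral>\<^sup>+x. \<integral>\<^sup>+y. ennreal (u x * u y * k \<bar>x - y\<bar>) \<partial>lborel \<partial>lborel) \<le> ennreal (D * P powr (2 / (q / (q - 1))))"
    and D: "0 < D"
  shows "maximal_estimate a (ennreal q) s"
  unfolding maximal_estimate_def
proof (intro exI allI impI)
  fix f assume f: "schwartz f"
  note fm [measurable] = fourier_borel_measurable[OF f]
  define C where "C = (2 powr s * D) powr (1 / 2)"
  \<comment> \<open>Positivity matters when the Sobolev norm is infinite, since 0 times infinity is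
    0 in \<open>ennreal\<close>.\<close>
  have C: "0 < C" using D by (simp add: C_def)
  have nrm: "Lq_norm (ennreal q) g = ennreal_power (\<integral>\<^sup>+x. ennreal_power (g x) q \<partial>lborel) (1 / q)" for g
    using q by (simp add: Lq_norm_def)
  show "Lq_norm (ennreal q) (maximal_function a f) \<le> ennreal C * sobolev_norm s f"
  proof (cases "integrable lborel (fourier f)")
    case False
    hence "Lq_norm (ennreal q) (maximal_function a f) = 0"
      using q by (simp add: nrm maximal_function_not_integrable[OF False fm] ennreal_power_def)
    thus ?thesis by simp
  next
    case int: True
    show ?thesis
    proof (cases "\<integral>\<^sup>+\<xi>. ennreal ((1 + \<bar>\<xi>\<bar>\<^sup>2) powr s * (cmod (fourier f \<xi>))\<^sup>2) \<partial>lborel")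
      case top
      thus ?thesis using C by (simp add: sobolev_norm_def ennreal_power_def ennreal_mult_top)
    next
      case (real H)
      have "(\<integral>\<^sup>+x. ennreal_power (maximal_function a f x) q \<partial>lborel) \<le> ennreal ((2 powr s * D * H) powr (q / 2))"
      proof (rule maximal_function_from_linearized[OF _ int])
        fix \<tau> :: "real \<Rightarrow> real" and R :: real
        assume "\<tau> \<in> borel_measurable borel" "\<And>x. 0 < \<tau> x \<and> \<tau> x < 1" "0 \<le> R"
        thus "(\<integral>\<^sup>+x. ennreal (indicator {-R..R} x * cmod (propagator a (\<tau> x) f x) powr q) \<partial>lborel)
          \<le> ennreal ((2 powr s * D * H) powr (q / 2))"
          unfolding propagator_eq
          by (intro linearized_estimate[OF q s int real(2,1) _ _ k k0 M kernel form]) (use D in auto)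
      qed (use q in auto)
      hence "Lq_norm (ennreal q) (maximal_function a f) \<le> ennreal_power (ennreal ((2 powr s * D * H) powr (q / 2))) (1 / q)"
        unfolding nrm using q by (intro ennreal_power_mono) auto
      also have "\<dots> = ennreal ((2 powr s * D * H) powr (1 / 2))"
        using q by (simp add: ennreal_power_ennreal powr_powr)
      also have "\<dots> = ennreal C * ennreal (H powr (1 / 2))"
        using D by (simp add: C_def powr_mult ennreal_mult')
      also have "\<dots> = ennreal C * sobolev_norm s f"
        using real by (simp add: sobolev_norm_def ennreal_power_ennreal)
      finally show ?thesis .
    qed
  qed
qed

section \<open>Sufficiency\<close>

lemma maximal_estimate_mono:
  assumes "maximal_estimate a q s" "s \<le> s'"
  shows "maximal_estimate a q s'"
proof -
  have "sobolev_norm s f \<le> sobolev_norm s' f" for f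
    unfolding sobolev_norm_def using assms(2)
    by (intro ennreal_power_mono nn_integral_mono ennreal_leI mult_right_mono powr_mono) auto
  moreover from assms(1) obtain C where
    "\<And>f. schwartz f \<Longrightarrow> Lq_norm q (maximal_function a f) \<le> ennreal C * sobolev_norm s f"
    unfolding maximal_estimate_def by blast
  ultimately show ?thesis
    unfolding maximal_estimate_def by (meson mult_left_mono order_trans zero_le)
qed

text \<open>The summand 1 keeps the constant positive even for C = 0, as required when passing from
  the kernel to the maximal estimate.\<close>

lemma Hardy_Littlewood_Sobolev_form:
  fixes u :: "real \<Rightarrow> real" and q P C :: real
  assumes q: "2 < q" and u [measurable]: "u \<in> borel_measurable borel" "\<And>x. 0 \<le> u x"
    and P: "0 \<le> P" "(\<integral>\<^sup>+x. ennreal (u x powr (q / (q - 1))) \<partial>lborel) = ennreal P" and C: "0 \<le> C"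
  shows "(\<integral>\<^sup>+x. \<integral>\<^sup>+y. ennreal (u x * u y * (C * \<bar>x - y\<bar> powr (- 2 / q))) \<partial>lborel \<partial>lborel)
     \<le> ennreal ((C * (2 * (2 / (1 - 2 / q) + 3)) + 1) * P powr (2 / (q / (q - 1))))"
proof -
  have q1: "0 \<le> 2 / (1 - 2 / q)" using q by simp
  have "(\<integral>\<^sup>+x. \<integral>\<^sup>+y. ennreal (u x * u y * (C * \<bar>x - y\<bar> powr (- 2 / q))) \<partial>lborel \<partial>lborel)
    = (\<integral>\<^sup>+x. \<integral>\<^sup>+y. ennreal C * ennreal (u x * u y * \<bar>x - y\<bar> powr (- 2 / q)) \<partial>lborel \<partial>lborel)"
    using C u by (intro nn_integral_cong) (simp add: ennreal_mult[symmetric] mult_ac)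
  also have "\<dots> = ennreal C * (\<integral>\<^sup>+x. \<integral>\<^sup>+y. ennreal (u x * u y * \<bar>x - y\<bar> powr (- 2 / q)) \<partial>lborel \<partial>lborel)"
    by (simp add: nn_integral_cmult)
  also have "\<dots> \<le> ennreal C * ennreal (2 * (2 / (1 - 2 / q) + 3) * P powr (2 / (q / (q - 1))))"
    by (intro mult_left_mono Hardy_Littlewood_Sobolev q u P) simp
  also have "\<dots> = ennreal (C * (2 * (2 / (1 - 2 / q) + 3)) * P powr (2 / (q / (q - 1))))"
    using C by (simp add: ennreal_mult'[symmetric] mult.assoc)
  also have "\<dots> \<le> ennreal ((C * (2 * (2 / (1 - 2 / q) + 3)) + 1) * P powr (2 / (q / (q - 1))))"
    by (intro ennreal_leI mult_right_mono) auto
  finally show ?thesis .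
qed

text \<open>At this s one has 2 s - 1 = -2/q, and q \<ge> 4 is equivalent to s \<ge> 1/4. Hence one
  power bound, valid for every x and t, has exactly the homogeneity of fractional integration, and
  no error term in N arises.\<close>

lemma maximal_estimate_large_exponent:
  fixes a q :: real
  assumes a: "a > 1" and q: "4 \<le> q"
  shows "maximal_estimate a (ennreal q) (1 / 2 - 1 / q)"
proof -
  define s where "s = 1 / 2 - 1 / q"
  have s: "1 / 4 \<le> s" "s < 1 / 2" "2 * s - 1 = - 2 / q"
    using q by (auto simp: s_def field_simps)
  obtain C where C: "0 \<le> C" "\<And>N x t. 0 < N \<Longrightarrow> x \<noteq> 0 \<Longrightarrow> cmod (maximal_kernel a s N x t) \<le> C * \<bar>x\<bar> powr (- 2 / q)"
    using maximal_kernel_bound[OF a s(1) order_refl s(2)] unfolding s(3) by blast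
  have q2: "2 < q" "0 \<le> 2 / (1 - 2 / q)" using q by auto
  have "maximal_estimate a (ennreal q) s"
  proof (rule maximal_estimate_finite_from_kernel[where k = "\<lambda>y. C * y powr (- 2 / q)" and M = 0
        and D = "C * (2 * (2 / (1 - 2 / q) + 3)) + 1"])
    show "0 < C * (2 * (2 / (1 - 2 / q) + 3)) + 1" using C q2 by (simp add: add_nonneg_pos)
  qed (use q s C Hardy_Littlewood_Sobolev_form[OF q2(1)] in auto)
  thus ?thesis by (simp add: s_def)
qed

text \<open>For |x| < 1 the bound |x|^(-1/2) is better than |x|^(-2/q) because q < 4. For |x| \<ge>
  1 the decay with \<beta> = 2/q is needed, and the critical s is the one for which the
  stationary-phase condition on \<beta> is an equality.\<close>

lemma maximal_estimate_medium_exponent: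
  fixes a q :: real
  assumes a: "a > 1" and q: "2 < q" "q < 4"
  shows "maximal_estimate a (ennreal q) (1 / 2 - a / 4 + a / q - 1 / q)"
proof -
  define s where "s = 1 / 2 - a / 4 + a / q - 1 / q"
  have s_eq: "s = 1 / 4 + (a - 1) * (1 / q - 1 / 4)" by (simp add: s_def algebra_simps diff_divide_distrib)
  have "0 < (a - 1) * (1 / q - 1 / 4)" using a q by (intro mult_pos_pos) (auto simp: field_simps)
  hence s: "1 / 4 \<le> s" by (simp add: s_eq)
  \<comment> \<open>Any d strictly between 0 and a - 1 that is at most 2 s would do; as 2/q \<le> 1,
    the remainder at the endpoint imposes nothing further.\<close>
  define d where "d = min ((a - 1) / 2) (2 * s)"
  have d: "0 < d" "d < a - 1" "d \<le> 2 * s" using a s unfolding d_def by (auto simp: min_less_iff_disj)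
  have "(2 * s - 1 / 2) / (a - 1) = 2 * (1 / q - 1 / 4)"
    using a by (simp add: s_eq)
  hence b1: "2 / q \<le> 1 / 2 + (2 * s - 1 / 2) / (a - 1)" by simp
  have "2 / q \<le> 1" "0 \<le> d / (a - 1)" using q d a by auto
  hence b2: "2 / q \<le> 1 + d / (a - 1)" by linarith
  have quarter: "1 / 4 < (1 / 2 :: real)" by simp
  obtain C1 where C1: "0 \<le> C1" "\<And>N x t. 0 < N \<Longrightarrow> x \<noteq> 0 \<Longrightarrow> cmod (maximal_kernel a s N x t) \<le> C1 * \<bar>x\<bar> powr (2 * (1 / 4) - 1)"
    using maximal_kernel_bound[OF a order_refl s quarter] by blast
  obtain C2 where C2: "0 \<le> C2" "\<And>N x t. 1 \<le> N \<Longrightarrow> 1 \<le> \<bar>x\<bar> \<Longrightarrow> \<bar>t\<bar> \<le> 1 \<Longrightarrow>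
       cmod (maximal_kernel a s N x t) \<le> C2 * (\<bar>x\<bar> powr (- (2 / q)) + N powr (- 2 * s))"
    using maximal_kernel_decay[OF a s d b1 b2] by blast
  define C where "C = C1 + C2"
  have q2: "0 \<le> 2 / (1 - 2 / q)" using q by simp
  have "maximal_estimate a (ennreal q) s"
  proof (rule maximal_estimate_finite_from_kernel[where k = "\<lambda>y. C * y powr (- 2 / q)" and M = C2
        and D = "C * (2 * (2 / (1 - 2 / q) + 3)) + 1"])
    show "0 < C * (2 * (2 / (1 - 2 / q) + 3)) + 1" using C1 C2 q2 by (simp add: C_def add_nonneg_pos)
    fix N x t :: real assume N: "1 \<le> N" and x: "x \<noteq> 0" and t: "\<bar>t\<bar> \<le> 1"
    have pos: "0 \<le> C1 * \<bar>x\<bar> powr (- 2 / q)" "0 \<le> C2 * \<bar>x\<bar> powr (- 2 / q)" "0 \<le> C2 * N powr (- 2 * s)"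
      using C1 C2 by auto
    show "cmod (maximal_kernel a s N x t) \<le> C * \<bar>x\<bar> powr (- 2 / q) + C2 * N powr (- 2 * s)"
    proof (cases "1 \<le> \<bar>x\<bar>")
      case True
      show ?thesis using C2(2)[OF N True t] pos by (simp add: C_def algebra_simps)
    next
      case False
      have "\<bar>x\<bar> powr (2 * (1 / 4) - 1) \<le> \<bar>x\<bar> powr (- 2 / q)"
        using False q by (intro powr_mono') (auto simp: field_simps)
      hence "C1 * \<bar>x\<bar> powr (2 * (1 / 4) - 1) \<le> C1 * \<bar>x\<bar> powr (- 2 / q)"
        using C1 by (intro mult_left_mono) auto
      thus ?thesis using C1(2)[of N x t] x N pos by (simp add: C_def algebra_simps)
    qed
  qed (use q s C1 C2 Hardy_Littlewood_Sobolev_form[OF q(1)] in \<open>auto simp: C_def\<close>)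
  thus ?thesis by (simp add: s_def)
qed

text \<open>The assumption s > a/4 says that (2 s - 1/2)/(a - 1) exceeds 1/2, so the kernel decays
  with some \<beta> > 1. Together with the singularity |x|^(-1/2) at the origin this gives an
  integrable majorant.\<close>

lemma maximal_estimate_square:
  fixes a s :: real
  assumes a: "a > 1" and s: "a / 4 < s"
  shows "maximal_estimate a 2 s"
proof -
  have s4: "1 / 4 \<le> s" using a s by simp
  define d where "d = min ((a - 1) / 2) (2 * s)"
  have d: "0 < d" "d < a - 1" "d \<le> 2 * s" using a s unfolding d_def by (auto simp: min_less_iff_disj)
  define \<beta> where "\<beta> = min (1 / 2 + (2 * s - 1 / 2) / (a - 1)) (1 + d / (a - 1))"
  have "1 / 2 < (2 * s - 1 / 2) / (a - 1)" using a s by (simp add: field_simps)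
  moreover have "0 < d / (a - 1)" using d a by simp
  ultimately have b: "1 < \<beta>" unfolding \<beta>_def by linarith
  have quarter: "1 / 4 < (1 / 2 :: real)" by simp
  obtain C1 where C1: "0 \<le> C1" "\<And>N x t. 0 < N \<Longrightarrow> x \<noteq> 0 \<Longrightarrow> cmod (maximal_kernel a s N x t) \<le> C1 * \<bar>x\<bar> powr (2 * (1 / 4) - 1)"
    using maximal_kernel_bound[OF a order_refl s4 quarter] by blast
  obtain C2 where C2: "0 \<le> C2" "\<And>N x t. 1 \<le> N \<Longrightarrow> 1 \<le> \<bar>x\<bar> \<Longrightarrow> \<bar>t\<bar> \<le> 1 \<Longrightarrow>
       cmod (maximal_kernel a s N x t) \<le> C2 * (\<bar>x\<bar> powr (- \<beta>) + N powr (- 2 * s))"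
    using maximal_kernel_decay[OF a s4 d, of \<beta>] unfolding \<beta>_def by auto
  define k where "k = (\<lambda>y. C1 * (y powr (- (1 / 2)) * indicator {..1} y) + C2 * (y powr (- \<beta>) * indicator {1<..} y))"
  have k [measurable]: "k \<in> borel_measurable borel" unfolding k_def by measurable
  have k0: "0 \<le> k y" for y using C1 C2 by (simp add: k_def)
  define K where "K = C1 * (2 * (1 powr (1 - 1 / 2) / (1 - 1 / 2))) + C2 * (2 * (1 powr (1 - \<beta>) / (\<beta> - 1)))"
  have K0: "0 \<le> K" using C1 C2 b by (simp add: K_def)
  have K: "(\<integral>\<^sup>+x. ennreal (k \<bar>x\<bar>) \<partial>lborel) \<le> ennreal K"
  proof -
    have "(\<integral>\<^sup>+x. ennreal (k \<bar>x\<bar>) \<partial>lborel) = (\<integral>\<^sup>+x. ennreal C1 * ennreal (\<bar>0 - x\<bar> powr (- (1 / 2)) * indicator {..1} \<bar>0 - x\<bar>)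
       + ennreal C2 * ennreal (\<bar>0 - x\<bar> powr (- \<beta>) * indicator {1<..} \<bar>0 - x\<bar>) \<partial>lborel)"
      unfolding k_def using C1 C2 by (intro nn_integral_cong) (simp add: ennreal_mult[symmetric] ennreal_plus[symmetric] del: ennreal_plus)
    also have "\<dots> = ennreal C1 * (\<integral>\<^sup>+x. ennreal (\<bar>0 - x\<bar> powr (- (1 / 2)) * indicator {..1} \<bar>0 - x\<bar>) \<partial>lborel)
       + ennreal C2 * (\<integral>\<^sup>+x. ennreal (\<bar>0 - x\<bar> powr (- \<beta>) * indicator {1<..} \<bar>0 - x\<bar>) \<partial>lborel)"
      by (subst nn_integral_add) (auto simp: nn_integral_cmult)
    also have "\<dots> \<le> ennreal C1 * ennreal (2 * (1 powr (1 - 1 / 2) / (1 - 1 / 2))) + ennreal C2 * ennreal (2 * (1 powr (1 - \<beta>) / (\<beta> - 1)))"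
      by (intro add_mono mult_left_mono nn_integral_powr_far nn_integral_powr_near[THEN eq_refl]) (use b in auto)
    also have "\<dots> = ennreal K"
    proof -
      have lin: "ennreal c * ennreal X + ennreal d * ennreal Y = ennreal (c * X + d * Y)"
        if "0 \<le> c" "0 \<le> d" "0 \<le> X" "0 \<le> Y" for c d X Y
        using that by (simp add: ennreal_mult)
      show ?thesis unfolding K_def by (rule lin) (use C1 C2 b in auto)
    qed
    finally show ?thesis .
  qed
  have "maximal_estimate a (ennreal 2) s"
  proof (rule maximal_estimate_finite_from_kernel[where k = k and M = C2 and D = "2 * K + 1"])
    show "0 < 2 * K + 1" using K0 by simp
    fix u :: "real \<Rightarrow> real" and P :: real
    assume u: "u \<in> borel_measurable borel" "\<And>x. 0 \<le> u x" and P: "0 \<le> P"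
      "(\<integral>\<^sup>+x. ennreal (u x powr (2 / (2 - 1))) \<partial>lborel) = ennreal P"
    have "(\<integral>\<^sup>+x. \<integral>\<^sup>+y. ennreal (u x * u y * k \<bar>x - y\<bar>) \<partial>lborel \<partial>lborel) \<le> ennreal (2 * K * P)"
      using P by (intro Schur_convolution u k k0 K K0) auto
    also have "\<dots> \<le> ennreal ((2 * K + 1) * P powr (2 / (2 / (2 - 1))))"
      using P by (intro ennreal_leI) (simp add: algebra_simps)
    finally show "(\<integral>\<^sup>+x. \<integral>\<^sup>+y. ennreal (u x * u y * k \<bar>x - y\<bar>) \<partial>lborel \<partial>lborel) \<le> ennreal ((2 * K + 1) * P powr (2 / (2 / (2 - 1))))" .
  next
    fix N x t :: real assume N: "1 \<le> N" and x: "x \<noteq> 0" and t: "\<bar>t\<bar> \<le> 1"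
    show "cmod (maximal_kernel a s N x t) \<le> k \<bar>x\<bar> + C2 * N powr (- 2 * s)"
    proof (cases "\<bar>x\<bar> \<le> 1")
      case True
      have "cmod (maximal_kernel a s N x t) \<le> C1 * \<bar>x\<bar> powr (- (1 / 2))" using C1(2)[of N x t] x N by simp
      thus ?thesis using True C2 by (simp add: k_def add_increasing2)
    next
      case False
      thus ?thesis using C2(2)[of N x t] N t by (simp add: k_def algebra_simps)
    qed
  qed (use s4 C2 k k0 in auto)
  thus ?thesis by simp
qed

section \<open>The uniform estimate\<close>

lemma maximal_function_le_integral:
  assumes "fourier f \<in> borel_measurable borel"
  shows "maximal_function a f x \<le> (\<integral>\<^sup>+\<xi>. ennreal (cmod (fourier f \<xi>)) \<partial>lborel)"
  unfolding maximal_function_def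
proof (rule SUP_least)
  fix t :: real
  show "ennreal (cmod (propagator a t f x)) \<le> (\<integral>\<^sup>+\<xi>. ennreal (cmod (fourier f \<xi>)) \<partial>lborel)"
    unfolding propagator_eq
    by (rule order_trans[OF norm_integral_le_nn_integral]) (simp add: norm_mult)
qed

lemma propagator_continuous_space:
  assumes "integrable lborel (fourier f)"
  shows "isCont (\<lambda>x. propagator a t f x) x"
proof (rule continuous_at_sequentiallyI)
  fix u :: "nat \<Rightarrow> real" assume u: "u \<longlonglongrightarrow> x"
  have [measurable]: "fourier f \<in> borel_measurable borel" using assms by (auto dest: borel_measurable_integrable)
  show "(\<lambda>n. propagator a t f (u n)) \<longlonglongrightarrow> propagator a t f x"
    unfolding propagator_eq
  proof (rule integral_dominated_convergence[where w = "\<lambda>\<xi>. cmod (fourier f \<xi>)"])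
    show "AE \<xi> in lborel. (\<lambda>n. plane_wave a t (u n) \<xi> * fourier f \<xi>) \<longlonglongrightarrow> plane_wave a t x \<xi> * fourier f \<xi>"
      unfolding plane_wave_def cis_conv_exp by (intro AE_I2 tendsto_intros u)
  qed (use assms in \<open>auto simp: norm_mult\<close>)
qed

text \<open>A supremum of continuous functions is lower semicontinuous. This gives measurability in
  spite of the uncountable supremum, and later shows that the essential supremum bounds the function
  at every point.\<close>

lemma maximal_function_superlevel_open:
  assumes "integrable lborel (fourier f)"
  shows "open {x. c < maximal_function a f x}"
proof -
  have "{x. c < maximal_function a f x} = (\<Union>t\<in>{0<..<1}. {x. c < ennreal (cmod (propagator a t f x))})"
    by (auto simp: maximal_function_def less_SUP_iff)
  also have "open \<dots>"
  proof (intro open_UN ballI)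
    fix t :: real
    have "continuous_on UNIV (\<lambda>x. ennreal (cmod (propagator a t f x)))"
      by (intro continuous_on_ennreal continuous_on_norm continuous_at_imp_continuous_on ballI
          propagator_continuous_space assms)
    thus "open {x. c < ennreal (cmod (propagator a t f x))}"
      by (intro open_Collect_less continuous_on_const)
  qed
  finally show ?thesis .
qed

lemma maximal_function_borel_measurable:
  assumes "fourier f \<in> borel_measurable borel"
  shows "maximal_function a f \<in> borel_measurable borel"
proof (cases "integrable lborel (fourier f)")
  case True
  show ?thesis
  proof (rule borel_measurableI_greater)
    fix c
    show "{x \<in> space borel. c < maximal_function a f x} \<in> sets borel"
      using maximal_function_superlevel_open[OF True, of c a] by simp
  qed
next
  case False
  hence "maximal_function a f = (\<lambda>x. 0)"
    using maximal_function_not_integrable[OF False assms] by auto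
  thus ?thesis by simp
qed

text \<open>The inverse weight is compared with 1 on the unit interval around 0 and with
  |\<xi>|^(-2s) outside it; both are instances of the power integrals already computed.\<close>

lemma sobolev_weight_integrable:
  assumes "1 / 2 < s"
  obtains A where "0 < A" "(\<integral>\<^sup>+\<xi>. ennreal (1 / (1 + \<bar>\<xi>\<bar>\<^sup>2) powr s) \<partial>lborel) \<le> ennreal A"
proof -
  define A where "A = 2 * (1 powr (1 - 0) / (1 - 0)) + 2 * (1 powr (1 - 2 * s) / (2 * s - 1))"
  have A: "0 < A" using assms by (simp add: A_def add_pos_pos)
  have "(\<integral>\<^sup>+\<xi>. ennreal (1 / (1 + \<bar>\<xi>\<bar>\<^sup>2) powr s) \<partial>lborel)
    \<le> (\<integral>\<^sup>+\<xi>. ennreal (\<bar>0 - \<xi>\<bar> powr (- 0) * indicator {..1} \<bar>0 - \<xi>\<bar>)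
         + ennreal (\<bar>0 - \<xi>\<bar> powr (- (2 * s)) * indicator {1<..} \<bar>0 - \<xi>\<bar>) \<partial>lborel)"
  proof (rule nn_integral_mono_AE)
    \<comment> \<open>The origin has to be excluded: \<open>0 powr (- 0)\<close> is 0, so the
      comparison fails there.\<close>
    have "AE \<xi> in lborel. \<xi> \<noteq> (0::real)" by (rule AE_lborel_singleton)
    thus "AE \<xi> in lborel. ennreal (1 / (1 + \<bar>\<xi>\<bar>\<^sup>2) powr s) \<le> ennreal (\<bar>0 - \<xi>\<bar> powr (- 0) * indicator {..1} \<bar>0 - \<xi>\<bar>)
         + ennreal (\<bar>0 - \<xi>\<bar> powr (- (2 * s)) * indicator {1<..} \<bar>0 - \<xi>\<bar>)"
    proof eventually_elim
      fix \<xi> :: real assume \<xi>: "\<xi> \<noteq> 0"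
      have p: "0 < (1 + \<bar>\<xi>\<bar>\<^sup>2) powr s" by (rule one_plus_square_powr_pos)
      show "ennreal (1 / (1 + \<bar>\<xi>\<bar>\<^sup>2) powr s) \<le> ennreal (\<bar>0 - \<xi>\<bar> powr (- 0) * indicator {..1} \<bar>0 - \<xi>\<bar>)
         + ennreal (\<bar>0 - \<xi>\<bar> powr (- (2 * s)) * indicator {1<..} \<bar>0 - \<xi>\<bar>)"
      proof (cases "\<bar>\<xi>\<bar> \<le> 1")
        case True
        have "1 powr s \<le> (1 + \<bar>\<xi>\<bar>\<^sup>2) powr s" using assms by (intro powr_mono2) auto
        thus ?thesis using True \<xi> p by (simp add: indicator_def)
      next
        case False
        have "\<bar>\<xi>\<bar>\<^sup>2 = \<bar>\<xi>\<bar> powr 2" using \<xi> by (simp add: powr_numeral del: power2_abs)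
        hence "\<bar>\<xi>\<bar> powr (2 * s) = (\<bar>\<xi>\<bar>\<^sup>2) powr s" by (simp only: powr_powr)
        also have "\<dots> \<le> (1 + \<bar>\<xi>\<bar>\<^sup>2) powr s" using assms by (intro powr_mono2) auto
        finally have "1 / (1 + \<bar>\<xi>\<bar>\<^sup>2) powr s \<le> 1 / \<bar>\<xi>\<bar> powr (2 * s)"
          using \<xi> p by (intro divide_left_mono mult_pos_pos) auto
        thus ?thesis using False by (simp add: indicator_def powr_minus_divide)
      qed
    qed
  qed
  also have "\<dots> = (\<integral>\<^sup>+\<xi>. ennreal (\<bar>0 - \<xi>\<bar> powr (- 0) * indicator {..1} \<bar>0 - \<xi>\<bar>) \<partial>lborel)
         + (\<integral>\<^sup>+\<xi>. ennreal (\<bar>0 - \<xi>\<bar> powr (- (2 * s)) * indicator {1<..} \<bar>0 - \<xi>\<bar>) \<partial>lborel)"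
    by (rule nn_integral_add) auto
  also have "\<dots> \<le> ennreal (2 * (1 powr (1 - 0) / (1 - 0))) + ennreal (2 * (1 powr (1 - 2 * s) / (2 * s - 1)))"
    by (intro add_mono nn_integral_powr_far nn_integral_powr_near[THEN eq_refl]) (use assms in auto)
  also have "\<dots> = ennreal A"
    unfolding A_def by (rule ennreal_plus[symmetric]) (use assms in auto)
  finally show ?thesis using A that by blast
qed

text \<open>The propagator is bounded by the integral of |\<open>fourier f\<close>|, uniformly in t
  and x. The Cauchy-Schwarz inequality against the integrable inverse weight is again proved
  additively, with a parameter \<theta> chosen at the end.\<close>

lemma maximal_estimate_sup:
  assumes s: "1 / 2 < s"
  shows "maximal_estimate a \<infinity> s"
proof -
  obtain A where A: "0 < A" "(\<integral>\<^sup>+\<xi>. ennreal (1 / (1 + \<bar>\<xi>\<bar>\<^sup>2) powr s) \<partial>lborel) \<le> ennreal A"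
    using sobolev_weight_integrable[OF s] by blast
  show ?thesis
    unfolding maximal_estimate_def
  proof (intro exI allI impI)
    fix f assume f: "schwartz f"
    note fm [measurable] = fourier_borel_measurable[OF f]
    show "Lq_norm \<infinity> (maximal_function a f) \<le> ennreal (A powr (1 / 2)) * sobolev_norm s f"
    proof (cases "\<integral>\<^sup>+\<xi>. ennreal ((1 + \<bar>\<xi>\<bar>\<^sup>2) powr s * (cmod (fourier f \<xi>))\<^sup>2) \<partial>lborel")
      case top
      thus ?thesis using A by (simp add: sobolev_norm_def ennreal_power_def ennreal_mult_top)
    next
      case (real H)
      have main: "(\<integral>\<^sup>+\<xi>. ennreal (cmod (fourier f \<xi>)) \<partial>lborel) \<le> ennreal (\<theta> / 2 * H + 1 / (2 * \<theta>) * A)"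
        if \<theta>: "0 < \<theta>" for \<theta>
      proof -
        have "(\<integral>\<^sup>+\<xi>. ennreal (cmod (fourier f \<xi>)) \<partial>lborel)
          \<le> (\<integral>\<^sup>+\<xi>. ennreal (\<theta> / 2) * ennreal ((1 + \<bar>\<xi>\<bar>\<^sup>2) powr s * (cmod (fourier f \<xi>))\<^sup>2)
              + ennreal (1 / (2 * \<theta>)) * ennreal (1 / (1 + \<bar>\<xi>\<bar>\<^sup>2) powr s) \<partial>lborel)"
        proof (rule nn_integral_mono)
          fix \<xi> :: real
          define b where "b = (1 + \<bar>\<xi>\<bar>\<^sup>2) powr s"
          have b: "b > 0" unfolding b_def by (rule one_plus_square_powr_pos)
          define B where "B = cmod (fourier f \<xi>)"
          have "0 \<le> (\<theta> * b * B - 1)\<^sup>2" by simp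
          hence "2 * \<theta> * b * B \<le> (\<theta> * b)\<^sup>2 * B\<^sup>2 + 1"
            by (simp add: power2_eq_square algebra_simps)
          hence "2 * \<theta> * b * B / (2 * \<theta> * b) \<le> ((\<theta> * b)\<^sup>2 * B\<^sup>2 + 1) / (2 * \<theta> * b)"
            using \<theta> b by (intro divide_right_mono) auto
          hence "B \<le> \<theta> / 2 * (b * B\<^sup>2) + 1 / (2 * \<theta>) * (1 / b)"
            using \<theta> b by (simp add: field_simps power2_eq_square)
          hence "ennreal B \<le> ennreal (\<theta> / 2) * ennreal (b * B\<^sup>2) + ennreal (1 / (2 * \<theta>)) * ennreal (1 / b)"
            using \<theta> b by (simp add: ennreal_mult[symmetric] ennreal_plus[symmetric] ennreal_leI del: ennreal_plus)
          thus "ennreal (cmod (fourier f \<xi>)) \<le> ennreal (\<theta> / 2) * ennreal ((1 + \<bar>\<xi>\<bar>\<^sup>2) powr s * (cmod (fourier f \<xi>))\<^sup>2)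
              + ennreal (1 / (2 * \<theta>)) * ennreal (1 / (1 + \<bar>\<xi>\<bar>\<^sup>2) powr s)"
            by (simp only: b_def B_def)
        qed
        also have "\<dots> = ennreal (\<theta> / 2) * (\<integral>\<^sup>+\<xi>. ennreal ((1 + \<bar>\<xi>\<bar>\<^sup>2) powr s * (cmod (fourier f \<xi>))\<^sup>2) \<partial>lborel)
           + ennreal (1 / (2 * \<theta>)) * (\<integral>\<^sup>+\<xi>. ennreal (1 / (1 + \<bar>\<xi>\<bar>\<^sup>2) powr s) \<partial>lborel)"
          by (subst nn_integral_add) (auto simp: nn_integral_cmult)
        also have "(\<integral>\<^sup>+\<xi>. ennreal ((1 + \<bar>\<xi>\<bar>\<^sup>2) powr s * (cmod (fourier f \<xi>))\<^sup>2) \<partial>lborel) = ennreal H"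
          by (rule real(2))
        also have "ennreal (\<theta> / 2) * ennreal H + ennreal (1 / (2 * \<theta>)) * (\<integral>\<^sup>+\<xi>. ennreal (1 / (1 + \<bar>\<xi>\<bar>\<^sup>2) powr s) \<partial>lborel)
          \<le> ennreal (\<theta> / 2) * ennreal H + ennreal (1 / (2 * \<theta>)) * ennreal A"
          by (intro add_left_mono mult_left_mono A) simp
        also have "\<dots> = ennreal (\<theta> / 2 * H + 1 / (2 * \<theta>) * A)"
          using \<theta> A real by (simp add: ennreal_mult[symmetric] ennreal_plus[symmetric] del: ennreal_plus)
        finally show ?thesis .
      qed
      have bound: "(\<integral>\<^sup>+\<xi>. ennreal (cmod (fourier f \<xi>)) \<partial>lborel) \<le> ennreal (sqrt (A * H))"
      proof (cases "H = 0")
        case False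
        hence H: "H > 0" using real by simp
        \<comment> \<open>The minimizer: it makes both summands of \<open>main\<close> equal to half
          of sqrt(A H).\<close>
        define \<theta> where "\<theta> = sqrt (A / H)"
        have \<theta>: "\<theta> > 0" "\<theta> * \<theta> = A / H" using A H by (auto simp: \<theta>_def)
        have 1: "\<theta> * H = sqrt (A * H)"
        proof -
          have "(\<theta> * H)\<^sup>2 = A * H" using \<theta> H by (simp add: power2_eq_square) (simp add: field_simps)
          thus ?thesis using \<theta> H by (metis abs_of_pos mult_pos_pos real_sqrt_abs)
        qed
        have "A / \<theta> = \<theta> * H" using \<theta> H by (simp add: field_simps)
        hence "\<theta> / 2 * H + 1 / (2 * \<theta>) * A = sqrt (A * H)" using 1 by simp
        thus ?thesis using main[OF \<theta>(1)] by simp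
      next
        \<comment> \<open>Without a minimizer \<theta> tends to infinity instead; \<theta> = A/(2 e)
          makes the remaining summand equal to e.\<close>
        case True
        show ?thesis
        proof (rule ennreal_le_epsilon)
          fix e :: real assume e: "0 < e"
          have "(\<integral>\<^sup>+\<xi>. ennreal (cmod (fourier f \<xi>)) \<partial>lborel) \<le> ennreal e"
            using main[of "A / (2 * e)"] e A True by simp
          thus "(\<integral>\<^sup>+\<xi>. ennreal (cmod (fourier f \<xi>)) \<partial>lborel) \<le> ennreal (sqrt (A * H)) + ennreal e"
            using True by simp
        qed
      qed
      have "Lq_norm \<infinity> (maximal_function a f) = esssup lborel (maximal_function a f)"
        by (simp add: Lq_norm_def)
      also have "\<dots> \<le> ennreal (sqrt (A * H))"
      proof (rule esssup_I)
        show "maximal_function a f \<in> borel_measurable lborel"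
          using maximal_function_borel_measurable[OF fm] by simp
        show "AE x in lborel. maximal_function a f x \<le> ennreal (sqrt (A * H))"
          by (intro AE_I2 order_trans[OF maximal_function_le_integral[OF fm] bound])
      qed
      also have "\<dots> = ennreal (A powr (1 / 2)) * sobolev_norm s f"
        using A real by (simp add: sobolev_norm_def ennreal_power_ennreal powr_half_sqrt real_sqrt_mult ennreal_mult)
      finally show ?thesis .
    qed
  qed
qed

section \<open>Gaussian wave packets\<close>

text \<open>A family stable under differentiation, which contains the packets as the members with
  constant polynomial; the Schwartz property can thus be checked for all derivatives at
  once.\<close>

definition poly_gaussian :: "complex poly \<Rightarrow> real \<Rightarrow> real \<Rightarrow> real \<Rightarrow> complex" where
  "poly_gaussian P \<beta> N x = poly P (of_real x) * exp (- of_real \<beta> * (of_real x)\<^sup>2 + \<i> * of_real N * of_real x)"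

lemma poly_gaussian_deriv:
  "(poly_gaussian P \<beta> N has_vector_derivative
     poly_gaussian (pderiv P + P * [:\<i> * of_real N, - 2 * of_real \<beta>:]) \<beta> N x) (at x)"
proof -
  let ?E = "\<lambda>z. exp (- of_real \<beta> * z\<^sup>2 + \<i> * of_real N * z) :: complex"
  have "((\<lambda>z. poly P z * ?E z) has_field_derivative
      poly (pderiv P + P * [:\<i> * of_real N, - 2 * of_real \<beta>:]) (of_real x) * ?E (of_real x)) (at (of_real x))"
    by (rule derivative_eq_intros poly_DERIV refl | simp add: algebra_simps)+
  from has_vector_derivative_real_field[OF this] show ?thesis
    unfolding poly_gaussian_def by simp
qed

lemma nth_derivative_poly_gaussian: "\<exists>Q. nth_derivative n (poly_gaussian P \<beta> N) = poly_gaussian Q \<beta> N"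
proof (induction n)
  case 0
  show ?case by (auto simp: nth_derivative_def)
next
  case (Suc n)
  then obtain Q where Q: "nth_derivative n (poly_gaussian P \<beta> N) = poly_gaussian Q \<beta> N" by blast
  have "nth_derivative (Suc n) (poly_gaussian P \<beta> N) = (\<lambda>x. vector_derivative (poly_gaussian Q \<beta> N) (at x))"
    using Q by (simp add: nth_derivative_def)
  also have "\<dots> = poly_gaussian (pderiv Q + Q * [:\<i> * of_real N, - 2 * of_real \<beta>:]) \<beta> N"
    by (rule ext) (rule vector_derivative_at[OF poly_gaussian_deriv])
  finally show ?case by blast
qed

lemma power_div_fact_le_exp:
  fixes y :: real
  assumes "0 \<le> y"
  shows "y ^ k / fact k \<le> exp y"
proof -
  have "(\<Sum>n\<in>{k}. y ^ n /\<^sub>R fact n) \<le> (\<Sum>n. y ^ n /\<^sub>R fact n)"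
  proof (rule sum_le_suminf)
    show "summable (\<lambda>n. y ^ n /\<^sub>R fact n)" by (rule summable_exp_generic)
  qed (use assms in auto)
  also have "\<dots> = exp y" by (simp add: exp_def)
  finally show ?thesis by (simp add: divide_inverse_commute)
qed

lemma power_gaussian_bounded:
  fixes \<beta> :: real
  assumes "0 < \<beta>"
  shows "\<bar>x\<bar> ^ k * exp (- \<beta> * x\<^sup>2) \<le> 1 + fact k / \<beta> ^ k"
proof (cases "\<bar>x\<bar> \<le> 1")
  case True
  have "\<bar>x\<bar> ^ k * exp (- \<beta> * x\<^sup>2) \<le> 1 * 1"
    using True assms by (intro mult_mono power_le_one) auto
  moreover have "0 \<le> fact k / \<beta> ^ k" using assms by simp
  ultimately show ?thesis by linarith
next
  case False
  have "\<bar>x\<bar> ^ k \<le> \<bar>x\<bar> ^ (2 * k)" using False by (intro power_increasing) auto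
  also have "\<dots> = (x\<^sup>2) ^ k" by (simp add: power_mult)
  also have "\<dots> = fact k / \<beta> ^ k * ((\<beta> * x\<^sup>2) ^ k / fact k)" using assms by (simp add: power_mult_distrib)
  also have "\<dots> \<le> fact k / \<beta> ^ k * exp (\<beta> * x\<^sup>2)"
    using assms by (intro mult_left_mono power_div_fact_le_exp) auto
  finally have "\<bar>x\<bar> ^ k * exp (- \<beta> * x\<^sup>2) \<le> fact k / \<beta> ^ k * exp (\<beta> * x\<^sup>2) * exp (- \<beta> * x\<^sup>2)"
    by (intro mult_right_mono) auto
  also have "\<dots> = fact k / \<beta> ^ k" by (simp add: mult.assoc flip: exp_add)
  finally show ?thesis by simp
qed

lemma norm_poly_gaussian: "cmod (poly_gaussian P \<beta> N x) = cmod (poly P (of_real x)) * exp (- \<beta> * x\<^sup>2)"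
  by (simp add: poly_gaussian_def norm_mult norm_exp_eq_Re power2_eq_square)

text \<open>Induction on the polynomial: splitting off the constant coefficient leaves a factor x,
  which is moved into the weight. This is why k is generalized.\<close>

lemma poly_gaussian_bounded:
  assumes "0 < \<beta>"
  shows "\<exists>B. \<forall>x. \<bar>x\<bar> ^ k * cmod (poly_gaussian P \<beta> N x) \<le> B"
proof (induction P arbitrary: k)
  case 0
  show ?case by (auto simp: poly_gaussian_def)
next
  case (pCons c P)
  obtain B where B: "\<And>x. \<bar>x\<bar> ^ (Suc k) * cmod (poly_gaussian P \<beta> N x) \<le> B" using pCons.IH by blast
  have "\<bar>x\<bar> ^ k * cmod (poly_gaussian (pCons c P) \<beta> N x) \<le> cmod c * (1 + fact k / \<beta> ^ k) + B" for x
  proof -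
    have "cmod (poly (pCons c P) (of_real x)) \<le> cmod c + \<bar>x\<bar> * cmod (poly P (of_real x))"
      using norm_triangle_ineq[of c "of_real x * poly P (of_real x)"] by (simp add: norm_mult)
    hence "\<bar>x\<bar> ^ k * cmod (poly_gaussian (pCons c P) \<beta> N x)
      \<le> \<bar>x\<bar> ^ k * ((cmod c + \<bar>x\<bar> * cmod (poly P (of_real x))) * exp (- \<beta> * x\<^sup>2))"
      unfolding norm_poly_gaussian by (intro mult_left_mono mult_right_mono) auto
    also have "\<dots> = cmod c * (\<bar>x\<bar> ^ k * exp (- \<beta> * x\<^sup>2)) + \<bar>x\<bar> ^ (Suc k) * cmod (poly_gaussian P \<beta> N x)"
      unfolding norm_poly_gaussian by (simp add: algebra_simps)
    also have "\<dots> \<le> cmod c * (1 + fact k / \<beta> ^ k) + B"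
      by (intro add_mono mult_left_mono power_gaussian_bounded assms B) auto
    finally show ?thesis .
  qed
  thus ?case by blast
qed

lemma schwartz_poly_gaussian:
  assumes "0 < \<beta>"
  shows "schwartz (poly_gaussian P \<beta> N)"
  unfolding schwartz_def
proof (intro allI conjI)
  fix n k :: nat and x :: real
  obtain Q where Q: "nth_derivative n (poly_gaussian P \<beta> N) = poly_gaussian Q \<beta> N"
    using nth_derivative_poly_gaussian by blast
  show "nth_derivative n (poly_gaussian P \<beta> N) differentiable (at x)"
    unfolding Q by (rule differentiableI_vector[OF poly_gaussian_deriv])
  obtain B where "\<And>x. \<bar>x\<bar> ^ k * cmod (poly_gaussian Q \<beta> N x) \<le> B"
    using poly_gaussian_bounded[OF assms] by blast
  thus "bounded (range (\<lambda>x. x ^ k *\<^sub>R nth_derivative n (poly_gaussian P \<beta> N) x))"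
    unfolding Q by (intro boundedI[of _ B]) (auto simp: power_abs)
qed

lemma schwartz_add:
  assumes "schwartz f" "schwartz g"
  shows "schwartz (\<lambda>x. f x + g x)"
proof -
  have nth: "nth_derivative n (\<lambda>x. f x + g x) = (\<lambda>x. nth_derivative n f x + nth_derivative n g x)" for n
  proof (induction n)
    case (Suc n)
    show ?case
    proof
      fix x
      have d: "nth_derivative n f differentiable (at x)" "nth_derivative n g differentiable (at x)"
        using assms by (auto simp: schwartz_def)
      have "nth_derivative (Suc n) (\<lambda>x. f x + g x) x = vector_derivative (nth_derivative n (\<lambda>x. f x + g x)) (at x)"
        by (simp add: nth_derivative_def)
      also have "\<dots> = vector_derivative (nth_derivative n f) (at x) + vector_derivative (nth_derivative n g) (at x)"
        unfolding Suc by (rule vector_derivative_add_at[OF d])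
      finally show "nth_derivative (Suc n) (\<lambda>x. f x + g x) x = nth_derivative (Suc n) f x + nth_derivative (Suc n) g x"
        by (simp add: nth_derivative_def)
    qed
  qed (simp add: nth_derivative_def)
  show ?thesis
    unfolding schwartz_def nth
  proof (intro allI conjI)
    fix n k :: nat and x :: real
    show "(\<lambda>x. nth_derivative n f x + nth_derivative n g x) differentiable (at x)"
      using assms by (intro differentiable_add) (auto simp: schwartz_def)
    have "bounded (range (\<lambda>x. x ^ k *\<^sub>R nth_derivative n f x + x ^ k *\<^sub>R nth_derivative n g x))"
      using assms by (intro bounded_plus_comp) (auto simp: schwartz_def)
    thus "bounded (range (\<lambda>x. x ^ k *\<^sub>R (nth_derivative n f x + nth_derivative n g x)))"
      by (simp add: scaleR_add_right)
  qed
qed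

section \<open>Packets with Gaussian Fourier transform\<close>

definition gauss :: "real \<Rightarrow> real \<Rightarrow> real \<Rightarrow> real" where
  "gauss N \<delta> \<xi> = exp (- ((\<xi> - N) / \<delta>)\<^sup>2 / 2)"

text \<open>N is the frequency and \<delta> the bandwidth; the packet has width about 1/\<delta> in
  space. The prefactor is chosen so that the unnormalized transform is
  \<open>gauss N \<delta>\<close>, of height 1 for every N and \<delta>.\<close>

definition packet :: "real \<Rightarrow> real \<Rightarrow> real \<Rightarrow> complex" where
  "packet N \<delta> = poly_gaussian [:of_real (\<delta> / sqrt (2 * pi)):] (\<delta>\<^sup>2 / 2) N"

lemma schwartz_packet: "0 < \<delta> \<Longrightarrow> schwartz (packet N \<delta>)"
  unfolding packet_def by (intro schwartz_poly_gaussian) simp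

text \<open>The right-hand side is the characteristic function of the standard normal
  distribution.\<close>

lemma integral_cis_gaussian:
  "(LINT y|lborel. cis (t * y) * of_real (exp (- y\<^sup>2 / 2) / sqrt (2 * pi))) = of_real (exp (- t\<^sup>2 / 2))"
proof -
  have "of_real (exp (- t\<^sup>2 / 2)) = (LINT y|density lborel std_normal_density. iexp (t * y))"
    using char_std_normal_distribution by (simp add: char_def fun_eq_iff)
  also have "\<dots> = (LINT y|lborel. std_normal_density y *\<^sub>R iexp (t * y))"
    by (rule integral_density) auto
  finally show ?thesis
    by (simp add: std_normal_density_def cis_conv_exp scaleR_conv_of_real mult_ac)
qed

lemma packet_eq: "packet N \<delta> x = of_real (\<delta> / sqrt (2 * pi) * exp (- (\<delta> * x)\<^sup>2 / 2)) * cis (N * x)"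
proof -
  have 1: "exp (- of_real (\<delta>\<^sup>2 / 2) * (of_real x)\<^sup>2) = complex_of_real (exp (- (\<delta> * x)\<^sup>2 / 2))"
    by (simp add: power_mult_distrib flip: exp_of_real)
  have 2: "exp (\<i> * of_real N * of_real x) = cis (N * x)"
    by (simp add: cis_conv_exp mult.assoc)
  show ?thesis unfolding packet_def poly_gaussian_def exp_add 1 2 by simp
qed

lemma fourier_packet:
  assumes "0 < \<delta>"
  shows "fourier (packet N \<delta>) \<xi> = of_real (gauss N \<delta> \<xi>)"
proof -
  let ?h = "\<lambda>x. exp (- \<i> * complex_of_real (x * \<xi>)) * packet N \<delta> x"
  have "fourier (packet N \<delta>) \<xi> = (LINT x|lborel. ?h x)" by (simp add: fourier_def)
  also have "\<dots> = \<bar>1 / \<delta>\<bar> *\<^sub>R (LINT y|lborel. ?h (0 + 1 / \<delta> * y))"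
    by (rule lborel_integral_real_affine) (use assms in simp)
  also have "\<dots> = (LINT y|lborel. (1 / \<delta>) *\<^sub>R ?h (0 + 1 / \<delta> * y))"
    using assms by simp
  also have "\<dots> = (LINT y|lborel. cis ((N - \<xi>) / \<delta> * y) * of_real (exp (- y\<^sup>2 / 2) / sqrt (2 * pi)))"
  proof (rule Bochner_Integration.integral_cong[OF refl])
    fix y
    have "exp (- \<i> * complex_of_real ((0 + 1 / \<delta> * y) * \<xi>)) * cis (N * (0 + 1 / \<delta> * y)) = cis ((N - \<xi>) / \<delta> * y)"
      by (simp add: cis_conv_exp flip: exp_add) (simp add: algebra_simps diff_divide_distrib)
    moreover have "\<delta> * (0 + 1 / \<delta> * y) = y" using assms by simp
    moreover have "?h z = exp (- \<i> * complex_of_real (z * \<xi>)) * cis (N * z) * of_real (\<delta> / sqrt (2 * pi) * exp (- (\<delta> * z)\<^sup>2 / 2))" for z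
      unfolding packet_eq by (simp only: mult_ac)
    ultimately have "?h (0 + 1 / \<delta> * y) = cis ((N - \<xi>) / \<delta> * y) * of_real (\<delta> / sqrt (2 * pi) * exp (- y\<^sup>2 / 2))"
      by (simp only:)
    thus "(1 / \<delta>) *\<^sub>R ?h (0 + 1 / \<delta> * y) = cis ((N - \<xi>) / \<delta> * y) * of_real (exp (- y\<^sup>2 / 2) / sqrt (2 * pi))"
      using assms by (simp add: scaleR_conv_of_real)
  qed
  also have "\<dots> = of_real (exp (- ((N - \<xi>) / \<delta>)\<^sup>2 / 2))" by (rule integral_cis_gaussian)
  also have "((N - \<xi>) / \<delta>)\<^sup>2 = ((\<xi> - N) / \<delta>)\<^sup>2" by (simp add: power_divide power2_commute)
  finally show ?thesis by (simp add: gauss_def)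
qed

lemma gauss_eq_normal_density: "0 < \<delta> \<Longrightarrow> gauss N \<delta> \<xi> = \<delta> * sqrt (2 * pi) * normal_density N \<delta> \<xi>"
  by (simp add: gauss_def normal_density_def real_sqrt_mult power_divide)

lemma gauss_pos: "0 < gauss N \<delta> \<xi>" and gauss_le_1: "gauss N \<delta> \<xi> \<le> 1"
  by (simp_all add: gauss_def)

lemma gauss_measurable [measurable]: "gauss N \<delta> \<in> borel_measurable borel"
  unfolding gauss_def by measurable

lemma gauss_integral:
  assumes "0 < \<delta>"
  shows "integrable lborel (gauss N \<delta>)" "(LINT \<xi>|lborel. gauss N \<delta> \<xi>) = \<delta> * sqrt (2 * pi)"
    "integrable lborel (\<lambda>\<xi>. gauss N \<delta> \<xi> * (\<xi> - N)\<^sup>2)"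
    "(LINT \<xi>|lborel. gauss N \<delta> \<xi> * (\<xi> - N)\<^sup>2) = \<delta> * sqrt (2 * pi) * \<delta>\<^sup>2"
proof -
  have eq: "gauss N \<delta> = (\<lambda>\<xi>. \<delta> * sqrt (2 * pi) * normal_density N \<delta> \<xi>)"
    using gauss_eq_normal_density[OF assms] by auto
  show "integrable lborel (gauss N \<delta>)" "(LINT \<xi>|lborel. gauss N \<delta> \<xi>) = \<delta> * sqrt (2 * pi)"
    unfolding eq using assms by simp_all
  have i: "integrable lborel (\<lambda>\<xi>. normal_density N \<delta> \<xi> * (\<xi> - N)\<^sup>2)"
    using integrable_normal_moment[OF assms, of N 2] .
  have v: "(LINT \<xi>|lborel. normal_density N \<delta> \<xi> * (\<xi> - N)\<^sup>2) = \<delta>\<^sup>2"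
    using integral_normal_moment_even[OF assms, of N 1] by simp
  show "integrable lborel (\<lambda>\<xi>. gauss N \<delta> \<xi> * (\<xi> - N)\<^sup>2)"
    unfolding eq mult.assoc using i by (intro integrable_mult_right) auto
  show "(LINT \<xi>|lborel. gauss N \<delta> \<xi> * (\<xi> - N)\<^sup>2) = \<delta> * sqrt (2 * pi) * \<delta>\<^sup>2"
    unfolding eq mult.assoc using v by simp
qed

lemma integrable_fourier_packet: "0 < \<delta> \<Longrightarrow> integrable lborel (fourier (packet N \<delta>))"
proof -
  assume d: "0 < \<delta>"
  have "fourier (packet N \<delta>) = (\<lambda>\<xi>. of_real (gauss N \<delta> \<xi>))" using fourier_packet[OF d] by auto
  thus ?thesis using gauss_integral(1)[OF d, of N] by simp
qed

text \<open>A constant phase c does not affect the modulus, so it suffices to bound a real part from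
  below. Since the bound for the cosine is quadratic and holds for all \<xi>, only the mass and the
  variance \<delta>^2 of the Gaussian enter, and its tails need no separate treatment.\<close>

lemma propagator_packet_lower_bound:
  assumes d: "0 < \<delta>" and A: "A * \<delta>\<^sup>2 \<le> 1 / 2"
    and phase: "\<And>\<xi>. 1 - A * (\<xi> - N)\<^sup>2 \<le> cos (t * \<bar>\<xi>\<bar> powr a + x * \<xi> - c)"
  shows "\<delta> \<le> cmod (propagator a t (packet N \<delta>) x)"
proof -
  let ?P = "propagator a t (packet N \<delta>) x"
  have P: "?P = (LINT \<xi>|lborel. plane_wave a t x \<xi> * of_real (gauss N \<delta> \<xi>))"
    unfolding propagator_eq using fourier_packet[OF d] by simp
  have int: "integrable lborel (\<lambda>\<xi>. plane_wave a t x \<xi> * of_real (gauss N \<delta> \<xi>))"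
    by (rule Bochner_Integration.integrable_bound[OF gauss_integral(1)[OF d, of N]])
       (auto simp: norm_mult)
  have "cnj (cis c) * ?P = (LINT \<xi>|lborel. cnj (cis c) * (plane_wave a t x \<xi> * of_real (gauss N \<delta> \<xi>)))"
    unfolding P by simp
  hence "Re (cnj (cis c) * ?P) = (LINT \<xi>|lborel. Re (cnj (cis c) * (plane_wave a t x \<xi> * of_real (gauss N \<delta> \<xi>))))"
    using int by (simp only: integral_Re integrable_mult_right)
  also have "\<dots> = (LINT \<xi>|lborel. cos (t * \<bar>\<xi>\<bar> powr a + x * \<xi> - c) * gauss N \<delta> \<xi>)"
  proof (rule Bochner_Integration.integral_cong[OF refl])
    fix \<xi>
    have "cnj (cis c) * plane_wave a t x \<xi> = cis (t * \<bar>\<xi>\<bar> powr a + x * \<xi> - c)"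
      by (simp add: plane_wave_def cis_cnj cis_mult)
    hence e: "cnj (cis c) * (plane_wave a t x \<xi> * of_real (gauss N \<delta> \<xi>)) = cis (t * \<bar>\<xi>\<bar> powr a + x * \<xi> - c) * of_real (gauss N \<delta> \<xi>)"
      by (simp only: mult.assoc[symmetric])
    show "Re (cnj (cis c) * (plane_wave a t x \<xi> * of_real (gauss N \<delta> \<xi>))) = cos (t * \<bar>\<xi>\<bar> powr a + x * \<xi> - c) * gauss N \<delta> \<xi>"
      unfolding e by simp
  qed
  also have "\<dots> \<ge> (LINT \<xi>|lborel. gauss N \<delta> \<xi> - A * (gauss N \<delta> \<xi> * (\<xi> - N)\<^sup>2))"
  proof (rule integral_mono)
    show "integrable lborel (\<lambda>\<xi>. gauss N \<delta> \<xi> - A * (gauss N \<delta> \<xi> * (\<xi> - N)\<^sup>2))"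
      using gauss_integral[OF d] by (intro Bochner_Integration.integrable_diff integrable_mult_right) auto
    show "integrable lborel (\<lambda>\<xi>. cos (t * \<bar>\<xi>\<bar> powr a + x * \<xi> - c) * gauss N \<delta> \<xi>)"
      by (rule Bochner_Integration.integrable_bound[OF gauss_integral(1)[OF d, of N]])
         (auto simp: abs_mult less_imp_le[OF gauss_pos] intro!: mult_left_le_one_le)
    fix \<xi>
    show "gauss N \<delta> \<xi> - A * (gauss N \<delta> \<xi> * (\<xi> - N)\<^sup>2) \<le> cos (t * \<bar>\<xi>\<bar> powr a + x * \<xi> - c) * gauss N \<delta> \<xi>"
      using mult_right_mono[OF phase[of \<xi>] less_imp_le[OF gauss_pos[of N \<delta> \<xi>]]] by (simp add: algebra_simps)
  qed
  also have "(LINT \<xi>|lborel. gauss N \<delta> \<xi> - A * (gauss N \<delta> \<xi> * (\<xi> - N)\<^sup>2))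
     = \<delta> * sqrt (2 * pi) * (1 - A * \<delta>\<^sup>2)"
    using gauss_integral[OF d, of N] by (simp add: algebra_simps)
  finally have "\<delta> * sqrt (2 * pi) * (1 - A * \<delta>\<^sup>2) \<le> Re (cnj (cis c) * ?P)" .
  also have "\<dots> \<le> cmod (cnj (cis c) * ?P)" by (rule complex_Re_le_cmod)
  also have "\<dots> = cmod ?P" by (simp add: norm_mult)
  finally have 1: "\<delta> * sqrt (2 * pi) * (1 - A * \<delta>\<^sup>2) \<le> cmod ?P" .
  \<comment> \<open>The factor sqrt(2 pi) compensates 1 - A \<delta>^2 \<ge> 1/2, so the final bound
    is \<delta> itself.\<close>
  have "2 \<le> sqrt (2 * pi)"
  proof (rule real_le_rsqrt)
    show "2\<^sup>2 \<le> 2 * pi" using pi_gt3 by simp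
  qed
  hence "\<delta> * (2 * (1 / 2)) \<le> \<delta> * (sqrt (2 * pi) * (1 - A * \<delta>\<^sup>2))"
    using d A by (intro mult_left_mono mult_mono) auto
  thus ?thesis using 1 by (simp add: mult.assoc)
qed

text \<open>With u = (\<xi> - N)/\<delta> the Sobolev weight is at most a constant times (1 + N^2 +
  \<delta>^2)^s (1 + u^2)^s. The squared Gaussian is exp(-u^2), and half of this exponent absorbs
  the growth in u. What matters is that K depends on neither N nor \<delta>.\<close>

lemma sobolev_norm_packet:
  assumes "0 \<le> s"
  obtains K where "0 < K"
    "\<And>N \<delta>. 0 < \<delta> \<Longrightarrow> sobolev_norm s (packet N \<delta>) \<le> ennreal ((K * (1 + N\<^sup>2 + \<delta>\<^sup>2) powr s * \<delta>) powr (1 / 2))"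
proof -
  \<comment> \<open>An integer exponent, so that a single term of the exponential series dominates
    the power.\<close>
  define m where "m = nat \<lceil>s\<rceil>"
  have m: "s \<le> real m" by (simp add: m_def) linarith
  define C where "C = fact m * 2 ^ m * exp (1 / 2 :: real)"
  have C: "0 < C" by (simp add: C_def)
  define K where "K = 2 powr s * C * sqrt (2 * pi)"
  have K: "0 < K" using C by (simp add: K_def)
  have poly_exp: "(1 + v) powr s * exp (- v) \<le> C * exp (- v / 2)" if v: "0 \<le> v" for v
  proof -
    have "(1 + v) powr s \<le> (1 + v) powr (real m)" using m v by (intro powr_mono) auto
    also have "\<dots> = fact m * 2 ^ m * (((1 + v) / 2) ^ m / fact m)"
      using v by (simp add: powr_realpow power_divide)
    also have "\<dots> \<le> fact m * 2 ^ m * exp ((1 + v) / 2)"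
      using v by (intro mult_left_mono power_div_fact_le_exp) auto
    also have "exp ((1 + v) / 2) = exp (1 / 2) * exp (v / 2)"
      by (simp add: add_divide_distrib exp_add)
    finally have "(1 + v) powr s * exp (- v) \<le> fact m * 2 ^ m * (exp (1 / 2) * exp (v / 2)) * exp (- v)"
      by (intro mult_right_mono) auto
    also have "\<dots> = C * (exp (v / 2) * exp (- v))" by (simp add: C_def)
    also have "exp (v / 2) * exp (- v) = exp (- v / 2)" by (simp flip: exp_add)
    finally show ?thesis .
  qed
  have "sobolev_norm s (packet N \<delta>) \<le> ennreal ((K * (1 + N\<^sup>2 + \<delta>\<^sup>2) powr s * \<delta>) powr (1 / 2))" if d: "0 < \<delta>" for N \<delta>
  proof -
    define D where "D = 1 + N\<^sup>2 + \<delta>\<^sup>2"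
    have D: "1 \<le> D" by (simp add: D_def)
    have pw: "(1 + \<bar>\<xi>\<bar>\<^sup>2) powr s * (cmod (fourier (packet N \<delta>) \<xi>))\<^sup>2 \<le> 2 powr s * D powr s * C * gauss N \<delta> \<xi>" for \<xi>
    proof -
      define u where "u = (\<xi> - N) / \<delta>"
      have \<xi>: "\<xi> = N + \<delta> * u" using d by (simp add: u_def)
      have "1 + \<bar>\<xi>\<bar>\<^sup>2 \<le> 2 * D * (1 + u\<^sup>2)"
      proof -
        have "(N + \<delta> * u)\<^sup>2 \<le> 2 * N\<^sup>2 + 2 * (\<delta>\<^sup>2 * u\<^sup>2)"
          using sum_squares_bound[of N "\<delta> * u"] by (simp add: power2_sum power_mult_distrib)
        moreover have "0 \<le> N\<^sup>2 * u\<^sup>2" "0 \<le> \<delta>\<^sup>2" "0 \<le> u\<^sup>2" by auto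
        moreover have "2 * D * (1 + u\<^sup>2) = 2 + 2 * N\<^sup>2 + 2 * \<delta>\<^sup>2 + 2 * u\<^sup>2 + 2 * (N\<^sup>2 * u\<^sup>2) + 2 * (\<delta>\<^sup>2 * u\<^sup>2)"
          by (simp add: D_def algebra_simps)
        ultimately show ?thesis unfolding \<xi> power2_abs by linarith
      qed
      hence "(1 + \<bar>\<xi>\<bar>\<^sup>2) powr s \<le> (2 * D * (1 + u\<^sup>2)) powr s"
        using assms by (intro powr_mono2) auto
      also have "\<dots> = 2 powr s * D powr s * (1 + u\<^sup>2) powr s" by (simp only: powr_mult)
      finally have 1: "(1 + \<bar>\<xi>\<bar>\<^sup>2) powr s \<le> 2 powr s * D powr s * (1 + u\<^sup>2) powr s" .
      have 2: "(cmod (fourier (packet N \<delta>) \<xi>))\<^sup>2 = exp (- u\<^sup>2)"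
        using d by (simp add: fourier_packet gauss_def u_def flip: exp_double)
      have "(1 + \<bar>\<xi>\<bar>\<^sup>2) powr s * (cmod (fourier (packet N \<delta>) \<xi>))\<^sup>2 \<le> 2 powr s * D powr s * (1 + u\<^sup>2) powr s * exp (- u\<^sup>2)"
        unfolding 2 by (intro mult_right_mono 1) auto
      also have "\<dots> = 2 powr s * D powr s * ((1 + u\<^sup>2) powr s * exp (- u\<^sup>2))" by simp
      also have "\<dots> \<le> 2 powr s * D powr s * (C * exp (- u\<^sup>2 / 2))"
        by (intro mult_left_mono poly_exp) auto
      finally show ?thesis by (simp add: gauss_def u_def mult.assoc)
    qed
    have "(\<integral>\<^sup>+\<xi>. ennreal ((1 + \<bar>\<xi>\<bar>\<^sup>2) powr s * (cmod (fourier (packet N \<delta>) \<xi>))\<^sup>2) \<partial>lborel)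
       \<le> (\<integral>\<^sup>+\<xi>. ennreal (2 powr s * D powr s * C * gauss N \<delta> \<xi>) \<partial>lborel)"
      by (intro nn_integral_mono ennreal_leI pw)
    also have "\<dots> = ennreal (LINT \<xi>|lborel. 2 powr s * D powr s * C * gauss N \<delta> \<xi>)"
      using gauss_integral(1)[OF d, of N] C less_imp_le[OF gauss_pos]
      by (intro nn_integral_eq_integral integrable_mult_right) auto
    also have "(LINT \<xi>|lborel. 2 powr s * D powr s * C * gauss N \<delta> \<xi>) = K * D powr s * \<delta>"
      using gauss_integral(2)[OF d, of N] by (simp add: K_def)
    finally have "sobolev_norm s (packet N \<delta>) \<le> ennreal_power (ennreal (K * D powr s * \<delta>)) (1 / 2)"
      unfolding sobolev_norm_def by (intro ennreal_power_mono) auto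
    thus ?thesis using K d by (simp add: ennreal_power_ennreal D_def)
  qed
  thus ?thesis using K that by blast
qed

section \<open>Necessity\<close>

text \<open>The quadratic bound serves phases linear in \<xi>, as at time 0. The linear one serves
  travelling packets, whose phase error is already quadratic in \<xi> - N.\<close>

lemma cos_lower_bounds:
  fixes y :: real
  shows "1 - y\<^sup>2 / 2 \<le> cos y" "1 - \<bar>y\<bar> \<le> cos y"
proof -
  have c: "cos y = 1 - 2 * (sin (y / 2))\<^sup>2" using cos_double_sin[of "y / 2"] by simp
  have s: "\<bar>sin (y / 2)\<bar> \<le> \<bar>y / 2\<bar>" by (rule abs_sin_x_le_abs_x)
  have "\<bar>sin (y / 2)\<bar>\<^sup>2 \<le> \<bar>y / 2\<bar>\<^sup>2" using s by (intro power_mono) auto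
  thus "1 - y\<^sup>2 / 2 \<le> cos y" unfolding c by (simp add: power_divide)
  have "\<bar>sin (y / 2)\<bar> * \<bar>sin (y / 2)\<bar> \<le> 1 * \<bar>y / 2\<bar>" using s by (intro mult_mono) auto
  thus "1 - \<bar>y\<bar> \<le> cos y" unfolding c by (simp add: power2_eq_square)
qed

text \<open>The way the necessary conditions for finite q are read off: a packet parameter tends to
  an extreme and only exponents remain. If \<alpha> > \<beta>, the chosen X makes
  X^(\<alpha>-\<beta>) equal to a number larger than C.\<close>

lemma powr_dominated_imp_le:
  assumes "\<And>X. 1 \<le> X \<Longrightarrow> X powr \<alpha> \<le> C * X powr \<beta>"
  shows "\<alpha> \<le> (\<beta> :: real)"
proof (rule ccontr)
  assume "\<not> \<alpha> \<le> \<beta>"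
  hence d: "\<alpha> - \<beta> > 0" by simp
  define E where "E = max C 1 + 1"
  have E: "1 \<le> E" "C < E" by (auto simp: E_def)
  define X where "X = E powr (1 / (\<alpha> - \<beta>))"
  have X: "1 \<le> X" unfolding X_def using E d by (intro ge_one_powr_ge_zero) auto
  have "X powr (\<alpha> - \<beta>) = E" using d E by (simp add: X_def powr_powr)
  moreover have "X powr (\<alpha> - \<beta>) = X powr \<alpha> / X powr \<beta>" by (rule powr_diff)
  moreover have "X powr \<alpha> / X powr \<beta> \<le> C" using assms[OF X] X by (simp add: divide_le_eq)
  ultimately show False using E by simp
qed

text \<open>Time 0 is not among the times of the supremum; it is reached as a limit by continuity of
  the propagator in t.\<close>

lemma maximal_function_ge_time_zero:
  assumes "integrable lborel (fourier f)"
  shows "ennreal (cmod (propagator a 0 f x)) \<le> maximal_function a f x"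
proof (rule tendsto_upperbound)
  have "(\<lambda>n. inverse (real (Suc n)) / 2) \<longlonglongrightarrow> 0 / 2"
    by (intro tendsto_divide LIMSEQ_inverse_real_of_nat tendsto_const) simp
  hence l: "(\<lambda>n. inverse (real (Suc n)) / 2) \<longlonglongrightarrow> 0" by simp
  have "(\<lambda>n. propagator a (inverse (real (Suc n)) / 2) f x) \<longlonglongrightarrow> propagator a 0 f x"
    by (rule isCont_tendsto_compose[OF propagator_continuous_time[OF assms] l])
  thus "(\<lambda>n. ennreal (cmod (propagator a (inverse (real (Suc n)) / 2) f x))) \<longlonglongrightarrow> ennreal (cmod (propagator a 0 f x))"
    by (intro tendsto_ennrealI tendsto_norm)
  \<comment> \<open>The halving keeps the time below 1 also at n = 0.\<close>
  have "inverse (real (Suc n)) / 2 \<in> {0<..<1}" for n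
    using inverse_le_1_iff[of "real (Suc n)"] by (auto simp del: of_nat_Suc)
  thus "\<forall>\<^sub>F n in sequentially. ennreal (cmod (propagator a (inverse (real (Suc n)) / 2) f x)) \<le> maximal_function a f x"
    unfolding maximal_function_def by (intro always_eventually allI SUP_upper)
qed simp

lemma Lq_norm_lower_bound:
  fixes q m l u :: real
  assumes q: "0 < q" and m: "0 \<le> m" and lu: "l \<le> u" and ge: "\<And>x. l < x \<Longrightarrow> x < u \<Longrightarrow> ennreal m \<le> g x"
  shows "ennreal (m * (u - l) powr (1 / q)) \<le> Lq_norm (ennreal q) g"
proof -
  have "ennreal (m powr q * (u - l)) = (\<integral>\<^sup>+x. ennreal (m powr q) * indicator {l<..<u} x \<partial>lborel)"
    using lu by (simp add: nn_integral_cmult_indicator ennreal_mult')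
  also have "\<dots> \<le> (\<integral>\<^sup>+x. ennreal_power (g x) q \<partial>lborel)"
  proof (rule nn_integral_mono)
    fix x
    show "ennreal (m powr q) * indicator {l<..<u} x \<le> ennreal_power (g x) q"
      using ennreal_power_mono[OF _ ge[of x], of q] q m
      by (auto simp: indicator_def ennreal_power_ennreal)
  qed
  finally have "ennreal_power (ennreal (m powr q * (u - l))) (1 / q) \<le> Lq_norm (ennreal q) g"
    using q by (simp add: Lq_norm_def ennreal_power_mono)
  thus ?thesis using q m lu by (simp add: ennreal_power_ennreal powr_mult powr_powr)
qed

text \<open>The constant is independent of N, \<delta> and the interval, so these can be coupled
  freely in the tests.\<close>

lemma maximal_estimate_packet:
  fixes q s :: real
  assumes est: "maximal_estimate a (ennreal q) s" and q: "0 < q" and s: "0 \<le> s"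
  obtains C where "0 < C"
    "\<And>N \<delta> l u. 0 < \<delta> \<Longrightarrow> l \<le> u \<Longrightarrow>
       (\<And>x. l < x \<Longrightarrow> x < u \<Longrightarrow> ennreal \<delta> \<le> maximal_function a (packet N \<delta>) x) \<Longrightarrow>
       \<delta> * (u - l) powr (1 / q) \<le> C * ((1 + N\<^sup>2 + \<delta>\<^sup>2) powr s * \<delta>) powr (1 / 2)"
proof -
  obtain C0 where C0: "\<And>f. schwartz f \<Longrightarrow> Lq_norm (ennreal q) (maximal_function a f) \<le> ennreal C0 * sobolev_norm s f"
    using est unfolding maximal_estimate_def by blast
  obtain K where K: "0 < K"
    "\<And>N \<delta>. 0 < \<delta> \<Longrightarrow> sobolev_norm s (packet N \<delta>) \<le> ennreal ((K * (1 + N\<^sup>2 + \<delta>\<^sup>2) powr s * \<delta>) powr (1 / 2))"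
    using sobolev_norm_packet[OF s] by blast
  \<comment> \<open>\<open>C0\<close> may be negative, in which case \<open>ennreal C0\<close> is 0;
    a positive constant permits the return to real numbers.\<close>
  define C1 where "C1 = max C0 1"
  have C1: "0 < C1" "C0 \<le> C1" by (auto simp: C1_def)
  have "\<delta> * (u - l) powr (1 / q) \<le> (C1 * K powr (1 / 2)) * ((1 + N\<^sup>2 + \<delta>\<^sup>2) powr s * \<delta>) powr (1 / 2)"
    if d: "0 < \<delta>" and lu: "l \<le> u" and ge: "\<And>x. l < x \<Longrightarrow> x < u \<Longrightarrow> ennreal \<delta> \<le> maximal_function a (packet N \<delta>) x" for N \<delta> l u
  proof -
    have "ennreal (\<delta> * (u - l) powr (1 / q)) \<le> Lq_norm (ennreal q) (maximal_function a (packet N \<delta>))"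
      using d by (intro Lq_norm_lower_bound q lu ge) auto
    also have "\<dots> \<le> ennreal C0 * sobolev_norm s (packet N \<delta>)" by (intro C0 schwartz_packet d)
    also have "\<dots> \<le> ennreal C1 * ennreal ((K * (1 + N\<^sup>2 + \<delta>\<^sup>2) powr s * \<delta>) powr (1 / 2))"
      by (intro mult_mono K(2) d ennreal_leI C1) auto
    also have "\<dots> = ennreal (C1 * (K * (1 + N\<^sup>2 + \<delta>\<^sup>2) powr s * \<delta>) powr (1 / 2))"
      using C1 by (simp add: ennreal_mult')
    finally have "\<delta> * (u - l) powr (1 / q) \<le> C1 * (K * (1 + N\<^sup>2 + \<delta>\<^sup>2) powr s * \<delta>) powr (1 / 2)"
      using C1 by (subst (asm) ennreal_le_iff) auto
    also have "(K * (1 + N\<^sup>2 + \<delta>\<^sup>2) powr s * \<delta>) powr (1 / 2) = K powr (1 / 2) * ((1 + N\<^sup>2 + \<delta>\<^sup>2) powr s * \<delta>) powr (1 / 2)"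
      by (simp only: powr_mult mult.assoc)
    finally show ?thesis by (simp only: mult.assoc)
  qed
  thus ?thesis using that[of "C1 * K powr (1 / 2)"] C1 K by simp
qed

text \<open>For 0 < x < 1/\<delta> the phase x \<xi> is small on the bandwidth: A = x^2/2 satisfies
  A \<delta>^2 \<le> 1/2. The resulting inequality has two uses, \<delta> tending to 0 for spreading
  in space and \<delta> tending to infinity for concentration.\<close>

lemma maximal_estimate_centered_packet:
  fixes q s :: real
  assumes est: "maximal_estimate a (ennreal q) s" and q: "0 < q" and s: "0 \<le> s"
  obtains C where "0 < C" "\<And>\<delta>. 0 < \<delta> \<Longrightarrow> \<delta> powr (1 - 1 / q) \<le> C * ((1 + \<delta>\<^sup>2) powr s * \<delta>) powr (1 / 2)"
proof -
  obtain C where C: "0 < C" "\<And>N \<delta> l u. 0 < \<delta> \<Longrightarrow> l \<le> u \<Longrightarrow>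
       (\<And>x. l < x \<Longrightarrow> x < u \<Longrightarrow> ennreal \<delta> \<le> maximal_function a (packet N \<delta>) x) \<Longrightarrow>
       \<delta> * (u - l) powr (1 / q) \<le> C * ((1 + N\<^sup>2 + \<delta>\<^sup>2) powr s * \<delta>) powr (1 / 2)"
    using maximal_estimate_packet[OF est q s] by blast
  have "\<delta> powr (1 - 1 / q) \<le> C * ((1 + \<delta>\<^sup>2) powr s * \<delta>) powr (1 / 2)" if d: "0 < \<delta>" for \<delta>
  proof -
    have "\<delta> powr (1 - 1 / q) = \<delta> * (1 / \<delta> - 0) powr (1 / q)"
      using d by (simp add: powr_diff powr_divide)
    also have "\<dots> \<le> C * ((1 + 0\<^sup>2 + \<delta>\<^sup>2) powr s * \<delta>) powr (1 / 2)"
    proof (rule C(2)[OF d])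
      show "0 \<le> 1 / \<delta>" using d by simp
      fix x assume x: "0 < x" "x < 1 / \<delta>"
      have "\<delta> \<le> cmod (propagator a 0 (packet 0 \<delta>) x)"
      proof (rule propagator_packet_lower_bound[OF d, where A = "x\<^sup>2 / 2" and c = 0])
        have "x * \<delta> \<le> 1" using x d by (simp add: field_simps)
        hence "(x * \<delta>)\<^sup>2 \<le> 1" using x d by (intro power_le_one) auto
        thus "x\<^sup>2 / 2 * \<delta>\<^sup>2 \<le> 1 / 2" by (simp add: power_mult_distrib)
        show "1 - x\<^sup>2 / 2 * (\<xi> - 0)\<^sup>2 \<le> cos (0 * \<bar>\<xi>\<bar> powr a + x * \<xi> - 0)" for \<xi>
          using cos_lower_bounds(1)[of "x * \<xi>"] by (simp add: power_mult_distrib)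
      qed
      thus "ennreal \<delta> \<le> maximal_function a (packet 0 \<delta>) x"
        by (intro order_trans[OF ennreal_leI maximal_function_ge_time_zero] integrable_fourier_packet d)
    qed
    finally show ?thesis by simp
  qed
  thus ?thesis using that C by blast
qed

text \<open>As \<delta> = 1/X tends to 0, the Sobolev weight stays bounded, so s drops out and
  comparing powers of X leaves 1/q \<le> 1/2.\<close>

lemma maximal_estimate_imp_exponent_ge_2:
  fixes q s :: real
  assumes est: "maximal_estimate a (ennreal q) s" and q: "0 < q"
  shows "2 \<le> q"
proof -
  \<comment> \<open>Raising s preserves the estimate, and the packet norms were bounded for
    nonnegative exponents.\<close>
  define s' where "s' = max s 0"
  have est': "maximal_estimate a (ennreal q) s'" "0 \<le> s'"
    using maximal_estimate_mono[OF est] by (auto simp: s'_def)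
  obtain C where C: "0 < C" "\<And>\<delta>. 0 < \<delta> \<Longrightarrow> \<delta> powr (1 - 1 / q) \<le> C * ((1 + \<delta>\<^sup>2) powr s' * \<delta>) powr (1 / 2)"
    using maximal_estimate_centered_packet[OF est'(1) q est'(2)] by blast
  have "X powr (1 / q - 1) \<le> (C * (2 powr s') powr (1 / 2)) * X powr (- (1 / 2))" if X: "1 \<le> X" for X
  proof -
    have "X powr (1 / q - 1) = (1 / X) powr (1 - 1 / q)"
      using X powr_minus_divide[of X "1 - 1 / q"] by (simp add: powr_divide)
    also have "\<dots> \<le> C * ((1 + (1 / X)\<^sup>2) powr s' * (1 / X)) powr (1 / 2)" using X by (intro C) auto
    also have "\<dots> \<le> C * (2 powr s' * (1 / X)) powr (1 / 2)"
    proof -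
      have "(1 / X)\<^sup>2 \<le> 1" using X by (intro power_le_one) auto
      hence "(1 + (1 / X)\<^sup>2) powr s' \<le> 2 powr s'" using est' by (intro powr_mono2) auto
      thus ?thesis using C X by (intro mult_left_mono powr_mono2[of "1 / 2"] mult_right_mono) auto
    qed
    also have "\<dots> = (C * (2 powr s') powr (1 / 2)) * X powr (- (1 / 2))"
      using X by (simp only: powr_mult powr_divide powr_minus_divide) simp
    finally show ?thesis .
  qed
  hence "1 / q - 1 \<le> - (1 / 2)" by (rule powr_dominated_imp_le)
  hence "1 / q \<le> 1 / 2" by simp
  thus ?thesis using q by (simp add: field_simps)
qed

lemma maximal_estimate_imp_ge_concentration:
  fixes q s :: real
  assumes est: "maximal_estimate a (ennreal q) s" and q: "2 < q"
  shows "1 / 2 - 1 / q \<le> s"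
proof -
  define s' where "s' = max s 0"
  have est': "maximal_estimate a (ennreal q) s'" "0 \<le> s'"
    using maximal_estimate_mono[OF est] by (auto simp: s'_def)
  have q0: "0 < q" using q by simp
  obtain C where C: "0 < C" "\<And>\<delta>. 0 < \<delta> \<Longrightarrow> \<delta> powr (1 - 1 / q) \<le> C * ((1 + \<delta>\<^sup>2) powr s' * \<delta>) powr (1 / 2)"
    using maximal_estimate_centered_packet[OF est'(1) q0 est'(2)] by blast
  have "X powr (1 - 1 / q) \<le> (C * (2 powr s') powr (1 / 2)) * X powr (s' + 1 / 2)" if X: "1 \<le> X" for X
  proof -
    have "X powr (1 - 1 / q) \<le> C * ((1 + X\<^sup>2) powr s' * X) powr (1 / 2)" using X by (intro C) auto
    also have "\<dots> \<le> C * ((2 * X\<^sup>2) powr s' * X) powr (1 / 2)"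
    proof -
      have "1 \<le> X\<^sup>2" using X by (simp add: one_le_power)
      hence "(1 + X\<^sup>2) powr s' \<le> (2 * X\<^sup>2) powr s'" using est' by (intro powr_mono2) auto
      thus ?thesis using C X by (intro mult_left_mono powr_mono2[of "1 / 2"] mult_right_mono) auto
    qed
    also have "X\<^sup>2 = X powr 2" using X by (simp add: powr_numeral)
    also have "C * ((2 * X powr 2) powr s' * X) powr (1 / 2) = (C * (2 powr s') powr (1 / 2)) * (X powr s' * X powr (1 / 2))"
      by (simp only: powr_mult powr_powr) simp
    also have "X powr s' * X powr (1 / 2) = X powr (s' + 1 / 2)" by (rule powr_add[symmetric])
    finally show ?thesis .
  qed
  hence le: "1 - 1 / q \<le> s' + 1 / 2" by (rule powr_dominated_imp_le)
  \<comment> \<open>The lower bound is positive, so it cannot be met by the alternative value 0 of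
    the maximum; hence s' = s.\<close>
  moreover have "0 < 1 / 2 - 1 / q" using q by (simp add: field_simps)
  ultimately show ?thesis by (auto simp: s'_def max_def split: if_splits)
qed

text \<open>Taylor expansion to second order at N; the intermediate point stays within [N/2, 3N/2],
  where the second derivative is comparable to N^(a-2).\<close>

lemma powr_Taylor_remainder:
  fixes a N \<xi> :: real
  assumes a: "1 < a" and N: "0 < N" and \<xi>: "\<bar>\<xi> - N\<bar> \<le> N / 2"
  shows "\<bar>\<bar>\<xi>\<bar> powr a - N powr a - a * N powr (a - 1) * (\<xi> - N)\<bar>
    \<le> 2 * a * (a - 1) * (3 / 2) powr a * N powr (a - 2) * (\<xi> - N)\<^sup>2"
proof (cases "\<xi> = N")
  case False
  have xr: "N / 2 \<le> \<xi>" "\<xi> \<le> 3 * N / 2" using \<xi> unfolding abs_le_iff by (simp_all add: field_simps)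
  have ax: "\<bar>\<xi>\<bar> = \<xi>" using xr N by simp
  define D where "D = (\<lambda>(m::nat) x. if m = 0 then x powr a else if m = 1 then a * x powr (a - 1) else a * ((a - 1) * x powr (a - 2)))"
  have "\<exists>t. (if \<xi> < N then \<xi> < t \<and> t < N else N < t \<and> t < \<xi>) \<and>
     \<xi> powr a = (\<Sum>m<2. (D m N / fact m) * (\<xi> - N) ^ m) + (D 2 t / fact 2) * (\<xi> - N) ^ 2"
  proof (rule Taylor[where a = "N / 2" and b = "3 * N / 2"])
    show "\<forall>m t. m < 2 \<and> N / 2 \<le> t \<and> t \<le> 3 * N / 2 \<longrightarrow> (D m has_real_derivative D (Suc m) t) (at t)"
    proof (intro allI impI)
      fix m :: nat and t :: real assume mt: "m < 2 \<and> N / 2 \<le> t \<and> t \<le> 3 * N / 2"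
      have t: "0 < t" using mt N by linarith
      consider "m = 0" | "m = 1" using mt by linarith
      thus "(D m has_real_derivative D (Suc m) t) (at t)"
      proof cases
        case 1
        thus ?thesis using has_real_derivative_powr[OF t, of a] by (simp add: D_def)
      next
        case 2
        thus ?thesis using DERIV_cmult[OF has_real_derivative_powr[OF t, of "a - 1"], of a] by (simp add: D_def)
      qed
    qed
  qed (use xr N False in \<open>auto simp: D_def\<close>)
  then obtain t where t: "if \<xi> < N then \<xi> < t \<and> t < N else N < t \<and> t < \<xi>"
    and eq: "\<xi> powr a = (\<Sum>m<2. (D m N / fact m) * (\<xi> - N) ^ m) + (D 2 t / fact 2) * (\<xi> - N) ^ 2" by blast
  have tr: "N / 2 \<le> t" "t \<le> 3 * N / 2" using t xr N by (auto split: if_splits)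
  have t0: "0 < t" using tr N by linarith
  have "\<xi> powr a = N powr a + a * N powr (a - 1) * (\<xi> - N) + a * (a - 1) * t powr (a - 2) / 2 * (\<xi> - N)\<^sup>2"
    unfolding eq by (simp add: D_def numeral_2_eq_2)
  hence "\<bar>\<bar>\<xi>\<bar> powr a - N powr a - a * N powr (a - 1) * (\<xi> - N)\<bar> = a * (a - 1) / 2 * t powr (a - 2) * (\<xi> - N)\<^sup>2"
    unfolding ax using a by (simp add: abs_mult)
  also have "\<dots> \<le> a * (a - 1) / 2 * (4 * (3 / 2) powr a * N powr (a - 2)) * (\<xi> - N)\<^sup>2"
  proof -
    \<comment> \<open>Numerator and denominator are estimated at opposite ends of the range, so the
      bound holds on both sides of a = 2.\<close>
    have "t powr (a - 2) = t powr a / t\<^sup>2" using t0 by (simp add: powr_diff powr_numeral)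
    also have "\<dots> \<le> (3 * N / 2) powr a / (N / 2)\<^sup>2"
      using tr t0 N a by (intro frac_le powr_mono2 power_mono) auto
    also have "(3 * N / 2) powr a = (3 / 2) powr a * N powr a"
      using powr_mult[of "3 / 2" N a] by simp
    also have "(3 / 2) powr a * N powr a / (N / 2)\<^sup>2 = 4 * (3 / 2) powr a * (N powr a / N\<^sup>2)"
      by (simp add: power_divide)
    also have "N powr a / N\<^sup>2 = N powr (a - 2)" using N by (simp add: powr_diff powr_numeral)
    finally show ?thesis using a by (intro mult_right_mono mult_left_mono) auto
  qed
  finally show ?thesis by (simp add: mult_ac del: left_diff_distrib_numeral right_diff_distrib_numeral)
qed (use N in simp)

text \<open>A packet at frequency \<open>N\<close> travels with speed \<open>a N\<^bsup>a-1\<^esup>\<close>; at bandwidth \<open>N\<^bsup>1-a/2\<^esup>\<close> it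
  does not disperse up to time 1.\<close>

lemma maximal_estimate_imp_ge_travelling:
  fixes a q s :: real
  assumes a: "1 < a" and est: "maximal_estimate a (ennreal q) s" and q: "2 \<le> q" "q < 4"
  shows "1 / 2 - a / 4 + a / q - 1 / q \<le> s"
proof -
  define s' where "s' = max s 0"
  have est': "maximal_estimate a (ennreal q) s'" "0 \<le> s'"
    using maximal_estimate_mono[OF est] by (auto simp: s'_def)
  have q0: "0 < q" using q by simp
  obtain C where C: "0 < C" "\<And>N \<delta> l u. 0 < \<delta> \<Longrightarrow> l \<le> u \<Longrightarrow>
       (\<And>x. l < x \<Longrightarrow> x < u \<Longrightarrow> ennreal \<delta> \<le> maximal_function a (packet N \<delta>) x) \<Longrightarrow>
       \<delta> * (u - l) powr (1 / q) \<le> C * ((1 + N\<^sup>2 + \<delta>\<^sup>2) powr s' * \<delta>) powr (1 / 2)"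
    using maximal_estimate_packet[OF est'(1) q0 est'(2)] by blast
  \<comment> \<open>The first summand is the Taylor constant. The 8 covers |\<xi> - N| > N/2, where
    it forces A (\<xi> - N)^2 \<ge> 2 and the cosine bound becomes trivial.\<close>
  define \<kappa> where "\<kappa> = 2 * a * (a - 1) * (3 / 2) powr a + 8"
  have \<kappa>: "8 \<le> \<kappa>" using a by (simp add: \<kappa>_def)
  \<comment> \<open>Chosen such that \<kappa> c^2 = 1/2, which is the required bound on A
    \<delta>^2.\<close>
  define c where "c = 1 / sqrt (2 * \<kappa>)"
  have c: "0 < c" "c \<le> 1" "c\<^sup>2 = 1 / (2 * \<kappa>)"
  proof -
    have "1 \<le> sqrt (2 * \<kappa>)" using \<kappa> by (simp add: real_le_rsqrt)
    thus "0 < c" "c \<le> 1" using \<kappa> by (auto simp: c_def)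
    show "c\<^sup>2 = 1 / (2 * \<kappa>)" using \<kappa> by (simp add: c_def power_divide)
  qed
  have "N powr (1 - a / 2 + (a - 1) / q) \<le> (C / c * (3 powr s') powr (1 / 2)) * N powr (s' + (1 - a / 2) / 2)"
    if N: "1 \<le> N" for N
  proof -
    have N0: "0 < N" using N by simp
    define \<delta> where "\<delta> = c * N powr (1 - a / 2)"
    have d: "0 < \<delta>" using c N0 by (simp add: \<delta>_def)
    have dN: "\<delta> \<le> N powr (1 - a / 2)" using c by (simp add: \<delta>_def mult_left_le_one_le)
    \<comment> \<open>The bandwidth does not exceed the frequency, so the Sobolev weight of the
      packet is of order N^(2s').\<close>
    have "N powr (1 - a / 2) \<le> N powr 1" using N a by (intro powr_mono) auto
    hence dN1: "\<delta> \<le> N" using dN N0 by simp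
    define V where "V = a * N powr (a - 1)"
    have V: "0 < V" using a N0 by (simp add: V_def)
    define A where "A = \<kappa> * N powr (a - 2)"
    have Ad: "A * \<delta>\<^sup>2 \<le> 1 / 2"
    proof -
      have "(N powr (1 - a / 2))\<^sup>2 = N powr (2 - a)" by (simp add: power2_eq_square flip: powr_add)
      hence "A * \<delta>\<^sup>2 = \<kappa> * c\<^sup>2 * (N powr (a - 2) * N powr (2 - a))"
        by (simp add: A_def \<delta>_def power_mult_distrib)
      also have "N powr (a - 2) * N powr (2 - a) = 1" using N0 by (simp flip: powr_add)
      finally show ?thesis using \<kappa> c(3) by simp
    qed
    have ge: "ennreal \<delta> \<le> maximal_function a (packet N \<delta>) x" if x: "- V < x" "x < 0" for x
    proof -
      \<comment> \<open>The time at which the packet arrives at x: the linear part t V + x of the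
        phase vanishes. It moves to the left and sweeps the interval from 0 to -V during the unit of
        time.\<close>
      define t where "t = - x / V"
      have t: "0 < t" "t < 1" using x V by (auto simp: t_def field_simps)
      have "\<delta> \<le> cmod (propagator a t (packet N \<delta>) x)"
      proof (rule propagator_packet_lower_bound[OF d Ad])
        fix \<xi>
        define y where "y = t * (\<bar>\<xi>\<bar> powr a - N powr a - a * N powr (a - 1) * (\<xi> - N))"
        have "t * V = - x" using V by (simp add: t_def)
        hence yeq: "t * \<bar>\<xi>\<bar> powr a + x * \<xi> - (t * N powr a + x * N) = y"
          unfolding y_def V_def by (simp add: algebra_simps)
        have "1 - A * (\<xi> - N)\<^sup>2 \<le> cos y"
        proof (cases "\<bar>\<xi> - N\<bar> \<le> N / 2")
          case True
          have "\<bar>y\<bar> \<le> 1 * (2 * a * (a - 1) * (3 / 2) powr a * N powr (a - 2) * (\<xi> - N)\<^sup>2)"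
            unfolding y_def abs_mult using t powr_Taylor_remainder[OF a N0 True] by (intro mult_mono) auto
          also have "\<dots> \<le> A * (\<xi> - N)\<^sup>2"
            unfolding A_def \<kappa>_def by (simp add: mult_right_mono)
          finally show ?thesis using cos_lower_bounds(2)[of y] by linarith
        next
          case False
          have "(N / 2)\<^sup>2 \<le> \<bar>\<xi> - N\<bar>\<^sup>2" using False N0 by (intro power_mono) auto
          hence "2 \<le> 8 / N\<^sup>2 * (\<xi> - N)\<^sup>2" using N0 by (simp add: field_simps)
          also have "8 / N\<^sup>2 \<le> A"
          proof -
            have "1 / N\<^sup>2 = N powr (- 2)" using N0 by (simp add: powr_minus_divide powr_numeral)
            also have "\<dots> \<le> N powr (a - 2)" using N a by (intro powr_mono) auto
            finally have "8 * (1 / N\<^sup>2) \<le> \<kappa> * N powr (a - 2)" using \<kappa> by (intro mult_mono) auto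
            thus ?thesis by (simp add: A_def)
          qed
          hence "8 / N\<^sup>2 * (\<xi> - N)\<^sup>2 \<le> A * (\<xi> - N)\<^sup>2" by (intro mult_right_mono) auto
          finally show ?thesis using cos_ge_minus_one[of y] by linarith
        qed
        thus "1 - A * (\<xi> - N)\<^sup>2 \<le> cos (t * \<bar>\<xi>\<bar> powr a + x * \<xi> - (t * N powr a + x * N))"
          by (simp only: yeq)
      qed
      hence "ennreal \<delta> \<le> ennreal (cmod (propagator a t (packet N \<delta>) x))" by (rule ennreal_leI)
      also have "\<dots> \<le> maximal_function a (packet N \<delta>) x"
        unfolding maximal_function_def using t by (intro SUP_upper) auto
      finally show ?thesis .
    qed
    have "c * N powr (1 - a / 2 + (a - 1) / q) = \<delta> * (N powr (a - 1)) powr (1 / q)"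
      by (simp add: \<delta>_def powr_add powr_powr)
    also have "\<dots> \<le> \<delta> * (0 - - V) powr (1 / q)"
    proof -
      have "1 * N powr (a - 1) \<le> V" unfolding V_def using a by (intro mult_right_mono) auto
      thus ?thesis using d q0 by (intro mult_left_mono powr_mono2) auto
    qed
    also have "\<dots> \<le> C * ((1 + N\<^sup>2 + \<delta>\<^sup>2) powr s' * \<delta>) powr (1 / 2)"
      by (rule C(2)[OF d _ ge]) (use V in auto)
    also have "\<dots> \<le> C * ((3 * N powr 2) powr s' * N powr (1 - a / 2)) powr (1 / 2)"
    proof -
      have "1 \<le> N\<^sup>2" "\<delta>\<^sup>2 \<le> N\<^sup>2" using N dN1 d by (auto intro: power_mono one_le_power)
      moreover have "N\<^sup>2 = N powr 2" using N0 by (simp add: powr_numeral)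
      ultimately have "(1 + N\<^sup>2 + \<delta>\<^sup>2) powr s' \<le> (3 * N powr 2) powr s'"
        using est' by (intro powr_mono2) auto
      thus ?thesis using C d dN by (intro mult_left_mono powr_mono2[of "1 / 2"] mult_mono) auto
    qed
    also have "\<dots> = C * (3 powr s') powr (1 / 2) * (N powr s' * N powr ((1 - a / 2) / 2))"
      by (simp only: powr_mult powr_powr) simp
    also have "N powr s' * N powr ((1 - a / 2) / 2) = N powr (s' + (1 - a / 2) / 2)" by (rule powr_add[symmetric])
    finally show ?thesis using c by (simp add: field_simps)
  qed
  hence le: "1 - a / 2 + (a - 1) / q \<le> s' + (1 - a / 2) / 2" by (rule powr_dominated_imp_le)
  have eq: "1 / 2 - a / 4 + a / q - 1 / q = 1 / 4 + (a - 1) * (1 / q - 1 / 4)"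
    by (simp add: algebra_simps diff_divide_distrib)
  have "1 / 2 - a / 4 + a / q - 1 / q \<le> s'" using le by (simp add: diff_divide_distrib)
  \<comment> \<open>With q < 4 the critical exponent is at least 1/4, in particular positive, so the
    bound for s' is one for s.\<close>
  moreover have "0 \<le> (a - 1) * (1 / q - 1 / 4)" using a q by (intro mult_nonneg_nonneg) (auto simp: field_simps)
  hence "0 < 1 / 2 - a / 4 + a / q - 1 / q" unfolding eq by linarith
  ultimately show ?thesis by (auto simp: s'_def max_def split: if_splits)
qed

text \<open>The tests for \<open>q = \<infinity>\<close>: each dyadic frequency contributes equally both to the value at the origin
  and to the squared Sobolev norm of order 1/2.\<close>

definition dyadic_packet :: "nat \<Rightarrow> real \<Rightarrow> complex" where
  "dyadic_packet n x = (\<Sum>k\<le>n. of_real (1 / 2 ^ k) * packet 0 (2 ^ k) x)"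

definition dyadic_gauss :: "nat \<Rightarrow> real \<Rightarrow> real" where
  "dyadic_gauss n \<xi> = (\<Sum>k\<le>n. 1 / 2 ^ k * gauss 0 (2 ^ k) \<xi>)"

lemma schwartz_dyadic_packet: "schwartz (dyadic_packet n)"
proof -
  have one: "schwartz (\<lambda>x. of_real (1 / 2 ^ k) * packet 0 (2 ^ k) x)" for k
  proof -
    have "(\<lambda>x. of_real (1 / 2 ^ k) * packet 0 (2 ^ k) x)
      = poly_gaussian (smult (of_real (1 / 2 ^ k)) [:of_real (2 ^ k / sqrt (2 * pi)):]) ((2 ^ k)\<^sup>2 / 2) 0"
      by (rule ext) (simp only: packet_def poly_gaussian_def poly_smult mult.assoc)
    thus ?thesis by (simp only:) (intro schwartz_poly_gaussian, simp)
  qed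
  show ?thesis
  proof (induction n)
    case 0
    show ?case using one[of 0] by (simp add: dyadic_packet_def [abs_def])
  next
    case (Suc n)
    have "dyadic_packet (Suc n) = (\<lambda>x. dyadic_packet n x + of_real (1 / 2 ^ Suc n) * packet 0 (2 ^ Suc n) x)"
      by (rule ext) (simp only: dyadic_packet_def sum.atMost_Suc)
    thus ?case using schwartz_add[OF Suc one[of "Suc n"]] by simp
  qed
qed

lemma integrable_packet:
  assumes "0 < \<delta>"
  shows "integrable lborel (packet N \<delta>)"
proof -
  have i: "integrable lborel (\<lambda>x. (\<delta> / sqrt (2 * pi)) * gauss 0 (1 / \<delta>) x)"
    using assms by (intro integrable_mult_right gauss_integral) auto
  have m: "packet N \<delta> \<in> borel_measurable borel"
    by (rule schwartz_borel_measurable[OF schwartz_packet[OF assms]])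
  have b: "cmod (packet N \<delta> x) \<le> norm ((\<delta> / sqrt (2 * pi)) * gauss 0 (1 / \<delta>) x)" for x
  proof -
    have "cmod (packet N \<delta> x) = \<bar>\<delta> / sqrt (2 * pi) * exp (- (\<delta> * x)\<^sup>2 / 2)\<bar>"
      unfolding packet_eq norm_mult norm_of_real norm_cis by simp
    thus ?thesis by (simp add: gauss_def mult.commute)
  qed
  show ?thesis
    by (rule Bochner_Integration.integrable_bound[OF i _ AE_I2[OF b]]) (use m in simp)
qed

lemma fourier_dyadic_packet: "fourier (dyadic_packet n) \<xi> = of_real (dyadic_gauss n \<xi>)"
proof -
  let ?e = "\<lambda>x. exp (- \<i> * complex_of_real (x * \<xi>))"
  have i: "integrable lborel (\<lambda>x. of_real (1 / 2 ^ k) * (?e x * packet 0 (2 ^ k) x))" for k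
  proof (rule integrable_mult_right)
    have "integrable lborel (packet 0 (2 ^ k))" by (rule integrable_packet) simp
    moreover have [measurable]: "packet 0 (2 ^ k) \<in> borel_measurable borel"
      by (intro schwartz_borel_measurable schwartz_packet) simp
    ultimately show "integrable lborel (\<lambda>x. ?e x * packet 0 (2 ^ k) x)"
      by (elim Bochner_Integration.integrable_bound) (auto simp: norm_mult norm_exp_eq_Re)
  qed
  have "fourier (dyadic_packet n) \<xi> = (LINT x|lborel. (\<Sum>k\<le>n. of_real (1 / 2 ^ k) * (?e x * packet 0 (2 ^ k) x)))"
    unfolding fourier_def dyadic_packet_def sum_distrib_left by (simp only: mult.left_commute)
  also have "\<dots> = (\<Sum>k\<le>n. (LINT x|lborel. of_real (1 / 2 ^ k) * (?e x * packet 0 (2 ^ k) x)))"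
    using i by (intro Bochner_Integration.integral_sum) auto
  also have "\<dots> = (\<Sum>k\<le>n. of_real (1 / 2 ^ k) * fourier (packet 0 (2 ^ k)) \<xi>)"
    by (simp only: fourier_def Bochner_Integration.integral_mult_right_zero)
  also have "\<dots> = of_real (dyadic_gauss n \<xi>)"
    by (simp add: fourier_packet dyadic_gauss_def)
  finally show ?thesis .
qed

lemma dyadic_gauss_measurable [measurable]: "dyadic_gauss n \<in> borel_measurable borel"
  unfolding dyadic_gauss_def by measurable

lemma dyadic_gauss_nonneg: "0 \<le> dyadic_gauss n \<xi>"
  unfolding dyadic_gauss_def by (intro sum_nonneg) (simp add: less_imp_le[OF gauss_pos])

lemma dyadic_gauss_integral:
  "integrable lborel (dyadic_gauss n)" "(LINT \<xi>|lborel. dyadic_gauss n \<xi>) = real (Suc n) * sqrt (2 * pi)"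
proof -
  have i: "integrable lborel (\<lambda>\<xi>. 1 / 2 ^ k * gauss 0 (2 ^ k) \<xi>)" for k
    by (intro integrable_mult_right gauss_integral) simp
  show "integrable lborel (dyadic_gauss n)"
    unfolding dyadic_gauss_def [abs_def] using i by (intro Bochner_Integration.integrable_sum) auto
  have "(LINT \<xi>|lborel. dyadic_gauss n \<xi>) = (\<Sum>k\<le>n. (LINT \<xi>|lborel. 1 / 2 ^ k * gauss 0 (2 ^ k) \<xi>))"
    unfolding dyadic_gauss_def using i by (intro Bochner_Integration.integral_sum) auto
  also have "\<dots> = (\<Sum>k\<le>n. sqrt (2 * pi))"
    by (intro sum.cong refl) (simp only: Bochner_Integration.integral_mult_right_zero, simp add: gauss_integral)
  finally show "(LINT \<xi>|lborel. dyadic_gauss n \<xi>) = real (Suc n) * sqrt (2 * pi)" by simp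
qed

text \<open>With u = \<xi>/\<delta> and \<delta> \<ge> 1 one has sqrt(1 + \<xi>^2) \<le> \<delta> (1
  + u^2), which reduces the integral to the mass and the second moment; each contributes sqrt(2 pi)
  \<delta>^2.\<close>

lemma weighted_gauss_integral:
  assumes d: "1 \<le> \<delta>"
  shows "(\<integral>\<^sup>+\<xi>. ennreal ((1 + \<bar>\<xi>\<bar>\<^sup>2) powr (1 / 2) * gauss 0 \<delta> \<xi>) \<partial>lborel) \<le> ennreal (2 * sqrt (2 * pi) * \<delta>\<^sup>2)"
proof -
  have d0: "0 < \<delta>" using d by simp
  have pw: "(1 + \<bar>\<xi>\<bar>\<^sup>2) powr (1 / 2) * gauss 0 \<delta> \<xi> \<le> \<delta> * gauss 0 \<delta> \<xi> + 1 / \<delta> * (gauss 0 \<delta> \<xi> * (\<xi> - 0)\<^sup>2)" for \<xi>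
  proof -
    define u where "u = \<xi> / \<delta>"
    have u: "\<xi> = \<delta> * u" using d0 by (simp add: u_def)
    have "(1 + \<bar>\<xi>\<bar>\<^sup>2) powr (1 / 2) = sqrt (1 + \<xi>\<^sup>2)" by (simp add: powr_half_sqrt)
    also have "\<dots> \<le> \<delta> * (1 + u\<^sup>2)"
    proof (rule real_le_lsqrt)
      have "1 \<le> \<delta>\<^sup>2" using d by (simp add: one_le_power)
      hence "1 + \<xi>\<^sup>2 \<le> \<delta>\<^sup>2 * (1 + u\<^sup>2)" unfolding u by (simp add: power_mult_distrib algebra_simps)
      also have "\<dots> \<le> \<delta>\<^sup>2 * ((1 + u\<^sup>2) * (1 + u\<^sup>2))"
        by (intro mult_left_mono) (auto simp: algebra_simps)
      finally show "1 + \<xi>\<^sup>2 \<le> (\<delta> * (1 + u\<^sup>2))\<^sup>2" by (simp only: power_mult_distrib power2_eq_square[of "1 + u\<^sup>2"])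
    qed (use d0 in auto)
    also have "\<delta> * (1 + u\<^sup>2) = \<delta> + 1 / \<delta> * (\<xi> - 0)\<^sup>2" using d0 by (simp add: u power_mult_distrib algebra_simps power2_eq_square)
    finally have "(1 + \<bar>\<xi>\<bar>\<^sup>2) powr (1 / 2) * gauss 0 \<delta> \<xi> \<le> (\<delta> + 1 / \<delta> * (\<xi> - 0)\<^sup>2) * gauss 0 \<delta> \<xi>"
      by (intro mult_right_mono less_imp_le[OF gauss_pos])
    thus ?thesis by (simp add: algebra_simps)
  qed
  have "(\<integral>\<^sup>+\<xi>. ennreal ((1 + \<bar>\<xi>\<bar>\<^sup>2) powr (1 / 2) * gauss 0 \<delta> \<xi>) \<partial>lborel)
    \<le> (\<integral>\<^sup>+\<xi>. ennreal (\<delta> * gauss 0 \<delta> \<xi> + 1 / \<delta> * (gauss 0 \<delta> \<xi> * (\<xi> - 0)\<^sup>2)) \<partial>lborel)"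
    by (intro nn_integral_mono ennreal_leI pw)
  also have "\<dots> = ennreal (LINT \<xi>|lborel. \<delta> * gauss 0 \<delta> \<xi> + 1 / \<delta> * (gauss 0 \<delta> \<xi> * (\<xi> - 0)\<^sup>2))"
    using gauss_integral[OF d0, of 0] d0 less_imp_le[OF gauss_pos]
    by (intro nn_integral_eq_integral Bochner_Integration.integrable_add integrable_mult_right AE_I2 add_nonneg_nonneg mult_nonneg_nonneg) auto
  also have "(LINT \<xi>|lborel. \<delta> * gauss 0 \<delta> \<xi> + 1 / \<delta> * (gauss 0 \<delta> \<xi> * (\<xi> - 0)\<^sup>2))
    = \<delta> * (\<delta> * sqrt (2 * pi)) + 1 / \<delta> * (\<delta> * sqrt (2 * pi) * \<delta>\<^sup>2)"
    using gauss_integral[OF d0, of 0]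
    by (subst Bochner_Integration.integral_add) (auto simp: mult.assoc)
  also have "\<dots> = 2 * sqrt (2 * pi) * \<delta>\<^sup>2" using d0 by (simp add: power2_eq_square)
  finally show ?thesis .
qed

lemma nn_integral_combination:
  assumes [measurable]: "f \<in> borel_measurable M" "\<And>k. h k \<in> borel_measurable M" "g \<in> borel_measurable M"
  shows "(\<integral>\<^sup>+x. f x + ((\<Sum>k\<le>n. c k * h k x) + d * g x) \<partial>M)
    = (\<integral>\<^sup>+x. f x \<partial>M) + ((\<Sum>k\<le>(n::nat). c k * (\<integral>\<^sup>+x. h k x \<partial>M)) + d * (\<integral>\<^sup>+x. g x \<partial>M))"
  by (simp add: nn_integral_add nn_integral_sum nn_integral_cmult)

text \<open>Linear growth in n is the point, although the square has about n^2 products: products of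
  different scales are small. Adding the scale n + 1 with coefficient b = 2^(-n-1), the cross terms
  are bounded through v \<le> 1 and sum to 2 C b times a geometric series, at most 2 C, while the
  new square costs at most C. Each step thus adds at most 3 C.\<close>

lemma weighted_dyadic_gauss_square:
  "(\<integral>\<^sup>+\<xi>. ennreal ((1 + \<bar>\<xi>\<bar>\<^sup>2) powr (1 / 2) * (dyadic_gauss n \<xi>)\<^sup>2) \<partial>lborel)
    \<le> ennreal (6 * sqrt (2 * pi) * real (Suc n))"
proof -
  let ?w = "\<lambda>\<xi>::real. (1 + \<bar>\<xi>\<bar>\<^sup>2) powr (1 / 2)"
  define C where "C = 2 * sqrt (2 * pi)"
  have C: "0 \<le> C" by (simp add: C_def)
  have g: "(\<integral>\<^sup>+\<xi>. ennreal (?w \<xi> * gauss 0 (2 ^ k) \<xi>) \<partial>lborel) \<le> ennreal (C * (2 ^ k)\<^sup>2)" for k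
    unfolding C_def by (intro weighted_gauss_integral) simp
  have "(\<integral>\<^sup>+\<xi>. ennreal (?w \<xi> * (dyadic_gauss n \<xi>)\<^sup>2) \<partial>lborel) \<le> ennreal (3 * C * real (Suc n))"
  proof (induction n)
    case 0
    have "(\<integral>\<^sup>+\<xi>. ennreal (?w \<xi> * (dyadic_gauss 0 \<xi>)\<^sup>2) \<partial>lborel) \<le> (\<integral>\<^sup>+\<xi>. ennreal (?w \<xi> * gauss 0 (2 ^ 0) \<xi>) \<partial>lborel)"
    proof (intro nn_integral_mono ennreal_leI mult_left_mono)
      fix \<xi> :: real
      show "(dyadic_gauss 0 \<xi>)\<^sup>2 \<le> gauss 0 (2 ^ 0) \<xi>"
        using mult_left_mono[OF gauss_le_1[of 0 1 \<xi>] less_imp_le[OF gauss_pos[of 0 1 \<xi>]]]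
        by (simp add: dyadic_gauss_def power2_eq_square)
    qed auto
    also have "\<dots> \<le> ennreal (C * (2 ^ 0)\<^sup>2)" by (rule g)
    also have "\<dots> \<le> ennreal (3 * C * real (Suc 0))" using C by (intro ennreal_leI) simp
    finally show ?case .
  next
    case (Suc n)
    define b where "b = (1 / 2 ^ Suc n :: real)"
    have b: "0 \<le> b" by (simp add: b_def)
    have "(\<integral>\<^sup>+\<xi>. ennreal (?w \<xi> * (dyadic_gauss (Suc n) \<xi>)\<^sup>2) \<partial>lborel)
      \<le> (\<integral>\<^sup>+\<xi>. ennreal (?w \<xi> * (dyadic_gauss n \<xi>)\<^sup>2)
          + ((\<Sum>k\<le>n. ennreal (2 * b / 2 ^ k) * ennreal (?w \<xi> * gauss 0 (2 ^ k) \<xi>))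
          + ennreal (b\<^sup>2) * ennreal (?w \<xi> * gauss 0 (2 ^ Suc n) \<xi>)) \<partial>lborel)"
    proof (rule nn_integral_mono)
      fix \<xi> :: real
      define v where "v = gauss 0 (2 ^ Suc n) \<xi>"
      have v: "0 \<le> v" "v \<le> 1" using gauss_pos gauss_le_1 by (auto simp: v_def less_imp_le)
      have w: "0 \<le> ?w \<xi>" by simp
      define S where "S = dyadic_gauss n \<xi>"
      have S: "0 \<le> S" by (simp add: S_def dyadic_gauss_nonneg)
      have "dyadic_gauss (Suc n) \<xi> = S + b * v" by (simp add: dyadic_gauss_def S_def b_def v_def)
      hence "(dyadic_gauss (Suc n) \<xi>)\<^sup>2 = S\<^sup>2 + (2 * b * S * v + b\<^sup>2 * (v * v))"
        by (simp add: power2_eq_square algebra_simps)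
      also have "\<dots> \<le> S\<^sup>2 + (2 * b * S * 1 + b\<^sup>2 * (1 * v))"
        using v b S by (intro add_left_mono add_mono mult_left_mono mult_right_mono) auto
      finally have "?w \<xi> * (dyadic_gauss (Suc n) \<xi>)\<^sup>2 \<le> ?w \<xi> * (S\<^sup>2 + (2 * b * S * 1 + b\<^sup>2 * (1 * v)))"
        by (intro mult_left_mono w)
      also have "\<dots> = ?w \<xi> * S\<^sup>2 + (2 * b * (?w \<xi> * S) + b\<^sup>2 * (?w \<xi> * v))" by (simp add: algebra_simps)
      also have "2 * b * (?w \<xi> * S) = (\<Sum>k\<le>n. 2 * b / 2 ^ k * (?w \<xi> * gauss 0 (2 ^ k) \<xi>))"
        by (simp add: S_def dyadic_gauss_def sum_distrib_left mult_ac)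
      finally have "?w \<xi> * (dyadic_gauss (Suc n) \<xi>)\<^sup>2 \<le> ?w \<xi> * S\<^sup>2 + ((\<Sum>k\<le>n. 2 * b / 2 ^ k * (?w \<xi> * gauss 0 (2 ^ k) \<xi>)) + b\<^sup>2 * (?w \<xi> * v))" .
      hence "ennreal (?w \<xi> * (dyadic_gauss (Suc n) \<xi>)\<^sup>2) \<le> ennreal (?w \<xi> * S\<^sup>2 + ((\<Sum>k\<le>n. 2 * b / 2 ^ k * (?w \<xi> * gauss 0 (2 ^ k) \<xi>)) + b\<^sup>2 * (?w \<xi> * v)))"
        by (rule ennreal_leI)
      also have "\<dots> = ennreal (?w \<xi> * S\<^sup>2) + (ennreal (\<Sum>k\<le>n. 2 * b / 2 ^ k * (?w \<xi> * gauss 0 (2 ^ k) \<xi>)) + ennreal (b\<^sup>2 * (?w \<xi> * v)))"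
        using w v b less_imp_le[OF gauss_pos]
        by (subst ennreal_plus, simp, intro add_nonneg_nonneg sum_nonneg mult_nonneg_nonneg, auto)
           (subst ennreal_plus, auto intro!: sum_nonneg)
      also have "ennreal (\<Sum>k\<le>n. 2 * b / 2 ^ k * (?w \<xi> * gauss 0 (2 ^ k) \<xi>)) = (\<Sum>k\<le>n. ennreal (2 * b / 2 ^ k) * ennreal (?w \<xi> * gauss 0 (2 ^ k) \<xi>))"
      proof -
        have "(\<Sum>k\<le>n. ennreal (2 * b / 2 ^ k) * ennreal (?w \<xi> * gauss 0 (2 ^ k) \<xi>)) = (\<Sum>k\<le>n. ennreal (2 * b / 2 ^ k * (?w \<xi> * gauss 0 (2 ^ k) \<xi>)))"
          using b w less_imp_le[OF gauss_pos] by (intro sum.cong refl ennreal_mult[symmetric]) auto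
        also have "\<dots> = ennreal (\<Sum>k\<le>n. 2 * b / 2 ^ k * (?w \<xi> * gauss 0 (2 ^ k) \<xi>))"
          using b w less_imp_le[OF gauss_pos] by (intro sum_ennreal) auto
        finally show ?thesis by (rule sym)
      qed
      also have "ennreal (b\<^sup>2 * (?w \<xi> * v)) = ennreal (b\<^sup>2) * ennreal (?w \<xi> * v)" using w v by (intro ennreal_mult) auto
      finally show "ennreal (?w \<xi> * (dyadic_gauss (Suc n) \<xi>)\<^sup>2) \<le> ennreal (?w \<xi> * (dyadic_gauss n \<xi>)\<^sup>2)
          + ((\<Sum>k\<le>n. ennreal (2 * b / 2 ^ k) * ennreal (?w \<xi> * gauss 0 (2 ^ k) \<xi>))
          + ennreal (b\<^sup>2) * ennreal (?w \<xi> * gauss 0 (2 ^ Suc n) \<xi>))"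
        by (simp only: S_def v_def)
    qed
    also have "\<dots> = (\<integral>\<^sup>+\<xi>. ennreal (?w \<xi> * (dyadic_gauss n \<xi>)\<^sup>2) \<partial>lborel)
          + ((\<Sum>k\<le>n. ennreal (2 * b / 2 ^ k) * (\<integral>\<^sup>+\<xi>. ennreal (?w \<xi> * gauss 0 (2 ^ k) \<xi>) \<partial>lborel))
          + ennreal (b\<^sup>2) * (\<integral>\<^sup>+\<xi>. ennreal (?w \<xi> * gauss 0 (2 ^ Suc n) \<xi>) \<partial>lborel))"
      by (rule nn_integral_combination) auto
    also have "\<dots> \<le> ennreal (3 * C * real (Suc n)) + ((\<Sum>k\<le>n. ennreal (2 * b / 2 ^ k) * ennreal (C * (2 ^ k)\<^sup>2))
          + ennreal (b\<^sup>2) * ennreal (C * (2 ^ Suc n)\<^sup>2))"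
      by (intro add_mono Suc sum_mono mult_left_mono g) auto
    also have "(\<Sum>k\<le>n. ennreal (2 * b / 2 ^ k) * ennreal (C * (2 ^ k)\<^sup>2)) = ennreal (\<Sum>k\<le>n. 2 * b / 2 ^ k * (C * (2 ^ k)\<^sup>2))"
    proof -
      have "(\<Sum>k\<le>n. ennreal (2 * b / 2 ^ k) * ennreal (C * (2 ^ k)\<^sup>2)) = (\<Sum>k\<le>n. ennreal (2 * b / 2 ^ k * (C * (2 ^ k)\<^sup>2)))"
        using b C by (intro sum.cong refl ennreal_mult[symmetric]) auto
      also have "\<dots> = ennreal (\<Sum>k\<le>n. 2 * b / 2 ^ k * (C * (2 ^ k)\<^sup>2))"
        using b C by (intro sum_ennreal) auto
      finally show ?thesis .
    qed
    also have "(\<Sum>k\<le>n. 2 * b / 2 ^ k * (C * (2 ^ k)\<^sup>2)) = 2 * C * b * (\<Sum>k\<le>n. 2 ^ k)"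
      unfolding sum_distrib_left by (intro sum.cong refl) (simp add: power2_eq_square)
    also have "(\<Sum>k\<le>n. 2 ^ k :: real) = 2 ^ Suc n - 1"
      using sum_gp_basic[of "2::real" n] by simp
    also have "ennreal (b\<^sup>2) * ennreal (C * (2 ^ Suc n)\<^sup>2) = ennreal C"
      using C by (simp add: ennreal_mult[symmetric] b_def power_divide)
    also have "ennreal (3 * C * real (Suc n)) + (ennreal (2 * C * b * (2 ^ Suc n - 1)) + ennreal C)
       \<le> ennreal (3 * C * real (Suc n)) + (ennreal (2 * C) + ennreal C)"
    proof -
      have "b * (2 ^ Suc n - 1) \<le> 1" by (simp add: b_def field_simps)
      hence "2 * C * (b * (2 ^ Suc n - 1)) \<le> 2 * C * 1" using C by (intro mult_left_mono) auto
      thus ?thesis by (intro add_left_mono add_right_mono ennreal_leI) (simp add: mult.assoc)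
    qed
    also have "\<dots> = ennreal (3 * C * real (Suc (Suc n)))"
      using C by (simp add: ennreal_plus[symmetric] algebra_simps del: ennreal_plus)
    finally show ?case .
  qed
  thus ?thesis by (simp add: C_def)
qed

text \<open>The set where the function exceeds its essential supremum is null and open, hence empty.
  This makes the value at the single point 0 usable as a test.\<close>

lemma maximal_function_le_esssup:
  assumes f: "integrable lborel (fourier f)"
  shows "maximal_function a f x \<le> esssup lborel (maximal_function a f)"
proof (rule ccontr)
  define B where "B = esssup lborel (maximal_function a f)"
  let ?U = "{x. B < maximal_function a f x}"
  assume "\<not> maximal_function a f x \<le> esssup lborel (maximal_function a f)"
  hence x: "x \<in> ?U" by (simp add: B_def)
  have open_U: "open ?U" by (rule maximal_function_superlevel_open[OF f])
  then obtain e where e: "0 < e" "ball x e \<subseteq> ?U" using x by (meson open_contains_ball)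
  have "{x..x + e / 2} \<subseteq> ball x e" using e by (auto simp: dist_real_def)
  hence "emeasure lborel {x..x + e / 2} \<le> emeasure lborel ?U"
    using e open_U by (intro emeasure_mono) auto
  moreover have "emeasure lborel ?U = 0"
    using esssup_zero_measure[of lborel "maximal_function a f"] by (simp add: B_def)
  ultimately show False using e by simp
qed

text \<open>The value at the origin grows at least like n + 1, the Sobolev norm at most like its
  square root; no constant can relate them for all n.\<close>

lemma not_maximal_estimate_sup_half: "\<not> maximal_estimate a \<infinity> (1 / 2)"
proof
  assume "maximal_estimate a \<infinity> (1 / 2)"
  then obtain C0 where C0: "\<And>f. schwartz f \<Longrightarrow> Lq_norm \<infinity> (maximal_function a f) \<le> ennreal C0 * sobolev_norm (1 / 2) f"
    unfolding maximal_estimate_def by blast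
  define C where "C = max C0 0"
  have C: "0 \<le> C" "C0 \<le> C" by (auto simp: C_def)
  define K where "K = C\<^sup>2 * (6 * sqrt (2 * pi))"
  have "real (Suc n) \<le> K" for n
  proof -
    let ?f = "dyadic_packet n"
    have ff: "fourier ?f = (\<lambda>\<xi>. of_real (dyadic_gauss n \<xi>))" using fourier_dyadic_packet by auto
    have int: "integrable lborel (fourier ?f)" unfolding ff using dyadic_gauss_integral(1)[of n] by simp
    have P: "propagator a 0 ?f 0 = of_real (real (Suc n) * sqrt (2 * pi))"
      unfolding propagator_eq ff using dyadic_gauss_integral(2)[of n] by (simp add: plane_wave_def)
    have "1 \<le> sqrt (2 * pi)" using pi_gt3 by (intro real_le_rsqrt) simp
    have "real (Suc n) \<le> cmod (propagator a 0 ?f 0)"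
    proof -
      have "real (Suc n) * 1 \<le> real (Suc n) * sqrt (2 * pi)"
        using \<open>1 \<le> sqrt (2 * pi)\<close> by (intro mult_left_mono) auto
      also have "\<dots> \<le> cmod (propagator a 0 ?f 0)" unfolding P norm_of_real by (rule abs_ge_self)
      finally show ?thesis by simp
    qed
    hence "ennreal (real (Suc n)) \<le> ennreal (cmod (propagator a 0 ?f 0))" by (rule ennreal_leI)
    also have "\<dots> \<le> maximal_function a ?f 0" by (rule maximal_function_ge_time_zero[OF int])
    also have "\<dots> \<le> esssup lborel (maximal_function a ?f)" by (rule maximal_function_le_esssup[OF int])
    also have "\<dots> = Lq_norm \<infinity> (maximal_function a ?f)" by (simp add: Lq_norm_def)
    also have "\<dots> \<le> ennreal C0 * sobolev_norm (1 / 2) ?f" by (intro C0 schwartz_dyadic_packet)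
    also have "\<dots> \<le> ennreal C * ennreal ((6 * sqrt (2 * pi) * real (Suc n)) powr (1 / 2))"
    proof (intro mult_mono ennreal_leI C)
      have "sobolev_norm (1 / 2) ?f \<le> ennreal_power (ennreal (6 * sqrt (2 * pi) * real (Suc n))) (1 / 2)"
        unfolding sobolev_norm_def ff using weighted_dyadic_gauss_square[of n]
        by (intro ennreal_power_mono) (auto simp: norm_of_real)
      thus "sobolev_norm (1 / 2) ?f \<le> ennreal ((6 * sqrt (2 * pi) * real (Suc n)) powr (1 / 2))"
        by (simp add: ennreal_power_ennreal)
    qed auto
    also have "\<dots> = ennreal (C * sqrt (6 * sqrt (2 * pi) * real (Suc n)))"
      using C by (simp add: ennreal_mult' powr_half_sqrt)
    finally have "real (Suc n) \<le> C * sqrt (6 * sqrt (2 * pi) * real (Suc n))"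
      using C by (subst (asm) ennreal_le_iff) auto
    hence "(real (Suc n))\<^sup>2 \<le> (C * sqrt (6 * sqrt (2 * pi) * real (Suc n)))\<^sup>2"
      by (intro power_mono) auto
    also have "\<dots> = K * real (Suc n)" by (simp add: K_def power_mult_distrib del: of_nat_Suc)
    finally have "real (Suc n) * real (Suc n) \<le> K * real (Suc n)" by (simp only: power2_eq_square)
    thus ?thesis by (simp del: of_nat_Suc)
  qed
  moreover obtain n where "K < real n" using reals_Archimedean2 by blast
  ultimately show False by (metis less_le_not_le of_nat_Suc order.strict_trans1 less_add_one add.commute)
qed

theorem theorem1p2:
  fixes a :: real
  assumes "a > 1"
  shows "(\<forall>(q::real) (s::real). 1 \<le> q \<and> q < 2 \<longrightarrow> \<not> maximal_estimate a (ennreal q) s) \<and>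
    (\<forall>s::real. (s > a / 4 \<longrightarrow> maximal_estimate a 2 s) \<and>
               (s < a / 4 \<longrightarrow> \<not> maximal_estimate a 2 s)) \<and>
    (\<forall>(q::real) (s::real). 2 < q \<and> q < 4 \<longrightarrow>
       (maximal_estimate a (ennreal q) s \<longleftrightarrow> s \<ge> 1 / 2 - a / 4 + a / q - 1 / q)) \<and>
    (\<forall>(q::real) (s::real). 4 \<le> q \<longrightarrow>
       (maximal_estimate a (ennreal q) s \<longleftrightarrow> s \<ge> 1 / 2 - 1 / q)) \<and>
    (\<forall>s::real. maximal_estimate a \<infinity> s \<longleftrightarrow> s > 1 / 2)"
proof (intro conjI allI impI iffI)
  fix q s :: real assume "1 \<le> q \<and> q < 2"
  thus "\<not> maximal_estimate a (ennreal q) s" using maximal_estimate_imp_exponent_ge_2[of a q s] by auto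
next
  fix s :: real assume "s > a / 4"
  thus "maximal_estimate a 2 s" by (rule maximal_estimate_square[OF assms])
next
  fix s :: real assume s: "s < a / 4"
  show "\<not> maximal_estimate a 2 s"
  proof
    assume "maximal_estimate a 2 s"
    hence "maximal_estimate a (ennreal 2) s" by simp
    from maximal_estimate_imp_ge_travelling[OF assms this] s show False by simp
  qed
next
  fix q s :: real assume q: "2 < q \<and> q < 4" and "maximal_estimate a (ennreal q) s"
  thus "s \<ge> 1 / 2 - a / 4 + a / q - 1 / q" using maximal_estimate_imp_ge_travelling[OF assms, of q s] by auto
next
  fix q s :: real assume q: "2 < q \<and> q < 4" and s: "s \<ge> 1 / 2 - a / 4 + a / q - 1 / q"
  show "maximal_estimate a (ennreal q) s"
    by (rule maximal_estimate_mono[OF maximal_estimate_medium_exponent s]) (use assms q in auto)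
next
  fix q s :: real assume q: "4 \<le> q" and "maximal_estimate a (ennreal q) s"
  thus "s \<ge> 1 / 2 - 1 / q" using maximal_estimate_imp_ge_concentration[of a q s] by simp
next
  fix q s :: real assume q: "4 \<le> q" and s: "s \<ge> 1 / 2 - 1 / q"
  show "maximal_estimate a (ennreal q) s"
    by (rule maximal_estimate_mono[OF maximal_estimate_large_exponent[OF assms q] s])
next
  fix s :: real assume "maximal_estimate a \<infinity> s"
  \<comment> \<open>For s \<le> 1/2 monotonicity in s would give the estimate at 1/2 itself.\<close>
  thus "s > 1 / 2" using maximal_estimate_mono[of a \<infinity> s "1 / 2"] not_maximal_estimate_sup_half[of a] by force
next
  fix s :: real assume "s > 1 / 2"
  thus "maximal_estimate a \<infinity> s" by (rule maximal_estimate_sup)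
qed

end
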